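(* (Optimality of the threshold $s<\frac12$.) Let $a(x)=1$ for $x<0$ and $a(x)=2$ for $x\ge0$, and let $u_0$ be an arbitrary smooth compactly supported function on $\mathbb{R}$. Assume that the Cauchy problem $$\partial_tu-a(x)\partial_x^2u=0,\quad 0<t\le T,\ x\in\mathbb{R},\qquad u(0,x)=u_0(x),$$ admits a unique strong solution $u$ satisfying $$\sup_{0\le t\le T}\|\partial_xu(t,\cdot)\|_{H^{1/2}(\mathbb{R})}^2+\int_0^T\|\partial_x^2u\|_{H^{1/2}(\mathbb{R})}^2\,dt\lesssim\|u_0\|_{\dot H^1\cap\dot H^{3/2}(\mathbb{R})}^2 .$$ Then $u$ is given, for $x<0$, by $$u(t,x)=\int_0^\infty(2-\sqrt2)\frac{1}{\sqrt{4\pi t}}e^{-\frac{(\sqrt2x-y)^2}{8t}}u_0(y)\,dy+\int_{-\infty}^0\left[\frac{1}{\sqrt{4\pi t}}e^{-\frac{(x-y)^2}{4t}}+(3-2\sqrt2)\frac{1}{\sqrt{4\pi t}}e^{-\frac{(x+y)^2}{4t}}\right]u_0(y)\,dy,$$ and, for $x>0$, by $$u(t,x)=\int_{-\infty}^0(4\sqrt2-4)\frac{1}{\sqrt{8\pi t}}e^{-\frac{(x-\sqrt2y)^2}{8t}}u_0(y)\,dy+\int_0^\infty\left[\frac{1}{\sqrt{8\pi t}}e^{-\frac{(x-y)^2}{8t}}+(2\sqrt2-3)\frac{1}{\sqrt{8\pi t}}e^{-\frac{(x+y)^2}{8t}}\right]u_0(y)\,dy;$$ moreover, since $\partial_x^2u\in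 L^2_tH^{1/2}_x$, it must hold that $\partial_x^2u(t,0-)=\partial_x^2u(t,0+)$ for almost all $t>0$. However, this fails unless $$\sqrt2\,u_0''(z)+u_0''(-z)\equiv0\qquad\text{for all }z\ge0 .$$ Thus the threshold $s<\frac12$ (for solutions with $\partial_xu\in L^\infty_tH^s_x$, $\partial_x^2u\in L^2_tH^s_x$) is optimal: higher regularity cannot be expected even for smooth compactly supported initial data and zero force.
   Context: $A\lesssim B$ means $A\le cB$ for some absolute constant $c$. Sobolev norms: $\|g\|_{\dot H^r}^2=\int_{\mathbb{R}}|\xi|^{2r}|\hat g(\xi)|^2d\xi$, $\|g\|_{H^r}^2=\int_{\mathbb{R}}(1+|\xi|^2)^r|\hat g(\xi)|^2d\xi$, and the norm of $\dot H^1\cap\dot H^{3/2}$ is the sum of the two norms. $\partial_x^2u(t,0\pm)$ denote the one-sided limits at $x=0$. "Strong solution" is used in its usual sense.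
   Formalization: The printed condition √2 u0''(z)+u0''(−z)=0 is false for single data; the one proved for each u0 is √2 u0''(√2 z)+u0''(−z)=0 for z≥0. The printed one is kept only under the (untenable) assumption that the problem is solvable for all u0 with one constant. *)

theory Defs
  imports "HOL-Analysis.Analysis"
begin

section \<open>Test functions and weak derivatives\<close>

definition test_function :: "(real \<Rightarrow> real) \<Rightarrow> bool" where
  "test_function \<phi> \<longleftrightarrow>
     (\<forall>n x. ((deriv ^^ n) \<phi>) differentiable (at x)) \<and> compact (closure {x. \<phi> x \<noteq> 0})"

definition locally_integrable_on :: "('a::euclidean_space \<Rightarrow> real) \<Rightarrow> 'a set \<Rightarrow> bool" where
  "locally_integrable_on f U \<longleftrightarrow> (\<forall>K. compact K \<and> K \<subseteq> U \<longrightarrow> set_integrable lborel K f)"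

definition weak_deriv :: "nat \<Rightarrow> (real \<Rightarrow> real) \<Rightarrow> (real \<Rightarrow> real) \<Rightarrow> bool" where
  "weak_deriv k f g \<longleftrightarrow>
     locally_integrable_on f UNIV \<and> locally_integrable_on g UNIV \<and>
     (\<forall>\<phi>. test_function \<phi> \<longrightarrow>
        (LINT x|lborel. f x * (deriv ^^ k) \<phi> x) = (- 1) ^ k * (LINT x|lborel. g x * \<phi> x))"

text \<open>A smooth function of \<open>(t, x)\<close> is given together with all its partial derivatives:
  \<open>D i j\<close> is the derivative of \<open>D 0 0\<close> of order \<open>i\<close> in \<open>t\<close> and \<open>j\<close> in \<open>x\<close>.\<close>

definition smooth_with_partials :: "(nat \<Rightarrow> nat \<Rightarrow> real \<times> real \<Rightarrow> real) \<Rightarrow> bool" where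
  "smooth_with_partials D \<longleftrightarrow>
     (\<forall>i j p. (D i j has_derivative (\<lambda>h. fst h * D (Suc i) j p + snd h * D i (Suc j) p)) (at p))"

definition weak_partial ::
  "(real \<times> real) set \<Rightarrow> nat \<Rightarrow> nat \<Rightarrow> (real \<times> real \<Rightarrow> real) \<Rightarrow> (real \<times> real \<Rightarrow> real) \<Rightarrow> bool" where
  "weak_partial \<Omega> i j v w \<longleftrightarrow>
     locally_integrable_on v \<Omega> \<and> locally_integrable_on w \<Omega> \<and>
     (\<forall>D. smooth_with_partials D \<and> compact (closure {p. D 0 0 p \<noteq> 0}) \<and>
          closure {p. D 0 0 p \<noteq> 0} \<subseteq> \<Omega> \<longrightarrow>
        (LINT p|lborel. v p * D i j p) = (- 1) ^ (i + j) * (LINT p|lborel. w p * D 0 0 p))"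


section \<open>Sobolev norms\<close>

definition fourier :: "(real \<Rightarrow> real) \<Rightarrow> real \<Rightarrow> complex" where
  "fourier g \<xi> = (LINT x|lborel. cis (- (x * \<xi>)) * complex_of_real (g x))"

text \<open>The Fourier transform of a square integrable function is the \<open>L\<^sup>2\<close> limit of the transforms of
  its truncations; it is determined up to a null set.\<close>

definition has_fourier :: "(real \<Rightarrow> real) \<Rightarrow> (real \<Rightarrow> complex) \<Rightarrow> bool" where
  "has_fourier g h \<longleftrightarrow>
     g \<in> borel_measurable borel \<and> (\<integral>\<^sup>+x. ennreal ((g x)\<^sup>2) \<partial>lborel) < \<infinity> \<and>
     h \<in> borel_measurable borel \<and>
     ((\<lambda>R. \<integral>\<^sup>+\<xi>. ennreal ((cmod (h \<xi> - fourier (\<lambda>x. indicat_real {-R..R} x * g x) \<xi>))\<^sup>2) \<partial>lborel)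
        \<longlongrightarrow> 0) at_top"

text \<open>Squared norm of \<open>H\<^sup>r\<close> for \<open>r \<ge> 0\<close>. The infimum ranges over the representatives of the
  transform, which all give the same value; it is \<open>\<infinity>\<close> when \<open>g\<close> is not square integrable.\<close>

definition sobolev_norm_sq :: "real \<Rightarrow> (real \<Rightarrow> real) \<Rightarrow> ennreal" where
  "sobolev_norm_sq r g =
     (INF h\<in>{h. has_fourier g h}. \<integral>\<^sup>+\<xi>. ennreal ((1 + \<xi>\<^sup>2) powr r * (cmod (h \<xi>))\<^sup>2) \<partial>lborel)"

text \<open>Squared \<open>H\<^sup>r\<close> norm of the weak derivative of order \<open>k\<close> (unique up to a null set);
  \<open>\<infinity>\<close> if there is no such derivative.\<close>

definition deriv_sobolev_norm_sq :: "nat \<Rightarrow> real \<Rightarrow> (real \<Rightarrow> real) \<Rightarrow> ennreal" where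
  "deriv_sobolev_norm_sq k r f = (INF g\<in>{g. weak_deriv k f g}. sobolev_norm_sq r g)"

text \<open>Only meant for functions such as test functions, for which the integrals converge.\<close>

definition homogeneous_norm :: "real \<Rightarrow> (real \<Rightarrow> real) \<Rightarrow> real" where
  "homogeneous_norm r g = sqrt (LINT \<xi>|lborel. \<bar>\<xi>\<bar> powr (2 * r) * (cmod (fourier g \<xi>))\<^sup>2)"


section \<open>The Cauchy problem\<close>

definition coeff_a :: "real \<Rightarrow> real" where
  "coeff_a x = (if x < 0 then 1 else 2)"

text \<open>Among the functions equal almost everywhere, the representative continuous up to \<open>t = 0\<close> is
  taken, so that the initial condition and the values \<open>u t x\<close> are meaningful.\<close>

definition strong_solution :: "real \<Rightarrow> (real \<Rightarrow> real) \<Rightarrow> (real \<Rightarrow> real \<Rightarrow> real) \<Rightarrow> bool" where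
  "strong_solution T u0 u \<longleftrightarrow>
     continuous_on ({0..T} \<times> UNIV) (\<lambda>(t, x). u t x) \<and>
     (\<forall>x. u 0 x = u0 x) \<and>
     (\<exists>ut uxx. weak_partial ({0<..<T} \<times> UNIV) 1 0 (\<lambda>(t, x). u t x) ut \<and>
               weak_partial ({0<..<T} \<times> UNIV) 0 2 (\<lambda>(t, x). u t x) uxx \<and>
               (AE p in lborel. p \<in> {0<..<T} \<times> UNIV \<longrightarrow> ut p - coeff_a (snd p) * uxx p = 0))"

text \<open>It is finite iff \<open>u\<^sub>x\<close> is in \<open>L\<^sup>\<infinity>\<^sub>t H\<^sup>s\<^sub>x\<close> and \<open>u\<^sub>x\<^sub>x\<close> is in \<open>L\<^sup>2\<^sub>t H\<^sup>s\<^sub>x\<close>.\<close>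

definition regularity_sq :: "real \<Rightarrow> real \<Rightarrow> (real \<Rightarrow> real \<Rightarrow> real) \<Rightarrow> ennreal" where
  "regularity_sq s T u =
     (SUP t\<in>{0..T}. deriv_sobolev_norm_sq 1 s (u t)) +
     (\<integral>\<^sup>+t\<in>{0..T}. deriv_sobolev_norm_sq 2 s (u t) \<partial>lborel)"

definition bounded_strong_solution ::
  "real \<Rightarrow> real \<Rightarrow> (real \<Rightarrow> real) \<Rightarrow> (real \<Rightarrow> real \<Rightarrow> real) \<Rightarrow> bool" where
  "bounded_strong_solution c T u0 u \<longleftrightarrow>
     strong_solution T u0 u \<and>
     regularity_sq (1/2) T u \<le> ennreal (c * (homogeneous_norm 1 u0 + homogeneous_norm (3/2) u0)\<^sup>2)"

definition unique_bounded_strong_solution ::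
  "real \<Rightarrow> real \<Rightarrow> (real \<Rightarrow> real) \<Rightarrow> (real \<Rightarrow> real \<Rightarrow> real) \<Rightarrow> bool" where
  "unique_bounded_strong_solution c T u0 u \<longleftrightarrow>
     bounded_strong_solution c T u0 u \<and>
     (\<forall>v. bounded_strong_solution c T u0 v \<longrightarrow> (\<forall>t\<in>{0..T}. \<forall>x. v t x = u t x))"


section \<open>The explicit formula\<close>

definition explicit_left :: "(real \<Rightarrow> real) \<Rightarrow> real \<Rightarrow> real \<Rightarrow> real" where
  "explicit_left u0 t x =
     (LINT y:{0..}|lborel.
        (2 - sqrt 2) * (1 / sqrt (4 * pi * t)) * exp (- (sqrt 2 * x - y)\<^sup>2 / (8 * t)) * u0 y) +
     (LINT y:{..0}|lborel.
        (1 / sqrt (4 * pi * t) * exp (- (x - y)\<^sup>2 / (4 * t)) +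
         (3 - 2 * sqrt 2) * (1 / sqrt (4 * pi * t)) * exp (- (x + y)\<^sup>2 / (4 * t))) * u0 y)"

definition explicit_right :: "(real \<Rightarrow> real) \<Rightarrow> real \<Rightarrow> real \<Rightarrow> real" where
  "explicit_right u0 t x =
     (LINT y:{..0}|lborel.
        (4 * sqrt 2 - 4) * (1 / sqrt (8 * pi * t)) * exp (- (x - sqrt 2 * y)\<^sup>2 / (8 * t)) * u0 y) +
     (LINT y:{0..}|lborel.
        (1 / sqrt (8 * pi * t) * exp (- (x - y)\<^sup>2 / (8 * t)) +
         (2 * sqrt 2 - 3) * (1 / sqrt (8 * pi * t)) * exp (- (x + y)\<^sup>2 / (8 * t))) * u0 y)"

text \<open>The two formulas have the same limit at the interface \<open>x = 0\<close>.\<close>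

definition explicit_solution :: "(real \<Rightarrow> real) \<Rightarrow> real \<Rightarrow> real \<Rightarrow> real" where
  "explicit_solution u0 t x = (if x < 0 then explicit_left u0 t x else explicit_right u0 t x)"

text \<open>\<open>f''(0-) = f''(0+)\<close>, both one-sided limits existing.\<close>

definition second_deriv_matches :: "(real \<Rightarrow> real) \<Rightarrow> bool" where
  "second_deriv_matches f \<longleftrightarrow>
     (\<exists>l. ((deriv ^^ 2) f \<longlongrightarrow> l) (at_left 0) \<and> ((deriv ^^ 2) f \<longlongrightarrow> l) (at_right 0))"

end

theory Submission
  imports Defs "HOL-Probability.Probability"
begin

text \<open>Integrating a strong solution in time gives \<open>F = \<integral>\<^sub>0\<^sup>t u\<close> with \<open>F\<^sub>x\<^sub>x = (u(t) - u\<^sub>0) / a\<close> weakly, that is, an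
  identity between second differences of \<open>F\<close> and averages of \<open>(u(t) - u\<^sub>0) / a\<close>, which makes sense across
  the interface. The bound on \<open>\<partial>\<^sub>xu\<close> in \<open>L\<^sup>\<infinity>\<^sub>tL\<^sup>2\<^sub>x\<close> forces at most linear growth, so a maximum principle for
  second differences identifies \<open>u\<close> with the explicit formula. The latter is \<open>C\<^sup>1\<close> across \<open>x = 0\<close> and
  satisfies \<open>u\<^sub>t = a u\<^sub>x\<^sub>x\<close> up to the interface on both sides, so \<open>u\<^sub>x\<^sub>x\<close> jumps there by \<open>u\<^sub>t(t, 0) / 2\<close>.
  A function in \<open>H\<^sup>1\<^sup>/\<^sup>2\<close> has no jump; by continuity in \<open>t\<close>, \<open>u\<^sub>t(t, 0) = 0\<close> for all \<open>t < T\<close>. Hence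
  \<open>u(t, 0)\<close> is constant in \<open>t\<close>; since it is the integral of \<open>(4 - 2\<surd>2) u\<^sub>0(-z) + (2\<surd>2 - 2) u\<^sub>0(\<surd>2 z)\<close>
  against the half-line heat kernel, completeness of Gaussians shows that this combination vanishes for
  \<open>z > 0\<close>. Two derivatives give the stated relation, which a bump supported in \<open>[0, 1]\<close> violates.\<close>

section \<open>Smooth functions and test functions\<close>

text \<open>The obstacle is the interface combined with the weak notion of solution: the weak
  derivatives are only locally integrable in the open strip, nothing is prescribed at
  \<open>x = 0\<close>, and \<open>1 / a\<close> is no admissible factor of a smooth test function.
  Integration in time removes the time derivative and lets the datum enter through continuity at
  \<open>t = 0\<close>. Testing with mollified tents in \<open>x\<close> leaves a derivative-free
  identity on every interval, whether or not it contains 0. The explicit formula satisfies the same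
  identity because its values and slopes match at 0, so no transmission condition has to be derived
  for the unknown solution. Completeness comes from sampling the constant trace at the times
  \<open>T / (2 * N)\<close>, \<open>N = 1, 2, ...\<close>: after rescaling, the Gaussian weights
  are the powers of the single function \<open>exp (- w^2 / 2)\<close>, and a moment problem on
  [0, 1] remains. As lengths on the right are measured in units of \<open>sqrt 2\<close>, the
  resulting relation pairs \<open>u0 (- z)\<close> with \<open>u0 (sqrt 2 * z)\<close>, and so does
  its second derivative.\<close>

definition smooth :: "(real \<Rightarrow> real) \<Rightarrow> bool" where
  "smooth f \<longleftrightarrow> (\<forall>n x. ((deriv ^^ n) f) differentiable (at x))"

text \<open>A class of functions that is closed under differentiation contains all iterated
  derivatives of its members. Smoothness is thus proved by exhibiting an invariant class instead of
  computing derivatives of every order.\<close>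

lemma smooth_coinduct:
  assumes "P f"
    and step: "\<And>f. P f \<Longrightarrow> \<exists>f'. (\<forall>x. (f has_real_derivative f' x) (at x)) \<and> P f'"
  shows "smooth f"
proof -
  have P_deriv: "P (deriv f)" if "P f" for f
  proof -
    obtain f' where f': "\<And>x. (f has_real_derivative f' x) (at x)" "P f'"
      using step[OF \<open>P f\<close>] by blast
    then have "deriv f = f'"
      by (auto intro: DERIV_imp_deriv)
    with f' show ?thesis by simp
  qed
  have "P ((deriv ^^ n) f)" for n
    by (induction n) (auto simp: P_deriv \<open>P f\<close>)
  then show ?thesis
    unfolding smooth_def real_differentiable_def using step by blast
qed

lemma smooth_imp_DERIV: "smooth f \<Longrightarrow> (f has_real_derivative deriv f x) (at x)"
  unfolding smooth_def DERIV_deriv_iff_real_differentiable by (drule spec[of _ 0]) simp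

lemma smooth_deriv: "smooth f \<Longrightarrow> smooth (deriv f)"
  unfolding smooth_def
proof (intro allI)
  fix n x
  assume "\<forall>n x. (deriv ^^ n) f differentiable at x"
  then have "(deriv ^^ Suc n) f differentiable at x" by blast
  then show "(deriv ^^ n) (deriv f) differentiable at x"
    by (simp only: funpow_Suc_right o_apply)
qed

lemma smooth_funpow_deriv: "smooth f \<Longrightarrow> smooth ((deriv ^^ n) f)"
  by (induction n) (auto simp: smooth_deriv)

text \<open>The invariant class consists of the smooth functions together with \<open>f\<close>.
  This is the form in which primitives of smooth functions are seen to be smooth.\<close>

lemma smoothI:
  assumes "\<And>x. (f has_real_derivative f' x) (at x)" "smooth f'"
  shows "smooth f"
proof (rule smooth_coinduct[where P = "\<lambda>g. g = f \<or> smooth g"])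
  show "\<exists>g'. (\<forall>x. (g has_real_derivative g' x) (at x)) \<and> (g' = f \<or> smooth g')"
    if "g = f \<or> smooth g" for g
    using that
  proof
    assume "g = f"
    then show ?thesis using assms by (intro exI[of _ f']) auto
  next
    assume "smooth g"
    then show ?thesis
      by (intro exI[of _ "deriv g"]) (auto simp: smooth_imp_DERIV smooth_deriv)
  qed
qed simp

text \<open>The products of two smooth functions are not closed under differentiation, since the
  product rule produces sums of products. The closure under sums, products and affine substitutions
  is, so the coinduction principle applies to it.\<close>

inductive smooth_alg :: "(real \<Rightarrow> real) \<Rightarrow> bool" where
  base: "smooth f \<Longrightarrow> smooth_alg f"
| add: "smooth_alg f \<Longrightarrow> smooth_alg g \<Longrightarrow> smooth_alg (\<lambda>x. f x + g x)"
| mult: "smooth_alg f \<Longrightarrow> smooth_alg g \<Longrightarrow> smooth_alg (\<lambda>x. f x * g x)"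
| affine: "smooth_alg f \<Longrightarrow> smooth_alg (\<lambda>x. f (c * x + d))"

lemma smooth_const: "smooth (\<lambda>x. c)"
  by (rule smooth_coinduct[where P = "\<lambda>f. \<exists>c. f = (\<lambda>x. c)"])
     (auto intro!: exI[of _ "\<lambda>x. 0"] derivative_eq_intros)

lemma smooth_alg_imp_smooth:
  assumes "smooth_alg f"
  shows "smooth f"
  using assms
proof (rule smooth_coinduct[where P = smooth_alg])
  fix f assume "smooth_alg f"
  then have "(\<forall>x. (f has_real_derivative deriv f x) (at x)) \<and> smooth_alg (deriv f)"
  proof induction
    case (base f)
    then show ?case
      by (simp add: smooth_imp_DERIV smooth_deriv smooth_alg.base)
  next
    case (add f g)
    have *: "((\<lambda>x. f x + g x) has_real_derivative deriv f x + deriv g x) (at x)" for x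
      by (rule DERIV_add) (simp_all add: add.IH)
    then have "deriv (\<lambda>x. f x + g x) = (\<lambda>x. deriv f x + deriv g x)"
      by (intro ext DERIV_imp_deriv)
    with * show ?case by (simp add: add.IH smooth_alg.add)
  next
    case (mult f g)
    have *: "((\<lambda>x. f x * g x) has_real_derivative deriv f x * g x + deriv g x * f x) (at x)" for x
      by (rule DERIV_mult) (simp_all add: mult.IH)
    then have "deriv (\<lambda>x. f x * g x) = (\<lambda>x. deriv f x * g x + deriv g x * f x)"
      by (intro ext DERIV_imp_deriv)
    with * show ?case by (simp add: mult smooth_alg.add smooth_alg.mult)
  next
    case (affine f c d)
    have *: "((\<lambda>x. f (c * x + d)) has_real_derivative deriv f (c * x + d) * c) (at x)" for x
      by (rule DERIV_chain2[where f = f]) (auto simp: affine.IH intro!: derivative_eq_intros)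
    then have "deriv (\<lambda>x. f (c * x + d)) = (\<lambda>x. deriv f (c * x + d) * c)"
      by (intro ext DERIV_imp_deriv)
    with * show ?case
      by (simp add: affine smooth_alg.mult smooth_alg.affine smooth_alg.base smooth_const)
  qed
  then show "\<exists>f'. (\<forall>x. (f has_real_derivative f' x) (at x)) \<and> smooth_alg f'"
    by (intro exI[of _ "deriv f"])
qed

lemma smooth_add: "smooth f \<Longrightarrow> smooth g \<Longrightarrow> smooth (\<lambda>x. f x + g x)"
  by (rule smooth_alg_imp_smooth, rule smooth_alg.add) (rule smooth_alg.base, assumption)+

lemma smooth_mult: "smooth f \<Longrightarrow> smooth g \<Longrightarrow> smooth (\<lambda>x. f x * g x)"
  by (rule smooth_alg_imp_smooth, rule smooth_alg.mult) (rule smooth_alg.base, assumption)+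

lemma smooth_affine: "smooth f \<Longrightarrow> smooth (\<lambda>x. f (c * x + d))"
  by (rule smooth_alg_imp_smooth, rule smooth_alg.affine, rule smooth_alg.base)

section \<open>A flat function, a normalised bump and its primitives\<close>

lemma tendsto_poly_times_exp_minus:
  "((\<lambda>y. poly p y * exp (- y)) \<longlongrightarrow> 0) (at_top :: real filter)"
proof -
  have "((\<lambda>y. \<Sum>i\<le>degree p. coeff p i * (y ^ i / exp y)) \<longlongrightarrow> (\<Sum>i\<le>degree p. coeff p i * 0)) at_top"
    by (intro tendsto_intros tendsto_power_div_exp_0)
  moreover have "poly p y * exp (- y) = (\<Sum>i\<le>degree p. coeff p i * (y ^ i / exp y))" for y
    by (simp add: poly_altdef exp_minus sum_distrib_right divide_inverse mult.assoc)
  ultimately show ?thesis by simp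
qed

definition flat :: "real \<Rightarrow> real" where
  "flat x = (if x \<le> 0 then 0 else exp (- (1 / x)))"

text \<open>The invariant class consists of the functions \<open>P(1/x) exp(-1/x)\<close> for
  \<open>x > 0\<close>, extended by 0, with \<open>P\<close> a polynomial. In the variable
  \<open>y = 1/x\<close> differentiation replaces \<open>P\<close> by \<open>y^2 (P - P')\<close>,
  and the difference quotient at 0 replaces \<open>P\<close> by \<open>y P\<close>, which still
  loses against the exponential.\<close>

lemma smooth_flat: "smooth flat"
proof (rule smooth_coinduct[where
      P = "\<lambda>f. \<exists>p. f = (\<lambda>x. if x \<le> 0 then 0 else poly p (1 / x) * exp (- (1 / x)))"])
  show "\<exists>p. flat = (\<lambda>x. if x \<le> 0 then 0 else poly p (1 / x) * exp (- (1 / x)))"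
    by (rule exI[of _ 1]) (auto simp: flat_def)
next
  fix f :: "real \<Rightarrow> real"
  assume "\<exists>p. f = (\<lambda>x. if x \<le> 0 then 0 else poly p (1 / x) * exp (- (1 / x)))"
  then obtain p where f: "f = (\<lambda>x. if x \<le> 0 then 0 else poly p (1 / x) * exp (- (1 / x)))"
    by blast
  define q where "q = [:0, 0, 1:] * (p - pderiv p)"
  define f' where "f' = (\<lambda>x. if x \<le> 0 then 0 else poly q (1 / x) * exp (- (1 / x)))"
  have "(f has_real_derivative f' x) (at x)" for x
  proof -
    consider "x < 0" | "x = 0" | "x > 0" by linarith
    then show ?thesis
    proof cases
      case 1
      have "((\<lambda>x. 0) has_real_derivative f' x) (at x)"
        using 1 by (simp add: f'_def)
      then show ?thesis
        by (rule DERIV_cong_ev[THEN iffD1, rotated -1])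
           (use 1 in \<open>auto simp: f eventually_at_topological intro!: exI[of _ "{..<0}"] simp: eventually_nhds\<close>)
    next
      case 3
      have "((\<lambda>x. poly p (1 / x) * exp (- (1 / x))) has_real_derivative f' x) (at x)"
        using 3
        by (auto simp: f'_def q_def field_simps power2_eq_square intro!: derivative_eq_intros)
      then show ?thesis
        by (rule DERIV_cong_ev[THEN iffD1, rotated -1])
           (use 3 in \<open>auto simp: f eventually_nhds intro!: exI[of _ "{0<..}"]\<close>)
    next
      case 2
      have "((\<lambda>x. poly (pCons 0 p) (1 / x) * exp (- (1 / x))) \<longlongrightarrow> 0) (at_right 0)"
        using filterlim_compose[OF tendsto_poly_times_exp_minus[of "pCons 0 p"]
            filterlim_inverse_at_top_right]
        by (simp only: inverse_eq_divide)
      then have "((\<lambda>x. f x / x) \<longlongrightarrow> 0) (at_right 0)"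
        by (rule Lim_transform_eventually)
           (auto simp: f eventually_at_right_field field_simps intro!: exI[of _ 1])
      moreover have "((\<lambda>x. f x / x) \<longlongrightarrow> 0) (at_left 0)"
        by (rule Lim_transform_eventually[of "\<lambda>_. 0"])
           (auto simp: f eventually_at_left_field intro!: exI[of _ "-1"])
      ultimately have "((\<lambda>x. f x / x) \<longlongrightarrow> 0) (at 0)"
        by (rule filterlim_split_at[rotated])
      then show ?thesis
        using 2 by (simp add: has_field_derivative_iff f f'_def)
    qed
  qed
  then show "\<exists>f'. (\<forall>x. (f has_real_derivative f' x) (at x)) \<and>
      (\<exists>p. f' = (\<lambda>x. if x \<le> 0 then 0 else poly p (1 / x) * exp (- (1 / x))))"
    by (intro exI[of _ f'] conjI exI[of _ q]) (auto simp: f'_def)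
qed


lemma flat_pos_iff: "0 < flat x \<longleftrightarrow> 0 < x"
  and flat_nonneg: "0 \<le> flat x"
  and flat_eq_0_iff: "flat x = 0 \<longleftrightarrow> x \<le> 0"
  by (auto simp: flat_def)

lemma smooth_imp_continuous_on: "smooth f \<Longrightarrow> continuous_on A f"
  by (meson DERIV_continuous_on smooth_imp_DERIV has_field_derivative_at_within)

text \<open>\<open>bump\<close>, \<open>smooth_step\<close> and \<open>smooth_ramp\<close> are
  smooth versions of the point mass at 0, the Heaviside function and the positive part, each a
  primitive of the preceding one. The support lies to the right of 0, so that integration may start
  at 0.\<close>

definition bump :: "real \<Rightarrow> real" where
  "bump x = flat x * flat (1 - x) / integral {0..1} (\<lambda>x. flat x * flat (1 - x))"

definition smooth_step :: "real \<Rightarrow> real" where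
  "smooth_step x = integral {0..x} bump"

definition smooth_ramp :: "real \<Rightarrow> real" where
  "smooth_ramp x = integral {0..x} smooth_step"

lemma smooth_flat_product: "smooth (\<lambda>x. flat x * flat (1 - x))"
  using smooth_mult[OF smooth_flat smooth_affine[OF smooth_flat, of "-1" 1]] by simp

lemma flat_product_integral_pos: "0 < integral {0..1} (\<lambda>x. flat x * flat (1 - x))"
proof -
  let ?f = "\<lambda>x. flat x * flat (1 - x)"
  have "?f integrable_on {0..1}"
    by (intro integrable_continuous_real smooth_imp_continuous_on smooth_flat_product)
  then have "0 \<le> integral {0..1} ?f"
    by (intro integral_nonneg) (auto simp: flat_nonneg)
  moreover have "integral {0..1} ?f \<noteq> 0"
  proof
    assume "integral {0..1} ?f = 0"
    then have "(?f has_integral 0) (cbox 0 1)"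
      using \<open>?f integrable_on {0..1}\<close> by (metis cbox_interval integrable_integral)
    then have "?f (1/2) = 0"
      by (intro has_integral_0_cbox_imp_0[of 0 1 ?f "1/2"])
         (auto simp: flat_nonneg intro!: smooth_imp_continuous_on smooth_flat_product)
    then show False by (simp add: flat_eq_0_iff)
  qed
  ultimately show ?thesis by linarith
qed

lemma smooth_bump: "smooth bump"
  using smooth_mult[OF smooth_const smooth_flat_product,
      of "1 / integral {0..1} (\<lambda>x. flat x * flat (1 - x))"]
  by (simp add: bump_def[abs_def])

lemma bump_nonneg: "0 \<le> bump x"
  using flat_product_integral_pos by (simp add: bump_def flat_nonneg)

lemma bump_eq_0: "x \<le> 0 \<or> 1 \<le> x \<Longrightarrow> bump x = 0"
  by (auto simp: bump_def flat_eq_0_iff)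

lemma bump_pos: "0 < x \<Longrightarrow> x < 1 \<Longrightarrow> 0 < bump x"
  using flat_product_integral_pos by (simp add: bump_def flat_pos_iff)

lemma integral_bump: "integral {0..1} bump = 1"
  using flat_product_integral_pos by (simp add: bump_def[abs_def])

text \<open>For \<open>x < 0\<close> the interval is empty and the integral is 0, which is also the
  value of the primitive because \<open>g\<close> vanishes there. Integrating from
  \<open>- N\<close> instead makes \<open>x\<close> an interior point, where the fundamental theorem
  gives a two-sided derivative.\<close>

lemma DERIV_integral_from_0:
  fixes g :: "real \<Rightarrow> real"
  assumes cont: "continuous_on UNIV g" and zero: "\<And>x. x \<le> 0 \<Longrightarrow> g x = 0"
  shows "((\<lambda>x. integral {0..x} g) has_real_derivative g x) (at x)"
proof -
  define N where "N = \<bar>x\<bar> + 1"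
  have contg: "continuous_on A g" for A
    using cont continuous_on_subset by blast
  have eq: "integral {- N..y} g = integral {0..y} g" if "- N < y" "y < N" for y
  proof (cases "y \<le> 0")
    case True
    have "integral {- N..y} g = integral {- N..y} (\<lambda>_. 0)"
      by (rule integral_cong) (use True zero in auto)
    moreover have "integral {0..y} g = integral {0..y} (\<lambda>_. 0)"
      by (rule integral_cong) (use True zero in auto)
    ultimately show ?thesis by simp
  next
    case False
    have "integral {- N..0} g + integral {0..y} g = integral {- N..y} g"
      by (rule Henstock_Kurzweil_Integration.integral_combine)
         (use False that in \<open>auto intro!: integrable_continuous_real contg\<close>)
    moreover have "integral {- N..0} g = integral {- N..0} (\<lambda>_. 0)"
      by (rule integral_cong) (use zero in auto)
    ultimately show ?thesis by simp
  qed
  have "((\<lambda>y. integral {- N..y} g) has_real_derivative g x) (at x within {- N..N})"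
    by (rule integral_has_real_derivative) (auto simp: N_def contg)
  then have "((\<lambda>y. integral {- N..y} g) has_real_derivative g x) (at x)"
    by (subst (asm) at_within_interior) (auto simp: N_def)
  then show ?thesis
    by (rule DERIV_cong_ev[THEN iffD1, rotated -1])
       (use eq in \<open>auto simp: eventually_nhds N_def intro!: exI[of _ "{- N<..<N}"]\<close>)
qed

lemma DERIV_smooth_step: "(smooth_step has_real_derivative bump x) (at x)"
  unfolding smooth_step_def[abs_def]
  by (rule DERIV_integral_from_0) (auto simp: bump_eq_0 smooth_imp_continuous_on smooth_bump)

lemma smooth_smooth_step: "smooth smooth_step"
  by (rule smoothI[OF DERIV_smooth_step smooth_bump])

lemma smooth_step_eq_0: "x \<le> 0 \<Longrightarrow> smooth_step x = 0"
proof -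
  assume "x \<le> 0"
  then have "integral {0..x} bump = integral {0..x} (\<lambda>_. 0)"
    by (intro integral_cong) (auto simp: bump_eq_0)
  then show ?thesis by (simp add: smooth_step_def)
qed

lemma smooth_step_eq_1: "1 \<le> x \<Longrightarrow> smooth_step x = 1"
proof -
  assume "1 \<le> x"
  have "integral {0..1} bump + integral {1..x} bump = integral {0..x} bump"
    by (rule Henstock_Kurzweil_Integration.integral_combine)
       (use \<open>1 \<le> x\<close> in \<open>auto intro!: integrable_continuous_real smooth_imp_continuous_on smooth_bump\<close>)
  moreover have "integral {1..x} bump = integral {1..x} (\<lambda>_. 0)"
    by (rule integral_cong) (auto simp: bump_eq_0)
  ultimately show ?thesis by (simp add: integral_bump smooth_step_def)
qed

lemma mono_smooth_step: "x \<le> y \<Longrightarrow> smooth_step x \<le> smooth_step y"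
  by (rule DERIV_nonneg_imp_nondecreasing[of x y smooth_step])
     (auto intro!: exI DERIV_smooth_step bump_nonneg)

lemma smooth_step_bounds: "0 \<le> smooth_step x" "smooth_step x \<le> 1"
proof -
  show "0 \<le> smooth_step x"
    using mono_smooth_step[of "min x 0" x] smooth_step_eq_0[of "min x 0"] by auto
  show "smooth_step x \<le> 1"
    using mono_smooth_step[of x "max x 1"] smooth_step_eq_1[of "max x 1"] by auto
qed

lemma DERIV_smooth_ramp: "(smooth_ramp has_real_derivative smooth_step x) (at x)"
  unfolding smooth_ramp_def[abs_def]
  by (rule DERIV_integral_from_0)
     (auto simp: smooth_step_eq_0 smooth_imp_continuous_on smooth_smooth_step)

lemma smooth_smooth_ramp: "smooth smooth_ramp"
  by (rule smoothI[OF DERIV_smooth_ramp smooth_smooth_step])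

lemma smooth_ramp_eq_0: "x \<le> 0 \<Longrightarrow> smooth_ramp x = 0"
proof -
  assume "x \<le> 0"
  then have "integral {0..x} smooth_step = integral {0..x} (\<lambda>_. 0)"
    by (intro integral_cong) (auto simp: smooth_step_eq_0)
  then show ?thesis by (simp add: smooth_ramp_def)
qed

lemma smooth_ramp_affine: "1 \<le> x \<Longrightarrow> smooth_ramp x = x - 1 + smooth_ramp 1"
proof -
  assume "1 \<le> x"
  have "integral {0..1} smooth_step + integral {1..x} smooth_step = integral {0..x} smooth_step"
    by (rule Henstock_Kurzweil_Integration.integral_combine)
       (use \<open>1 \<le> x\<close> in \<open>auto intro!: integrable_continuous_real smooth_imp_continuous_on smooth_smooth_step\<close>)
  moreover have "integral {1..x} smooth_step = integral {1..x} (\<lambda>_. 1)"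
    by (rule integral_cong) (auto simp: smooth_step_eq_1)
  ultimately show ?thesis using \<open>1 \<le> x\<close> by (simp add: smooth_ramp_def)
qed

text \<open>The defect 1 is independent of \<open>x\<close>; after the rescaling
  \<open>smooth_ramp (r * z) / r\<close> it becomes \<open>1 / r\<close>, which yields uniform
  convergence to the positive part.\<close>

lemma smooth_ramp_bounds: "max 0 x - 1 \<le> smooth_ramp x" "smooth_ramp x \<le> max 0 x"
proof -
  have *: "0 \<le> smooth_ramp y \<and> smooth_ramp y \<le> y" if "0 \<le> y" for y
  proof
    show "0 \<le> smooth_ramp y" unfolding smooth_ramp_def
      by (intro integral_nonneg integrable_continuous_real smooth_imp_continuous_on
          smooth_smooth_step smooth_step_bounds)
    have "smooth_ramp y \<le> integral {0..y} (\<lambda>_. 1)" unfolding smooth_ramp_def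
      by (intro integral_le integrable_continuous_real smooth_imp_continuous_on
          smooth_smooth_step smooth_step_bounds smooth_const)
    then show "smooth_ramp y \<le> y" using that by simp
  qed
  show "smooth_ramp x \<le> max 0 x"
    using *[of x] smooth_ramp_eq_0[of x] by (cases "x \<le> 0") auto
  show "max 0 x - 1 \<le> smooth_ramp x"
    using *[of x] *[of 1] smooth_ramp_eq_0[of x] smooth_ramp_affine[of x]
    by (cases "x \<le> 0"; cases "x \<le> 1") auto
qed

section \<open>Test functions and mollification\<close>

lemma test_functionI:
  assumes "smooth f" "\<And>x. f x \<noteq> 0 \<Longrightarrow> x \<in> {a..b}"
  shows "test_function f"
proof -
  have "{x. f x \<noteq> 0} \<subseteq> {a..b}" using assms(2) by auto
  then have "bounded {x. f x \<noteq> 0}" by (rule bounded_subset[rotated]) simp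
  then show ?thesis
    using assms(1) by (simp add: test_function_def smooth_def compact_closure)
qed

lemma test_function_imp_smooth: "test_function f \<Longrightarrow> smooth f"
  by (simp add: test_function_def smooth_def)

lemma test_function_bounded_support:
  assumes "test_function f"
  obtains M where "0 < M" "\<And>x. M \<le> \<bar>x\<bar> \<Longrightarrow> f x = 0"
proof -
  have "bounded {x. f x \<noteq> 0}"
    using assms by (simp add: test_function_def compact_closure)
  then obtain B where B: "\<And>x. f x \<noteq> 0 \<Longrightarrow> \<bar>x\<bar> \<le> B"
    by (auto simp: bounded_iff)
  show thesis
    by (rule that[of "\<bar>B\<bar> + 1"]) (use B in force)+
qed

lemma integrable_continuous_compact_support:
  fixes f :: "real \<Rightarrow> real"
  assumes "continuous_on {a..b} f" "\<And>z. f z \<noteq> 0 \<Longrightarrow> z \<in> {a..b}"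
  shows "integrable lborel f" "(LINT z|lborel. f z) = integral {a..b} f"
proof -
  have ind: "(\<lambda>z. indicator {a..b} z *\<^sub>R f z) = f"
  proof
    fix z show "indicator {a..b} z *\<^sub>R f z = f z"
      using assms(2)[of z] by (cases "z \<in> {a..b}") (auto simp del: atLeastAtMost_iff)
  qed
  have "set_integrable lborel {a..b} f"
    by (rule borel_integrable_atLeastAtMost'[OF assms(1)])
  from set_borel_integral_eq_integral[OF this] this
  show "integrable lborel f" "(LINT z|lborel. f z) = integral {a..b} f"
    unfolding set_integrable_def set_lebesgue_integral_def ind by auto
qed

lemma integrable_bump: "integrable lborel bump"
  and LINT_bump: "(LINT z|lborel. bump z) = 1"
proof -
  have *: "continuous_on {0..1} bump" "\<And>z. bump z \<noteq> 0 \<Longrightarrow> z \<in> {0..1}"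
    subgoal by (intro smooth_imp_continuous_on smooth_bump)
    subgoal for z using bump_eq_0[of z] by force
    done
  show "integrable lborel bump" "(LINT z|lborel. bump z) = 1"
    using integrable_continuous_compact_support[OF *] integral_bump by auto
qed

lemma smooth_imp_borel_measurable: "smooth f \<Longrightarrow> f \<in> borel_measurable borel"
  by (intro borel_measurable_continuous_onI smooth_imp_continuous_on)

text \<open>The substitution \<open>z = x + w / r n\<close> fixes the weight and moves the scale
  into the continuous function. The condition \<open>1 \<le> r n\<close> keeps the argument in
  \<open>[x, x + 1]\<close>, where \<open>f\<close> is bounded, so dominated convergence
  applies.\<close>

lemma bump_approximate_identity:
  fixes f :: "real \<Rightarrow> real" and r :: "nat \<Rightarrow> real"
  assumes f: "continuous_on UNIV f" and r: "filterlim r at_top sequentially" "\<And>n. 1 \<le> r n"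
  shows "(\<lambda>n. LINT z|lborel. f z * (r n * bump (r n * (z - x)))) \<longlonglongrightarrow> f x"
proof -
  have r0: "r n \<noteq> 0" "0 < r n" for n using r(2)[of n] by auto
  have fm [measurable]: "f \<in> borel_measurable borel"
    using f by (rule borel_measurable_continuous_onI)
  have bm [measurable]: "bump \<in> borel_measurable borel"
    by (intro borel_measurable_continuous_onI smooth_imp_continuous_on smooth_bump)
  have eq: "(LINT z|lborel. f z * (r n * bump (r n * (z - x)))) =
      (LINT w|lborel. f (x + w / r n) * bump w)" for n
  proof -
    have "(LINT z|lborel. f z * (r n * bump (r n * (z - x)))) = \<bar>1 / r n\<bar> *\<^sub>R
        (LINT w|lborel. f (x + 1 / r n * w) * (r n * bump (r n * (x + 1 / r n * w - x))))"
      by (rule lborel_integral_real_affine) (use r0[of n] in simp)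
    also have "(\<lambda>w. f (x + 1 / r n * w) * (r n * bump (r n * (x + 1 / r n * w - x)))) =
        (\<lambda>w. r n * (f (x + w / r n) * bump w))"
      using r0[of n] by (simp add: mult_ac)
    finally show ?thesis using r0[of n] by simp
  qed
  have "compact (f ` {x..x+1})"
    by (intro compact_continuous_image continuous_on_subset[OF f]) auto
  then obtain B where B: "\<And>z. z \<in> {x..x+1} \<Longrightarrow> \<bar>f z\<bar> \<le> B"
    by (metis (no_types, opaque_lifting) bounded_real compact_imp_bounded imageI)
  have "(\<lambda>n. LINT w|lborel. f (x + w / r n) * bump w) \<longlonglongrightarrow> (LINT w|lborel. f x * bump w)"
  proof (rule integral_dominated_convergence[where w = "\<lambda>w. B * bump w"])
    show "integrable lborel (\<lambda>w. B * bump w)"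
      by (simp add: integrable_bump)
    show "AE w in lborel. (\<lambda>n. f (x + w / r n) * bump w) \<longlonglongrightarrow> f x * bump w"
    proof (rule AE_I2)
      fix w
      have "(\<lambda>n. x + w * inverse (r n)) \<longlonglongrightarrow> x + w * 0"
        by (intro tendsto_intros tendsto_inverse_0_at_top r)
      then have "(\<lambda>n. x + w / r n) \<longlonglongrightarrow> x" by (simp add: divide_inverse)
      moreover have "isCont f x" using f by (simp add: continuous_on_eq_continuous_at)
      ultimately show "(\<lambda>n. f (x + w / r n) * bump w) \<longlonglongrightarrow> f x * bump w"
        by (intro tendsto_intros isCont_tendsto_compose[of x f])
    qed
    show "AE w in lborel. norm (f (x + w / r n) * bump w) \<le> B * bump w" for n
    proof (rule AE_I2)
      fix w
      show "norm (f (x + w / r n) * bump w) \<le> B * bump w"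
      proof (cases "w \<le> 0 \<or> 1 \<le> w")
        case True
        then show ?thesis by (simp add: bump_eq_0)
      next
        case False
        then have "0 \<le> w / r n" "w / r n \<le> 1"
          using r(2)[of n] by (auto simp: field_simps)
        with B[of "x + w / r n"] show ?thesis
          by (auto simp: abs_mult bump_nonneg intro!: mult_right_mono)
      qed
    qed
  qed auto
  then show ?thesis by (simp add: eq LINT_bump)
qed

lemma smooth_step_tendsto:
  assumes "filterlim r at_top sequentially"
  shows "(\<lambda>n. smooth_step (r n * z)) \<longlonglongrightarrow> indicat_real {0<..} z"
proof (cases "0 < z")
  case True
  have "filterlim (\<lambda>n. r n * z) at_top sequentially"
    by (rule filterlim_at_top_mult_tendsto_pos[OF tendsto_const True assms])
  then have "eventually (\<lambda>n. 1 \<le> r n * z) sequentially"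
    by (simp add: filterlim_at_top)
  then show ?thesis
    using True by (intro tendsto_eventually) (auto elim!: eventually_mono simp: smooth_step_eq_1)
next
  case False
  have "eventually (\<lambda>n. 0 \<le> r n) sequentially"
    using assms by (simp add: filterlim_at_top)
  then show ?thesis
    using False by (intro tendsto_eventually)
      (auto elim!: eventually_mono simp: smooth_step_eq_0 mult_nonneg_nonpos)
qed

section \<open>From weak derivatives to identities for differences\<close>

lemma smooth_diff: "smooth f \<Longrightarrow> smooth g \<Longrightarrow> smooth (\<lambda>x. f x - g x)"
  using smooth_add[of f "\<lambda>x. (-1) * g x"] smooth_mult[OF smooth_const, of g "-1"] by simp

lemma smooth_rescale: "smooth f \<Longrightarrow> smooth (\<lambda>x. f (c * (x - d)))"
  using smooth_affine[of f c "- c * d"] by (simp add: algebra_simps)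

lemma DERIV_rescale:
  assumes "\<And>x. (f has_real_derivative f' x) (at x)"
  shows "((\<lambda>x. f (c * (x - d))) has_real_derivative c * f' (c * (x - d))) (at x)"
proof -
  have "((\<lambda>x. c * (x - d)) has_real_derivative c) (at x)"
    by (auto intro!: derivative_eq_intros)
  from DERIV_chain2[OF assms this] show ?thesis by (simp add: mult.commute)
qed

lemma deriv_eqI: "(\<And>x. (f has_real_derivative f' x) (at x)) \<Longrightarrow> deriv f = f'"
  by (intro ext DERIV_imp_deriv)

text \<open>The test functions are mollified indicators of \<open>(x, y]\<close>; their derivatives
  are approximate identities at \<open>x\<close> and \<open>y\<close> with opposite signs. The weak
  identity is demanded only for tests supported in \<open>[a, b]\<close>, so that the lemma serves
  in space as well as on compact parts of the open time interval. The gap \<open>y < b\<close>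
  leaves room for the steps, which rise to the right of their base points.\<close>

lemma weak_deriv_difference:
  fixes f g :: "real \<Rightarrow> real"
  assumes f: "continuous_on UNIV f" and g: "set_integrable lborel {a..b} g"
    and xy: "a \<le> x" "x \<le> y" "y < b"
    and weak: "\<And>\<phi>. test_function \<phi> \<Longrightarrow> (\<And>z. \<phi> z \<noteq> 0 \<Longrightarrow> z \<in> {a..b}) \<Longrightarrow>
      (LINT z|lborel. f z * deriv \<phi> z) = - (LINT z|lborel. g z * \<phi> z)"
  shows "(LINT z:{x<..y}|lborel. g z) = f y - f x"
proof -
  \<comment> \<open>The second step rises over an interval of length \<open>1 / r n\<close> starting
    at \<open>y\<close>; the summand \<open>1 / (b - y)\<close> makes it end before
    \<open>b\<close>.\<close>
  define r where "r n = real n + 1 + 1 / (b - y)" for n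
  have r1: "1 \<le> r n" for n using xy by (simp add: r_def)
  have rlim: "filterlim r at_top sequentially"
    unfolding r_def using filterlim_tendsto_add_at_top[OF tendsto_const filterlim_real_sequentially, of "1 + 1 / (b - y)"]
    by (simp add: algebra_simps)
  have rb: "y + 1 / r n \<le> b" for n
  proof -
    have "1 / (b - y) \<le> r n" by (simp add: r_def)
    then show ?thesis using xy r1[of n] by (simp add: field_simps)
  qed
  define \<phi> where "\<phi> n z = smooth_step (r n * (z - x)) - smooth_step (r n * (z - y))" for n z
  have smooth_\<phi>: "smooth (\<phi> n)" for n
    unfolding \<phi>_def[abs_def] by (intro smooth_diff smooth_rescale smooth_smooth_step)
  have supp: "z \<in> {a..b}" if "\<phi> n z \<noteq> 0" for n z
  proof (rule ccontr)
    assume "z \<notin> {a..b}"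
    then consider "z < x" | "y + 1 / r n < z" using xy rb[of n] by force
    then show False
    proof cases
      case 1
      then have "r n * (z - x) \<le> 0" "r n * (z - y) \<le> 0"
        using r1[of n] xy by (auto intro!: mult_nonneg_nonpos)
      with that show False by (simp add: \<phi>_def smooth_step_eq_0)
    next
      case 2
      then have "1 \<le> r n * (z - y)" using r1[of n] by (simp add: field_simps)
      moreover have "r n * (z - y) \<le> r n * (z - x)"
        using xy r1[of n] by (intro mult_left_mono) auto
      ultimately show False using that by (simp add: \<phi>_def smooth_step_eq_1)
    qed
  qed
  have deriv_\<phi>: "deriv (\<phi> n) = (\<lambda>z. r n * bump (r n * (z - x)) - r n * bump (r n * (z - y)))" for n
    unfolding \<phi>_def[abs_def]
    by (intro deriv_eqI DERIV_diff DERIV_rescale DERIV_smooth_step)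
  have int: "integrable lborel (\<lambda>z. f z * (r n * bump (r n * (z - c))))" for n c
  proof (rule integrable_continuous_compact_support)
    show "continuous_on {c..c+1} (\<lambda>z. f z * (r n * bump (r n * (z - c))))"
      by (intro continuous_intros continuous_on_subset[OF f]
          smooth_imp_continuous_on smooth_rescale smooth_bump) auto
    show "z \<in> {c..c+1}" if nz: "f z * (r n * bump (r n * (z - c))) \<noteq> 0" for z
    proof -
      have "0 < r n * (z - c) \<and> r n * (z - c) < 1"
        using nz bump_eq_0[of "r n * (z - c)"] by force
      then have "0 < z - c" "z - c < 1 / r n" "1 / r n \<le> 1"
        using r1[of n] by (auto simp: field_simps zero_less_mult_iff)
      then show ?thesis by auto
    qed
  qed
  have "(LINT z|lborel. f z * deriv (\<phi> n) z) =
      (LINT z|lborel. f z * (r n * bump (r n * (z - x)))) -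
      (LINT z|lborel. f z * (r n * bump (r n * (z - y))))" for n
  proof -
    have "f z * deriv (\<phi> n) z = f z * (r n * bump (r n * (z - x))) - f z * (r n * bump (r n * (z - y)))" for z
      by (simp add: deriv_\<phi> right_diff_distrib)
    then show ?thesis by (simp only: Bochner_Integration.integral_diff[OF int int])
  qed
  then have 1: "(\<lambda>n. LINT z|lborel. f z * deriv (\<phi> n) z) \<longlonglongrightarrow> f x - f y"
    by (simp add: tendsto_diff bump_approximate_identity f rlim r1)
  let ?g = "\<lambda>z. indicator {a..b} z *\<^sub>R g z"
  have gi: "integrable lborel ?g" using g by (simp add: set_integrable_def)
  then have gm [measurable]: "?g \<in> borel_measurable borel" by auto
  have ge: "g z * \<phi> n z = ?g z * \<phi> n z" for n z
    using supp[of n z] by (auto simp: indicator_def)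
  have "(\<lambda>n. LINT z|lborel. ?g z * \<phi> n z) \<longlonglongrightarrow> (LINT z|lborel. ?g z * indicator {x<..y} z)"
  proof (rule integral_dominated_convergence[where w = "\<lambda>z. \<bar>?g z\<bar>"])
    show "AE z in lborel. (\<lambda>n. ?g z * \<phi> n z) \<longlonglongrightarrow> ?g z * indicator {x<..y} z"
    proof (rule AE_I2)
      \<comment> \<open>A step vanishes at its base point, so the pointwise limit is exactly the
        indicator of the half-open interval.\<close>
      fix z
      have "(\<lambda>n. \<phi> n z) \<longlonglongrightarrow> indicat_real {0<..} (z - x) - indicat_real {0<..} (z - y)"
        unfolding \<phi>_def by (intro tendsto_diff smooth_step_tendsto rlim)
      also have "indicat_real {0<..} (z - x) - indicat_real {0<..} (z - y) = indicator {x<..y} z"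
        using xy by (auto simp: indicator_def)
      finally show "(\<lambda>n. ?g z * \<phi> n z) \<longlonglongrightarrow> ?g z * indicator {x<..y} z"
        by (intro tendsto_intros)
    qed
    show "AE z in lborel. norm (?g z * \<phi> n z) \<le> \<bar>?g z\<bar>" for n
    proof (rule AE_I2)
      fix z
      have "\<bar>\<phi> n z\<bar> \<le> 1"
        using smooth_step_bounds[of "r n * (z - x)"] smooth_step_bounds[of "r n * (z - y)"]
        by (auto simp: \<phi>_def)
      then show "norm (?g z * \<phi> n z) \<le> \<bar>?g z\<bar>"
        unfolding real_norm_def abs_mult by (intro mult_left_le) auto
    qed
    show "(\<lambda>z. ?g z * \<phi> n z) \<in> borel_measurable lborel" for n
      using smooth_imp_borel_measurable[OF smooth_\<phi>[of n]] gm
      by (intro borel_measurable_times) simp_all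
  qed (use gi in auto)
  moreover have "(LINT z|lborel. f z * deriv (\<phi> n) z) = - (LINT z|lborel. ?g z * \<phi> n z)" for n
    using weak[of "\<phi> n"] test_functionI[OF smooth_\<phi> supp] supp ge by simp
  ultimately have "(\<lambda>n. LINT z|lborel. f z * deriv (\<phi> n) z) \<longlonglongrightarrow>
      - (LINT z|lborel. ?g z * indicator {x<..y} z)"
    by (simp add: tendsto_minus)
  from LIMSEQ_unique[OF 1 this]
  have "(LINT z|lborel. ?g z * indicator {x<..y} z) = f y - f x" by simp
  moreover have "indicator {x<..y} z *\<^sub>R g z = ?g z * indicator {x<..y} z" for z
    using xy by (auto simp: indicator_def)
  ultimately show ?thesis by (simp only: set_lebesgue_integral_def)
qed

lemma smooth_ramp_tendsto:
  assumes "filterlim r at_top sequentially" "\<And>n. 1 \<le> r n"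
  shows "(\<lambda>n. smooth_ramp (r n * z) / r n) \<longlonglongrightarrow> max 0 z"
proof (rule tendsto_sandwich)
  have pos: "0 < r n" for n using assms(2)[of n] by linarith
  have mx: "max 0 (r n * z) = r n * max 0 z" for n
    using pos[of n] by (auto simp: max_def zero_le_mult_iff mult_le_0_iff)
  show "eventually (\<lambda>n. max 0 z - inverse (r n) \<le> smooth_ramp (r n * z) / r n) sequentially"
  proof (rule always_eventually, rule allI)
    fix n show "max 0 z - inverse (r n) \<le> smooth_ramp (r n * z) / r n"
      using smooth_ramp_bounds(1)[of "r n * z"] pos[of n] divide_right_mono[of "r n * max 0 z - 1" "smooth_ramp (r n * z)" "r n"]
      unfolding mx by (simp add: diff_divide_distrib inverse_eq_divide)
  qed
  show "eventually (\<lambda>n. smooth_ramp (r n * z) / r n \<le> max 0 z) sequentially"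
  proof (rule always_eventually, rule allI)
    fix n show "smooth_ramp (r n * z) / r n \<le> max 0 z"
      using smooth_ramp_bounds(2)[of "r n * z"] pos[of n] unfolding mx by (simp add: field_simps)
  qed
  have "(\<lambda>n. max 0 z - inverse (r n)) \<longlonglongrightarrow> max 0 z - 0"
    by (intro tendsto_intros tendsto_inverse_0_at_top assms)
  then show "(\<lambda>n. max 0 z - inverse (r n)) \<longlonglongrightarrow> max 0 z" by simp
qed simp

lemma smooth_ramp_scaled_bounds:
  assumes "1 \<le> r"
  shows "max 0 z - 1 \<le> smooth_ramp (r * z) / r" "smooth_ramp (r * z) / r \<le> max 0 z"
proof -
  have mx: "max 0 (r * z) = r * max 0 z"
    using assms by (auto simp: max_def zero_le_mult_iff mult_le_0_iff)
  show "max 0 z - 1 \<le> smooth_ramp (r * z) / r"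
  proof -
    have "(max 0 z - 1) * r \<le> max 0 z * r - 1" using assms by (simp add: algebra_simps)
    also have "\<dots> \<le> smooth_ramp (r * z)" using smooth_ramp_bounds(1)[of "r * z"] by (simp add: mx mult.commute)
    finally show ?thesis using assms by (simp add: pos_le_divide_eq)
  qed
  show "smooth_ramp (r * z) / r \<le> max 0 z"
    using smooth_ramp_bounds(2)[of "r * z"] assms by (simp add: mx field_simps)
qed

text \<open>The tent \<open>h - |z - x|\<close> is the combination of ramps at \<open>x - h\<close>,
  \<open>x\<close>, \<open>x + h\<close> with weights 1, -2, 1, and its second derivative consists
  of point masses with these weights. Mollified ramps become affine only after a distance up to 1 to
  the right, hence the longer interval on which \<open>f\<close> has to be integrable.\<close>

lemma weak_second_difference:
  fixes F f :: "real \<Rightarrow> real"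
  assumes F: "continuous_on UNIV F" and f: "set_integrable lborel {x - h..x + h + 1} f" and h: "0 < h"
    and weak: "\<And>\<eta>. test_function \<eta> \<Longrightarrow>
      (LINT z|lborel. F z * (deriv ^^ 2) \<eta> z) = (LINT z|lborel. f z * \<eta> z)"
  shows "(LINT z:{x - h..x + h}|lborel. f z * (h - \<bar>z - x\<bar>)) = F (x + h) - 2 * F x + F (x - h)"
proof -
  define r where "r n = real n + 1" for n
  have r1: "1 \<le> r n" and r0: "r n \<noteq> 0" for n by (auto simp: r_def)
  have rlim: "filterlim r at_top sequentially"
    unfolding r_def using filterlim_tendsto_add_at_top[OF tendsto_const filterlim_real_sequentially, of 1]
    by (simp add: algebra_simps)
  define \<eta> where "\<eta> n z = (1 / r n) * ((smooth_ramp (r n * (z - (x - h))) -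
     2 * smooth_ramp (r n * (z - x))) + smooth_ramp (r n * (z - (x + h))))" for n z
  have smooth_\<eta>: "smooth (\<eta> n)" for n
    unfolding \<eta>_def[abs_def]
    by (intro smooth_diff smooth_add smooth_mult smooth_const smooth_rescale smooth_smooth_ramp)
  have supp: "z \<in> {x - h..x + h + 1}" if "\<eta> n z \<noteq> 0" for n z
  proof (rule ccontr)
    assume "z \<notin> {x - h..x + h + 1}"
    then consider "z < x - h" | "x + h + 1 < z" by force
    then show False
    proof cases
      case 1
      then have "r n * (z - (x - h)) \<le> 0" "r n * (z - x) \<le> 0" "r n * (z - (x + h)) \<le> 0"
        using r1[of n] h by (auto intro!: mult_nonneg_nonpos)
      with that show False by (simp add: \<eta>_def smooth_ramp_eq_0)
    next
      case 2
      then have *: "1 * 1 \<le> r n * (z - (x - h))" "1 * 1 \<le> r n * (z - x)" "1 * 1 \<le> r n * (z - (x + h))"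
        using r1[of n] h by (intro mult_mono; simp)+
      \<comment> \<open>All three ramps are affine here with the same slope; the weights 1, -2, 1 at
        equidistant points cancel both the slopes and the constants, so the support is
        compact.\<close>
      then have "\<eta> n z = (1 / r n) * 0"
        unfolding \<eta>_def
        by (subst (1 2 3) smooth_ramp_affine) (auto simp: algebra_simps)
      with that show False by simp
    qed
  qed
  define b where "b n c z = r n * bump (r n * (z - c))" for n c z
  have "deriv (\<eta> n) = (\<lambda>z. (1 / r n) * ((r n * smooth_step (r n * (z - (x - h))) -
     2 * (r n * smooth_step (r n * (z - x)))) + r n * smooth_step (r n * (z - (x + h)))))" for n
    unfolding \<eta>_def[abs_def]
    by (intro deriv_eqI DERIV_cmult DERIV_diff DERIV_add DERIV_rescale DERIV_smooth_ramp)
  also have "\<dots> n = (\<lambda>z. smooth_step (r n * (z - (x - h))) -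
     2 * smooth_step (r n * (z - x)) + smooth_step (r n * (z - (x + h))))" for n
    using r0[of n] by (intro ext) (simp add: distrib_left right_diff_distrib)
  finally have "(deriv ^^ 2) (\<eta> n) = deriv (\<lambda>z. smooth_step (r n * (z - (x - h))) -
     2 * smooth_step (r n * (z - x)) + smooth_step (r n * (z - (x + h))))" for n
    by (simp add: numeral_2_eq_2)
  also have "\<dots> n = (\<lambda>z. b n (x - h) z - 2 * b n x z + b n (x + h) z)" for n
    unfolding b_def
    by (intro deriv_eqI DERIV_cmult DERIV_diff DERIV_add DERIV_rescale DERIV_smooth_step)
  finally have deriv_\<eta>: "(deriv ^^ 2) (\<eta> n) = (\<lambda>z. b n (x - h) z - 2 * b n x z + b n (x + h) z)" for n .
  have int: "integrable lborel (\<lambda>z. F z * b n c z)" for n c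
  proof (rule integrable_continuous_compact_support)
    show "continuous_on {c..c+1} (\<lambda>z. F z * b n c z)"
      unfolding b_def
      by (intro continuous_intros continuous_on_subset[OF F]
          smooth_imp_continuous_on smooth_rescale smooth_bump) auto
    show "z \<in> {c..c+1}" if nz: "F z * b n c z \<noteq> 0" for z
    proof -
      have "0 < r n * (z - c) \<and> r n * (z - c) < 1"
        using nz bump_eq_0[of "r n * (z - c)"] by (force simp: b_def)
      then have "0 < z - c" "z - c < 1 / r n" "1 / r n \<le> 1"
        using r1[of n] by (auto simp: field_simps zero_less_mult_iff)
      then show ?thesis by auto
    qed
  qed
  have lim_b: "(\<lambda>n. LINT z|lborel. F z * b n c z) \<longlonglongrightarrow> F c" for c
    unfolding b_def by (intro bump_approximate_identity F rlim r1)
  have eq: "(LINT z|lborel. F z * (deriv ^^ 2) (\<eta> n) z) = (LINT z|lborel. F z * b n (x - h) z) -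
      2 * (LINT z|lborel. F z * b n x z) + (LINT z|lborel. F z * b n (x + h) z)" for n
  proof -
    have "F z * (deriv ^^ 2) (\<eta> n) z =
        F z * b n (x - h) z - 2 * (F z * b n x z) + F z * b n (x + h) z" for z
      by (simp add: deriv_\<eta> algebra_simps)
    then show ?thesis by (simp add: int)
  qed
  have 1: "(\<lambda>n. LINT z|lborel. F z * (deriv ^^ 2) (\<eta> n) z) \<longlonglongrightarrow> F (x - h) - 2 * F x + F (x + h)"
    unfolding eq by (intro tendsto_intros lim_b)
  let ?f = "\<lambda>z. indicator {x - h..x + h + 1} z *\<^sub>R f z"
  have fi: "integrable lborel ?f" using f by (simp add: set_integrable_def)
  then have fm [measurable]: "?f \<in> borel_measurable borel" by auto
  have fe: "f z * \<eta> n z = ?f z * \<eta> n z" for n z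
    using supp[of n z] by (auto simp: indicator_def)
  have "(\<lambda>n. LINT z|lborel. ?f z * \<eta> n z) \<longlonglongrightarrow> (LINT z|lborel. ?f z * max 0 (h - \<bar>z - x\<bar>))"
  proof (rule integral_dominated_convergence[where w = "\<lambda>z. \<bar>?f z\<bar> * (h + 2)"])
    show "AE z in lborel. (\<lambda>n. ?f z * \<eta> n z) \<longlonglongrightarrow> ?f z * max 0 (h - \<bar>z - x\<bar>)"
    proof (rule AE_I2)
      fix z
      have "(\<lambda>n. (smooth_ramp (r n * (z - (x - h))) / r n - 2 * (smooth_ramp (r n * (z - x)) / r n)) +
          smooth_ramp (r n * (z - (x + h))) / r n)
          \<longlonglongrightarrow> (max 0 (z - (x - h)) - 2 * max 0 (z - x)) + max 0 (z - (x + h))"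
        by (intro tendsto_intros smooth_ramp_tendsto rlim r1)
      also have "(max 0 (z - (x - h)) - 2 * max 0 (z - x)) + max 0 (z - (x + h)) = max 0 (h - \<bar>z - x\<bar>)"
        using h by (auto simp: max_def abs_if)
      finally show "(\<lambda>n. ?f z * \<eta> n z) \<longlonglongrightarrow> ?f z * max 0 (h - \<bar>z - x\<bar>)"
        by (intro tendsto_intros) (simp add: \<eta>_def diff_divide_distrib add_divide_distrib)
    qed
    show "AE z in lborel. norm (?f z * \<eta> n z) \<le> \<bar>?f z\<bar> * (h + 2)" for n
    proof (rule AE_I2)
      fix z
      have "\<eta> n z = (smooth_ramp (r n * (z - (x - h))) / r n - 2 * (smooth_ramp (r n * (z - x)) / r n)) +
          smooth_ramp (r n * (z - (x + h))) / r n"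
        by (simp add: \<eta>_def diff_divide_distrib add_divide_distrib)
      \<comment> \<open>The limiting tent takes values in \<open>[0, h]\<close>, and each scaled
        ramp falls short of its limit by at most 1; with the weights 1, -2, 1 the error is at most 2
        in either direction.\<close>
      then have "\<bar>\<eta> n z\<bar> \<le> h + 2"
        using smooth_ramp_scaled_bounds[OF r1[of n], of "z - (x - h)"] h
          smooth_ramp_scaled_bounds[OF r1[of n], of "z - x"]
          smooth_ramp_scaled_bounds[OF r1[of n], of "z - (x + h)"]
        by (simp add: max_def abs_if split: if_splits)
      then show "norm (?f z * \<eta> n z) \<le> \<bar>?f z\<bar> * (h + 2)"
        unfolding real_norm_def abs_mult by (intro mult_left_mono) auto
    qed
    show "(\<lambda>z. ?f z * \<eta> n z) \<in> borel_measurable lborel" for n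
      using smooth_imp_borel_measurable[OF smooth_\<eta>[of n]] fm
      by (intro borel_measurable_times) simp_all
  qed (use fi in auto)
  moreover have "(LINT z|lborel. F z * (deriv ^^ 2) (\<eta> n) z) = (LINT z|lborel. ?f z * \<eta> n z)" for n
    using weak[of "\<eta> n"] test_functionI[OF smooth_\<eta> supp] fe by simp
  ultimately have "(\<lambda>n. LINT z|lborel. F z * (deriv ^^ 2) (\<eta> n) z) \<longlonglongrightarrow>
      (LINT z|lborel. ?f z * max 0 (h - \<bar>z - x\<bar>))"
    by simp
  from LIMSEQ_unique[OF 1 this]
  have "(LINT z|lborel. ?f z * max 0 (h - \<bar>z - x\<bar>)) = F (x + h) - 2 * F x + F (x - h)" by simp
  moreover have "indicator {x - h..x + h} z *\<^sub>R (f z * (h - \<bar>z - x\<bar>)) = ?f z * max 0 (h - \<bar>z - x\<bar>)" for z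
    using h by (auto simp: indicator_def)
  ultimately show ?thesis by (simp only: set_lebesgue_integral_def)
qed

section \<open>Fourier transforms and Sobolev regularity\<close>

abbreviation gauss :: "real \<Rightarrow> real" where "gauss \<equiv> std_normal_density"

text \<open>Up to a constant the Gaussian is its own transform. Together with Fubini this takes the
  place of an inversion theorem in the pairing bounds.\<close>

lemma gauss_fourier:
  "(LINT t|lborel. complex_of_real (gauss t) * cis (- (t * w))) = complex_of_real (sqrt (2 * pi) * gauss w)"
proof -
  have "(LINT t|lborel. complex_of_real (gauss t) * cis (- (t * w))) =
      (LINT t|lborel. gauss t *\<^sub>R iexp (- w * t))"
    by (simp add: scaleR_conv_of_real cis_conv_exp mult.commute)
  also have "\<dots> = char std_normal_distribution (- w)"
    unfolding char_def by (subst integral_density) auto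
  also have "\<dots> = complex_of_real (exp (- w\<^sup>2 / 2))"
    by (simp add: char_std_normal_distribution)
  also have "exp (- w\<^sup>2 / 2) = sqrt (2 * pi) * gauss w"
    by (simp add: std_normal_density_def)
  finally show ?thesis .
qed

lemma measurable_cis [measurable]: "cis \<in> borel_measurable borel"
  by (intro borel_measurable_continuous_onI continuous_intros)

lemma measurable_cnj [measurable]: "cnj \<in> borel_measurable borel"
  by (intro borel_measurable_continuous_onI continuous_intros)

text \<open>The multiplication formula for the Fourier transform, with a free factor
  \<open>c\<close> in the phase: Fubini applies because the exponential has modulus 1.\<close>

lemma fourier_swap:
  fixes A B :: "real \<Rightarrow> complex"
  assumes A: "integrable lborel A" and B: "integrable lborel B"
  shows "(LINT x|lborel. A x * (LINT t|lborel. B t * cis (c * t * x))) =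
    (LINT t|lborel. B t * (LINT x|lborel. A x * cis (c * t * x)))"
proof -
  have [measurable]: "A \<in> borel_measurable borel" "B \<in> borel_measurable borel"
    using A B by auto
  have "integrable (lborel \<Otimes>\<^sub>M lborel) (\<lambda>(x, t). A x * (B t * cis (c * t * x)))"
  proof (rule lborel_pair.Fubini_integrable)
    show "(\<lambda>(x, t). A x * (B t * cis (c * t * x))) \<in> borel_measurable (lborel \<Otimes>\<^sub>M lborel)"
      by measurable
    show "integrable lborel (\<lambda>x. LINT t|lborel. norm (case (x, t) of (x, t) \<Rightarrow> A x * (B t * cis (c * t * x))))"
      using A by (simp add: norm_mult)
    show "AE x in lborel. integrable lborel (\<lambda>t. case (x, t) of (x, t) \<Rightarrow> A x * (B t * cis (c * t * x)))"
    proof (rule AE_I2)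
      fix x
      have "integrable lborel (\<lambda>t. B t * cis (c * t * x))"
        by (rule Bochner_Integration.integrable_bound[OF B]) (auto simp: norm_mult)
      then show "integrable lborel (\<lambda>t. case (x, t) of (x, t) \<Rightarrow> A x * (B t * cis (c * t * x)))"
        by simp
    qed
  qed
  then have "(LINT t|lborel. LINT x|lborel. A x * (B t * cis (c * t * x))) =
      (LINT x|lborel. LINT t|lborel. A x * (B t * cis (c * t * x)))"
    by (rule lborel_pair.Fubini_integral)
  moreover have "A x * (B t * cis (c * t * x)) = B t * (A x * cis (c * t * x))" for x t
    by (simp add: mult_ac)
  ultimately have "(LINT t|lborel. LINT x|lborel. B t * (A x * cis (c * t * x))) =
      (LINT x|lborel. LINT t|lborel. A x * (B t * cis (c * t * x)))"
    by (simp only:)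
  then show ?thesis by simp
qed

lemma fourier_borel_measurable [measurable]:
  assumes [measurable]: "g \<in> borel_measurable borel"
  shows "fourier g \<in> borel_measurable borel"
  unfolding fourier_def by measurable

lemma norm_fourier_le:
  assumes "integrable lborel g"
  shows "cmod (fourier g \<xi>) \<le> (LINT x|lborel. \<bar>g x\<bar>)"
  unfolding fourier_def
  by (rule order_trans[OF integral_norm_bound]) (simp add: norm_mult)

lemma cnj_fourier: "cnj (fourier \<psi> \<xi>) = (LINT y|lborel. complex_of_real (\<psi> y) * cis (\<xi> * y))"
  unfolding fourier_def Bochner_Integration.integral_cnj[symmetric] by (simp add: cis_cnj mult.commute)

text \<open>The pairing is regularised by replacing \<open>\<psi>\<close> with its convolution with a Gaussian of width
  \<open>1 / r\<close>, whose Fourier representation follows from that of the Gaussian.\<close>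

lemma fourier_pairing_regularised:
  assumes g: "integrable lborel g" and \<psi>: "integrable lborel \<psi>" and r: "0 < r"
  shows "ennreal \<bar>LINT x|lborel. g x * (LINT w|lborel. \<psi> (x - w / r) * gauss w)\<bar> \<le>
    ennreal (1 / (2 * pi)) * (\<integral>\<^sup>+\<xi>. ennreal (cmod (fourier g \<xi>) * cmod (fourier \<psi> \<xi>)) \<partial>lborel)"
proof -
  have [measurable]: "g \<in> borel_measurable borel" "\<psi> \<in> borel_measurable borel"
    using g \<psi> by auto
  have gs: "integrable lborel (\<lambda>t. complex_of_real (gauss t))" by simp
  let ?c = "r / sqrt (2 * pi)"
  \<comment> \<open>The convolution of \<open>\<psi>\<close> with the rescaled Gaussian is, up to a
    constant, the transform of \<open>k\<close>; the Gaussian factor makes \<open>k\<close>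
    integrable although the transform of \<open>\<psi>\<close> is merely bounded.\<close>
  define k where "k t = complex_of_real (gauss t) * cnj (fourier \<psi> (r * t))" for t
  have k_int: "integrable lborel k"
    unfolding k_def
  proof (rule Bochner_Integration.integrable_bound)
    show "integrable lborel (\<lambda>t. (LINT x|lborel. \<bar>\<psi> x\<bar>) * gauss t)" by simp
    show "AE t in lborel. norm (complex_of_real (gauss t) * cnj (fourier \<psi> (r * t)))
        \<le> norm ((LINT x|lborel. \<bar>\<psi> x\<bar>) * gauss t)"
      using norm_fourier_le[OF \<psi>]
      by (auto simp: norm_mult normal_density_nonneg mult.commute intro!: AE_I2 mult_left_mono)
  qed measurable
  have "(LINT w|lborel. \<psi> (x - w / r) * gauss w) = r * (LINT y|lborel. \<psi> y * gauss (r * (x - y)))" for x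
  proof -
    have "(LINT w|lborel. \<psi> (x - w / r) * gauss w) =
        \<bar>- r\<bar> *\<^sub>R (LINT y|lborel. \<psi> (x - (r * x + (- r) * y) / r) * gauss (r * x + (- r) * y))"
      by (rule lborel_integral_real_affine) (use r in simp)
    also have "(\<lambda>y. \<psi> (x - (r * x + (- r) * y) / r) * gauss (r * x + (- r) * y)) =
        (\<lambda>y. \<psi> y * gauss (r * (x - y)))"
      using r by (intro ext) (simp add: field_simps)
    finally show ?thesis using r by simp
  qed
  moreover have "complex_of_real (LINT y|lborel. \<psi> y * gauss (r * (x - y))) =
      (1 / sqrt (2 * pi)) * (LINT t|lborel. k t * cis (- r * t * x))" for x
  proof -
    have *: "complex_of_real (gauss w) = (1 / sqrt (2 * pi)) * (LINT t|lborel. complex_of_real (gauss t) * cis (- (t * w)))" for w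
      by (subst gauss_fourier) simp
    have "complex_of_real (LINT y|lborel. \<psi> y * gauss (r * (x - y))) =
        (LINT y|lborel. complex_of_real (\<psi> y) * complex_of_real (gauss (r * (x - y))))"
      by (simp flip: integral_complex_of_real)
    also have "\<dots> = (1 / sqrt (2 * pi)) * (LINT y|lborel. complex_of_real (\<psi> y) *
        (LINT t|lborel. complex_of_real (gauss t) * cis (- (t * (r * (x - y))))))"
      by (rule trans[OF Bochner_Integration.integral_cong[OF refl] integral_mult_right_zero],
          subst *, rule mult.left_commute)
    also have "(LINT y|lborel. complex_of_real (\<psi> y) *
        (LINT t|lborel. complex_of_real (gauss t) * cis (- (t * (r * (x - y)))))) =
        (LINT y|lborel. complex_of_real (\<psi> y) *
        (LINT t|lborel. (complex_of_real (gauss t) * cis (- r * t * x)) * cis (r * t * y)))"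
      by (simp add: mult.assoc cis_mult algebra_simps)
    also have "\<dots> = (LINT t|lborel. (complex_of_real (gauss t) * cis (- r * t * x)) *
        (LINT y|lborel. complex_of_real (\<psi> y) * cis (r * t * y)))"
    proof (rule fourier_swap)
      show "integrable lborel (\<lambda>t. complex_of_real (gauss t) * cis (- r * t * x))"
        by (rule Bochner_Integration.integrable_bound[OF gs]) (auto simp: norm_mult)
    qed (use \<psi> in simp)
    also have "\<dots> = (LINT t|lborel. k t * cis (- r * t * x))"
      by (simp add: k_def cnj_fourier mult_ac)
    finally show ?thesis .
  qed
  ultimately have conv: "complex_of_real (LINT w|lborel. \<psi> (x - w / r) * gauss w) =
      ?c * (LINT t|lborel. k t * cis (- r * t * x))" for x
    by simp
  have "complex_of_real (LINT x|lborel. g x * (LINT w|lborel. \<psi> (x - w / r) * gauss w)) =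
      (LINT x|lborel. complex_of_real (g x * (LINT w|lborel. \<psi> (x - w / r) * gauss w)))"
    by (rule integral_complex_of_real[symmetric])
  also have "\<dots> = (LINT x|lborel. complex_of_real (g x) * (?c * (LINT t|lborel. k t * cis (- r * t * x))))"
    by (simp only: of_real_mult conv)
  also have "\<dots> = ?c * (LINT x|lborel. complex_of_real (g x) * (LINT t|lborel. k t * cis (- r * t * x)))"
    by (simp only: mult.left_commute[of _ "complex_of_real ?c"] integral_mult_right_zero)
  also have "(LINT x|lborel. complex_of_real (g x) * (LINT t|lborel. k t * cis (- r * t * x))) =
      (LINT t|lborel. k t * (LINT x|lborel. complex_of_real (g x) * cis (- r * t * x)))"
    by (rule fourier_swap) (use g k_int in auto)
  also have "\<dots> = (LINT t|lborel. k t * fourier g (r * t))"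
    by (simp add: fourier_def mult_ac)
  finally have "\<bar>LINT x|lborel. g x * (LINT w|lborel. \<psi> (x - w / r) * gauss w)\<bar> =
      ?c * cmod (LINT t|lborel. k t * fourier g (r * t))"
    using r by (metis (no_types, lifting) norm_mult norm_of_real abs_of_nonneg divide_nonneg_nonneg less_imp_le
        real_sqrt_ge_zero pi_ge_zero mult_nonneg_nonneg zero_le_numeral)
  moreover have "0 \<le> ?c" using r by simp
  ultimately have "ennreal \<bar>LINT x|lborel. g x * (LINT w|lborel. \<psi> (x - w / r) * gauss w)\<bar> =
      ennreal ?c * ennreal (cmod (LINT t|lborel. k t * fourier g (r * t)))"
    by (simp only: ennreal_mult')
  also have "\<dots> \<le> ennreal ?c * (\<integral>\<^sup>+t. ennreal (cmod (k t * fourier g (r * t))) \<partial>lborel)"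
  proof (rule mult_left_mono)
    have "integrable lborel (\<lambda>t. k t * fourier g (r * t))"
    proof (rule Bochner_Integration.integrable_bound)
      show "integrable lborel (\<lambda>t. (LINT x|lborel. \<bar>g x\<bar>) * cmod (k t))"
        using k_int by simp
      show "AE t in lborel. norm (k t * fourier g (r * t)) \<le> norm ((LINT x|lborel. \<bar>g x\<bar>) * cmod (k t))"
        using norm_fourier_le[OF g]
        by (auto simp: norm_mult mult.commute abs_mult intro!: AE_I2 mult_left_mono order_trans[OF _ abs_ge_self])
    qed (unfold k_def, measurable)
    then show "ennreal (cmod (LINT t|lborel. k t * fourier g (r * t))) \<le>
        (\<integral>\<^sup>+t. ennreal (cmod (k t * fourier g (r * t))) \<partial>lborel)"
      by (rule integral_norm_bound_ennreal)
  qed simp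
  also have "\<dots> \<le> ennreal ?c * (\<integral>\<^sup>+t. ennreal (1 / sqrt (2 * pi)) *
      ennreal (cmod (fourier g (0 + r * t)) * cmod (fourier \<psi> (0 + r * t))) \<partial>lborel)"
  proof (intro mult_left_mono nn_integral_mono)
    fix t
    \<comment> \<open>Bounding the Gaussian by its maximum costs a factor
      \<open>1 / sqrt (2 * pi)\<close>. With the one contained in \<open>?c\<close> it forms the
      Plancherel constant \<open>1 / (2 * pi)\<close>, and the substitution \<xi> =
      \<open>r * t\<close> then removes \<open>r\<close> from the bound.\<close>
    have "gauss t \<le> 1 / sqrt (2 * pi)" by (simp add: std_normal_density_def divide_right_mono)
    then have "cmod (k t * fourier g (r * t)) \<le>
        1 / sqrt (2 * pi) * (cmod (fourier g (r * t)) * cmod (fourier \<psi> (r * t)))"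
      using mult_right_mono[of "gauss t" "1 / sqrt (2 * pi)" "cmod (fourier g (r * t)) * cmod (fourier \<psi> (r * t))"]
      unfolding k_def norm_mult complex_mod_cnj by (simp add: mult_ac)
    then show "ennreal (cmod (k t * fourier g (r * t))) \<le> ennreal (1 / sqrt (2 * pi)) *
      ennreal (cmod (fourier g (0 + r * t)) * cmod (fourier \<psi> (0 + r * t)))"
      by (subst ennreal_mult'[symmetric]) (auto intro!: ennreal_leI)
  qed simp
  also have "\<dots> = ennreal (1 / sqrt (2 * pi)) * (ennreal (1 / sqrt (2 * pi)) * (ennreal \<bar>r\<bar> * (\<integral>\<^sup>+t.
      ennreal (cmod (fourier g (0 + r * t)) * cmod (fourier \<psi> (0 + r * t))) \<partial>lborel)))"
  proof -
    have "ennreal ?c = ennreal (1 / sqrt (2 * pi)) * ennreal \<bar>r\<bar>"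
      using r by (subst ennreal_mult'[symmetric]) auto
    then show ?thesis
      by (subst nn_integral_cmult) (auto simp: mult_ac)
  qed
  also have "ennreal \<bar>r\<bar> * (\<integral>\<^sup>+t. ennreal (cmod (fourier g (0 + r * t)) * cmod (fourier \<psi> (0 + r * t))) \<partial>lborel)
      = (\<integral>\<^sup>+\<xi>. ennreal (cmod (fourier g \<xi>) * cmod (fourier \<psi> \<xi>)) \<partial>lborel)"
    by (rule nn_integral_real_affine[symmetric]) (use r in auto)
  also have "ennreal (1 / sqrt (2 * pi)) * (ennreal (1 / sqrt (2 * pi)) * (\<integral>\<^sup>+\<xi>. ennreal (cmod (fourier g \<xi>) * cmod (fourier \<psi> \<xi>)) \<partial>lborel))
      = ennreal (1 / (2 * pi)) * (\<integral>\<^sup>+\<xi>. ennreal (cmod (fourier g \<xi>) * cmod (fourier \<psi> \<xi>)) \<partial>lborel)"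
    by (subst mult.assoc[symmetric], subst ennreal_mult'[symmetric]) auto
  finally show ?thesis .
qed

lemma fourier_pairing_bound_integrable:
  assumes g: "integrable lborel g" and \<psi>: "integrable lborel \<psi>" and bound: "\<And>x. \<bar>\<psi> x\<bar> \<le> 1"
    and cont: "AE x in lborel. isCont \<psi> x"
  shows "ennreal \<bar>LINT x|lborel. g x * \<psi> x\<bar> \<le>
    ennreal (1 / (2 * pi)) * (\<integral>\<^sup>+\<xi>. ennreal (cmod (fourier g \<xi>) * cmod (fourier \<psi> \<xi>)) \<partial>lborel)"
proof -
  have [measurable]: "g \<in> borel_measurable borel" "\<psi> \<in> borel_measurable borel"
    using g \<psi> by auto
  let ?K = "\<lambda>n x. LINT w|lborel. \<psi> (x - w / real (Suc n)) * gauss w"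
  have int: "integrable lborel (\<lambda>w. \<psi> (x - w / real (Suc n)) * gauss w)" for n x
  proof (rule Bochner_Integration.integrable_bound[of lborel gauss])
    show "AE w in lborel. norm (\<psi> (x - w / real (Suc n)) * gauss w) \<le> norm (gauss w)"
      using bound by (auto simp: abs_mult intro!: AE_I2 mult_left_le_one_le)
  qed auto
  have K1: "\<bar>?K n x\<bar> \<le> 1" for n x
  proof -
    have "\<bar>?K n x\<bar> \<le> (LINT w|lborel. gauss w)"
    proof (rule integral_abs_bound[THEN order_trans], rule integral_mono)
      show "integrable lborel (\<lambda>w. \<bar>\<psi> (x - w / real (Suc n)) * gauss w\<bar>)"
        by (rule integrable_abs[OF int])
      show "\<bar>\<psi> (x - w / real (Suc n)) * gauss w\<bar> \<le> gauss w" for w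
        using bound by (simp add: abs_mult normal_density_nonneg mult_left_le_one_le)
    qed simp
    then show ?thesis by simp
  qed
  have "(\<lambda>n. LINT x|lborel. g x * ?K n x) \<longlonglongrightarrow> (LINT x|lborel. g x * \<psi> x)"
  proof (rule integral_dominated_convergence[where w = "\<lambda>x. \<bar>g x\<bar>"])
    show "AE x in lborel. (\<lambda>n. g x * ?K n x) \<longlonglongrightarrow> g x * \<psi> x"
      using cont
    proof eventually_elim
      case (elim x)
      have "(\<lambda>n. ?K n x) \<longlonglongrightarrow> (LINT w|lborel. \<psi> x * gauss w)"
      proof (rule integral_dominated_convergence[where w = gauss])
        show "AE w in lborel. (\<lambda>n. \<psi> (x - w / real (Suc n)) * gauss w) \<longlonglongrightarrow> \<psi> x * gauss w"
        proof (rule AE_I2)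
          fix w
          have "(\<lambda>n. x - w * inverse (real (Suc n))) \<longlonglongrightarrow> x - w * 0"
            by (intro tendsto_intros LIMSEQ_inverse_real_of_nat)
          then have "(\<lambda>n. x - w / real (Suc n)) \<longlonglongrightarrow> x" by (simp add: divide_inverse)
          then show "(\<lambda>n. \<psi> (x - w / real (Suc n)) * gauss w) \<longlonglongrightarrow> \<psi> x * gauss w"
            by (intro tendsto_intros isCont_tendsto_compose[OF elim])
        qed
        show "AE w in lborel. norm (\<psi> (x - w / real (Suc n)) * gauss w) \<le> gauss w" for n
          using bound by (auto simp: abs_mult normal_density_nonneg intro!: AE_I2 mult_left_le_one_le)
      qed auto
      then show ?case by (intro tendsto_intros) simp
    qed
    show "AE x in lborel. norm (g x * ?K n x) \<le> \<bar>g x\<bar>" for n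
      using K1 by (auto simp: abs_mult intro!: AE_I2 mult_left_le)
  qed (use g in auto)
  then have "(\<lambda>n. ennreal \<bar>LINT x|lborel. g x * ?K n x\<bar>) \<longlonglongrightarrow> ennreal \<bar>LINT x|lborel. g x * \<psi> x\<bar>"
    by (intro tendsto_intros)
  then show ?thesis
    by (rule LIMSEQ_le_const2)
       (use fourier_pairing_regularised[OF g \<psi>] in \<open>auto simp del: of_nat_Suc\<close>)
qed

lemma set_integrable_square_integrable:
  fixes g :: "real \<Rightarrow> real"
  assumes "g \<in> borel_measurable borel" "(\<integral>\<^sup>+x. ennreal ((g x)\<^sup>2) \<partial>lborel) < \<infinity>"
  shows "set_integrable lborel {a..b} g"
proof -
  have 1: "integrable lborel (\<lambda>x. (g x)\<^sup>2)"
    using assms by (intro integrableI_bounded) auto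
  have 2: "integrable lborel (indicat_real {a..b})"
    by (simp add: emeasure_lborel_Icc_eq)
  have "integrable lborel (\<lambda>x. indicat_real {a..b} x * g x)"
  proof (rule Bochner_Integration.integrable_bound[OF Bochner_Integration.integrable_add[OF 1 2]])
    have "\<bar>y\<bar> \<le> y\<^sup>2 + 1" for y :: real
      using zero_le_power2[of "\<bar>y\<bar> - 1"] zero_le_power2[of y] by (simp add: power2_diff)
    then show "AE x in lborel. norm (indicat_real {a..b} x * g x) \<le> norm ((g x)\<^sup>2 + indicat_real {a..b} x)"
      by (auto simp: indicator_def intro!: AE_I2 order_trans[OF _ abs_ge_self])
  qed (use assms in measurable)
  then show ?thesis by (simp add: set_integrable_def)
qed

text \<open>Truncating \<open>g\<close> to a large interval does not change the pairing, because
  \<open>\<psi>\<close> has bounded support, while the transforms of the truncations converge to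
  \<open>h\<close> in mean square. The square integrability of the transform of
  \<open>\<psi>\<close> controls the error on the Fourier side.\<close>

lemma fourier_pairing_bound:
  assumes gh: "has_fourier g h" and [measurable]: "\<psi> \<in> borel_measurable borel"
    and bound: "\<And>x. \<bar>\<psi> x\<bar> \<le> 1" and supp: "\<And>x. \<psi> x \<noteq> 0 \<Longrightarrow> \<bar>x\<bar> \<le> K"
    and cont: "AE x in lborel. isCont \<psi> x"
    and sq: "(\<integral>\<^sup>+\<xi>. ennreal ((cmod (fourier \<psi> \<xi>))\<^sup>2) \<partial>lborel) < \<infinity>"
  shows "ennreal \<bar>LINT x|lborel. g x * \<psi> x\<bar> \<le>
    ennreal (1 / (2 * pi)) * (\<integral>\<^sup>+\<xi>. ennreal (cmod (h \<xi>) * cmod (fourier \<psi> \<xi>)) \<partial>lborel)"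
proof (rule ennreal_le_epsilon)
  fix e :: real assume "0 < e"
  have [measurable]: "g \<in> borel_measurable borel" "h \<in> borel_measurable borel"
    and g2: "(\<integral>\<^sup>+x. ennreal ((g x)\<^sup>2) \<partial>lborel) < \<infinity>"
    using gh by (auto simp: has_fourier_def)
  let ?g = "\<lambda>R x. indicat_real {-R..R} x * g x"
  let ?D = "\<lambda>R. \<integral>\<^sup>+\<xi>. ennreal ((cmod (h \<xi> - fourier (?g R) \<xi>))\<^sup>2) \<partial>lborel"
  obtain P where P: "(\<integral>\<^sup>+\<xi>. ennreal ((cmod (fourier \<psi> \<xi>))\<^sup>2) \<partial>lborel) = ennreal P" "0 \<le> P"
    using sq by (metis ennreal_cases less_irrefl infinity_ennreal_def)
  \<comment> \<open>The weight in \<open>a b \<le> a^2 / d + d b^2\<close>: with the integral of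
    \<open>a^2\<close> below \<open>d * e\<close> and that of \<open>b^2\<close> equal to
    \<open>P\<close>, each of the two terms contributes at most \<open>e\<close>.\<close>
  define d where "d = e / (P + 1)"
  have d: "0 < d" "d * P \<le> e" using \<open>0 < e\<close> P(2) by (auto simp: d_def field_simps)
  have "(?D \<longlongrightarrow> 0) at_top" using gh by (simp add: has_fourier_def)
  then have "eventually (\<lambda>R. ?D R < ennreal (d * e)) at_top"
    by (rule order_tendstoD) (use d \<open>0 < e\<close> in simp)
  moreover have "eventually (\<lambda>R. K \<le> R) at_top" by (rule eventually_ge_at_top)
  ultimately obtain R where R: "?D R < ennreal (d * e)" "K \<le> R"
    by (metis (mono_tags, lifting) eventually_at_top_linorder eventually_conj nle_le)
  have gi: "integrable lborel (?g R)"
    using set_integrable_square_integrable[of g "-R" R] g2 by (simp add: set_integrable_def)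
  have \<psi>i: "integrable lborel \<psi>"
  proof (rule Bochner_Integration.integrable_bound[of lborel "indicat_real {-K..K}"])
    show "AE x in lborel. norm (\<psi> x) \<le> norm (indicat_real {-K..K} x)"
    proof (rule AE_I2)
      fix x show "norm (\<psi> x) \<le> norm (indicat_real {-K..K} x)"
        using bound[of x] supp[of x] by (cases "\<psi> x = 0") (auto simp: indicator_def abs_le_iff)
    qed
  qed (auto simp: emeasure_lborel_Icc_eq)
  have "?g R x * \<psi> x = g x * \<psi> x" for x
    using supp[of x] R(2) by (auto simp: indicator_def)
  then have "ennreal \<bar>LINT x|lborel. g x * \<psi> x\<bar> = ennreal \<bar>LINT x|lborel. ?g R x * \<psi> x\<bar>"
    by (simp only:)
  also have "\<dots> \<le> ennreal (1 / (2 * pi)) * (\<integral>\<^sup>+\<xi>. ennreal (cmod (fourier (?g R) \<xi>) * cmod (fourier \<psi> \<xi>)) \<partial>lborel)"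
    by (rule fourier_pairing_bound_integrable[OF gi \<psi>i bound cont])
  also have "\<dots> \<le> ennreal (1 / (2 * pi)) * ((\<integral>\<^sup>+\<xi>. ennreal (cmod (h \<xi>) * cmod (fourier \<psi> \<xi>)) \<partial>lborel) + ennreal (2 * e))"
  proof (rule mult_left_mono)
    have "(\<integral>\<^sup>+\<xi>. ennreal (cmod (fourier (?g R) \<xi>) * cmod (fourier \<psi> \<xi>)) \<partial>lborel) \<le>
        (\<integral>\<^sup>+\<xi>. (ennreal (cmod (h \<xi>) * cmod (fourier \<psi> \<xi>)) +
          (ennreal (1 / d) * ennreal ((cmod (h \<xi> - fourier (?g R) \<xi>))\<^sup>2) + ennreal d * ennreal ((cmod (fourier \<psi> \<xi>))\<^sup>2))) \<partial>lborel)"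
    proof (rule nn_integral_mono)
      fix \<xi>
      let ?a = "cmod (h \<xi> - fourier (?g R) \<xi>)" and ?b = "cmod (fourier \<psi> \<xi>)"
      have "cmod (fourier (?g R) \<xi>) \<le> cmod (h \<xi>) + ?a"
        by (metis norm_minus_commute norm_triangle_sub add.commute)
      then have "cmod (fourier (?g R) \<xi>) * ?b \<le> (cmod (h \<xi>) + ?a) * ?b"
        by (rule mult_right_mono) simp
      moreover have "?a * ?b \<le> 1 / d * ?a\<^sup>2 + d * ?b\<^sup>2"
      proof -
        have "0 \<le> (?a - d * ?b)\<^sup>2 + ?a\<^sup>2 + (d * ?b)\<^sup>2" by simp
        then have "2 * (d * (?a * ?b)) \<le> 2 * (?a\<^sup>2 + d\<^sup>2 * ?b\<^sup>2)"
          by (simp add: power2_eq_square algebra_simps)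
        then have "d * (?a * ?b) \<le> d * (1 / d * ?a\<^sup>2 + d * ?b\<^sup>2)"
          using d(1) by (simp add: distrib_left power2_eq_square mult.assoc)
        then show ?thesis using d(1) by simp
      qed
      ultimately have "cmod (fourier (?g R) \<xi>) * ?b \<le> cmod (h \<xi>) * ?b + (1 / d * ?a\<^sup>2 + d * ?b\<^sup>2)"
        by (simp add: distrib_right)
      then show "ennreal (cmod (fourier (?g R) \<xi>) * ?b) \<le> ennreal (cmod (h \<xi>) * ?b) +
          (ennreal (1 / d) * ennreal (?a\<^sup>2) + ennreal d * ennreal (?b\<^sup>2))"
        using d(1) by (simp add: ennreal_leI flip: ennreal_mult' ennreal_plus)
    qed
    also have "\<dots> = (\<integral>\<^sup>+\<xi>. ennreal (cmod (h \<xi>) * cmod (fourier \<psi> \<xi>)) \<partial>lborel) +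
        (ennreal (1 / d) * ?D R + ennreal d * ennreal P)"
      by (simp add: nn_integral_add nn_integral_cmult P(1))
    also have "\<dots> \<le> (\<integral>\<^sup>+\<xi>. ennreal (cmod (h \<xi>) * cmod (fourier \<psi> \<xi>)) \<partial>lborel) +
        (ennreal (1 / d) * ennreal (d * e) + ennreal d * ennreal P)"
      using R(1) by (intro add_mono mult_left_mono) auto
    also have "ennreal (1 / d) * ennreal (d * e) + ennreal d * ennreal P = ennreal (e + d * P)"
      using d(1) P(2) \<open>0 < e\<close> by (simp flip: ennreal_mult' ennreal_plus)
    also have "ennreal (e + d * P) \<le> ennreal (2 * e)"
      using d(2) by (intro ennreal_leI) simp
    finally show "(\<integral>\<^sup>+\<xi>. ennreal (cmod (fourier (?g R) \<xi>) * cmod (fourier \<psi> \<xi>)) \<partial>lborel) \<le>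
        (\<integral>\<^sup>+\<xi>. ennreal (cmod (h \<xi>) * cmod (fourier \<psi> \<xi>)) \<partial>lborel) + ennreal (2 * e)"
      by (simp add: add_left_mono)
  qed simp
  also have "\<dots> \<le> ennreal (1 / (2 * pi)) * (\<integral>\<^sup>+\<xi>. ennreal (cmod (h \<xi>) * cmod (fourier \<psi> \<xi>)) \<partial>lborel) + ennreal e"
  proof -
    have "1 / (2 * pi) * (2 * e) \<le> e"
      using pi_gt3 \<open>0 < e\<close> by (simp add: field_simps)
    then have "ennreal (1 / (2 * pi)) * ennreal (2 * e) \<le> ennreal e"
      using \<open>0 < e\<close> by (subst ennreal_mult'[symmetric]) (auto intro: ennreal_leI)
    then show ?thesis by (simp only: distrib_left add_left_mono)
  qed
  finally show "ennreal \<bar>LINT x|lborel. g x * \<psi> x\<bar> \<le>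
    ennreal (1 / (2 * pi)) * (\<integral>\<^sup>+\<xi>. ennreal (cmod (h \<xi>) * cmod (fourier \<psi> \<xi>)) \<partial>lborel) + ennreal e" .
qed

section \<open>Supports of derivatives, integration by parts and elementary transforms\<close>

lemma deriv_eq_0_outside_support:
  assumes "x \<notin> closure {x. f x \<noteq> 0}"
  shows "deriv f x = (0 :: real)"
proof (rule DERIV_imp_deriv)
  show "(f has_real_derivative 0) (at x)"
  proof (rule has_field_derivative_transform_within_open)
    show "((\<lambda>_. 0) has_real_derivative 0) (at x)" by simp
    show "open (- closure {x. f x \<noteq> 0})" by (simp add: open_Compl)
    show "x \<in> - closure {x. f x \<noteq> 0}" using assms by simp
    show "0 = f y" if "y \<in> - closure {x. f x \<noteq> 0}" for y
      using that closure_subset[of "{x. f x \<noteq> 0}"] by auto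
  qed
qed

lemma support_funpow_deriv:
  fixes f :: "real \<Rightarrow> real"
  shows "{x. (deriv ^^ n) f x \<noteq> 0} \<subseteq> closure {x. f x \<noteq> 0}"
proof (induction n)
  case 0
  show ?case by (simp add: closure_subset)
next
  case (Suc n)
  then have "closure {x. (deriv ^^ n) f x \<noteq> 0} \<subseteq> closure {x. f x \<noteq> 0}"
    by (simp add: closure_minimal)
  then show ?case
    using deriv_eq_0_outside_support[of _ "(deriv ^^ n) f"] by auto
qed

lemma test_function_deriv:
  assumes "test_function f"
  shows "test_function (deriv f)"
proof -
  have "closure {x. deriv f x \<noteq> 0} \<subseteq> closure {x. f x \<noteq> 0}"
    using support_funpow_deriv[of 1 f] by (simp add: closure_minimal)
  moreover have "compact (closure {x. f x \<noteq> 0})"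
    using assms by (simp add: test_function_def)
  ultimately have "compact (closure {x. deriv f x \<noteq> 0})"
    by (metis bounded_subset closed_closure compact_eq_bounded_closed)
  then show ?thesis
    using smooth_deriv[OF test_function_imp_smooth[OF assms]] by (simp add: test_function_def smooth_def)
qed

lemma LINT_parts_test_function:
  assumes f: "\<And>x. (f has_real_derivative f' x) (at x)" "continuous_on UNIV f'" and \<phi>: "test_function \<phi>"
  shows "(LINT x|lborel. f x * deriv \<phi> x) = - (LINT x|lborel. f' x * \<phi> x)"
proof -
  note sm = test_function_imp_smooth[OF \<phi>]
  have contf: "continuous_on A f" for A
    by (meson DERIV_continuous_on f(1) has_field_derivative_at_within)
  have contf': "continuous_on A f'" for A
    using f(2) continuous_on_subset by blast
  obtain M where M: "0 < M" "\<And>x. M \<le> \<bar>x\<bar> \<Longrightarrow> \<phi> x = 0"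
    using test_function_bounded_support[OF \<phi>] by blast
  obtain N where N: "0 < N" "\<And>x. N \<le> \<bar>x\<bar> \<Longrightarrow> deriv \<phi> x = 0"
    using test_function_bounded_support[OF test_function_deriv[OF \<phi>]] by blast
  define K where "K = max M N"
  have K: "0 < K" "\<And>x. K \<le> \<bar>x\<bar> \<Longrightarrow> \<phi> x = 0" "\<And>x. K \<le> \<bar>x\<bar> \<Longrightarrow> deriv \<phi> x = 0"
    using M N by (auto simp: K_def)
  have 1: "continuous_on {-K..K} (\<lambda>x. f x * deriv \<phi> x)" "\<And>z. f z * deriv \<phi> z \<noteq> 0 \<Longrightarrow> z \<in> {-K..K}"
    subgoal by (intro continuous_intros contf smooth_imp_continuous_on smooth_deriv sm)
    subgoal for z using K(3)[of z] by (cases "K \<le> \<bar>z\<bar>") (auto simp: abs_if split: if_splits)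
    done
  have 2: "continuous_on {-K..K} (\<lambda>x. f' x * \<phi> x)" "\<And>z. f' z * \<phi> z \<noteq> 0 \<Longrightarrow> z \<in> {-K..K}"
    subgoal by (intro continuous_intros contf' smooth_imp_continuous_on sm)
    subgoal for z using K(2)[of z] by (cases "K \<le> \<bar>z\<bar>") (auto simp: abs_if split: if_splits)
    done
  have "((\<lambda>x. f' x * \<phi> x + deriv \<phi> x * f x) has_integral (f K * \<phi> K - f (-K) * \<phi> (-K))) {-K..K}"
  proof (rule fundamental_theorem_of_calculus)
    fix x
    show "((\<lambda>x. f x * \<phi> x) has_vector_derivative f' x * \<phi> x + deriv \<phi> x * f x) (at x within {-K..K})"
      unfolding has_real_derivative_iff_has_vector_derivative[symmetric]
      by (intro DERIV_mult has_field_derivative_at_within[OF f(1)]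
          has_field_derivative_at_within[OF smooth_imp_DERIV[OF sm]])
  qed (use K(1) in simp)
  then have "integral {-K..K} (\<lambda>x. f' x * \<phi> x + f x * deriv \<phi> x) = 0"
    using K(1,2) by (simp add: integral_unique mult.commute)
  then have "integral {-K..K} (\<lambda>x. f' x * \<phi> x) + integral {-K..K} (\<lambda>x. f x * deriv \<phi> x) = 0"
    by (subst (asm) Henstock_Kurzweil_Integration.integral_add)
       (auto intro!: integrable_continuous_real 1 2)
  then show ?thesis
    using integrable_continuous_compact_support(2)[OF 1] integrable_continuous_compact_support(2)[OF 2] by simp
qed

lemma integrable_inverse_1_plus_square_lborel: "integrable lborel (\<lambda>\<xi>::real. 1 / (1 + \<xi>\<^sup>2))"
  and LINT_inverse_1_plus_square: "(LINT \<xi>|lborel. 1 / (1 + \<xi>\<^sup>2)) = pi"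
  using integrable_inverse_1_plus_square LBINT_inverse_1_plus_square
  by (simp_all add: einterval_def set_integrable_def interval_lebesgue_integral_def
      set_lebesgue_integral_def inverse_eq_divide)

text \<open>The mass is the same at every scale \<open>s\<close>. This invariance is what keeps the
  estimates at the critical exponent 1/2 uniform as \<open>s\<close> tends to 0.\<close>

lemma integrable_cauchy_kernel: "0 < s \<Longrightarrow> integrable lborel (\<lambda>\<xi>::real. s / (1 + s\<^sup>2 * \<xi>\<^sup>2))"
  and LINT_cauchy_kernel: "0 < s \<Longrightarrow> (LINT \<xi>|lborel. s / (1 + s\<^sup>2 * \<xi>\<^sup>2)) = pi"
proof -
  assume s: "0 < s"
  have "integrable lborel (\<lambda>\<xi>. 1 / (1 + (0 + s * \<xi>)\<^sup>2))"
    by (rule lborel_integrable_real_affine[OF integrable_inverse_1_plus_square_lborel]) (use s in simp)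
  then have "integrable lborel (\<lambda>\<xi>. s * (1 / (1 + (0 + s * \<xi>)\<^sup>2)))"
    by (rule integrable_mult_right)
  then show "integrable lborel (\<lambda>\<xi>. s / (1 + s\<^sup>2 * \<xi>\<^sup>2))"
    by (simp add: power_mult_distrib)
  have "pi = \<bar>s\<bar> *\<^sub>R (LINT \<xi>|lborel. 1 / (1 + (0 + s * \<xi>)\<^sup>2))"
    unfolding LINT_inverse_1_plus_square[symmetric] by (rule lborel_integral_real_affine) (use s in simp)
  also have "\<dots> = (LINT \<xi>|lborel. s * (1 / (1 + (0 + s * \<xi>)\<^sup>2)))"
    using s by (simp only: integral_mult_right_zero) simp
  finally show "(LINT \<xi>|lborel. s / (1 + s\<^sup>2 * \<xi>\<^sup>2)) = pi"
    by (simp add: power_mult_distrib)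
qed

text \<open>The formula for the transform is kept multiplied by the frequency, so that it holds at
  frequency 0 as well and no case distinction arises.\<close>

lemma fourier_indicator:
  assumes "x \<le> y"
  shows "cmod (fourier (indicat_real {x..y}) \<xi>) \<le> y - x"
    and "- (\<i> * \<xi>) * fourier (indicat_real {x..y}) \<xi> = cis (- (y * \<xi>)) - cis (- (x * \<xi>))"
proof -
  show "cmod (fourier (indicat_real {x..y}) \<xi>) \<le> y - x"
    using norm_fourier_le[of "indicat_real {x..y}" \<xi>] assms
    by (simp add: emeasure_lborel_Icc_eq)
  have "(LINT z|lborel. indicat_real {x..y} z *\<^sub>R (- (\<i> * \<xi>) * cis (- (z * \<xi>)))) =
      cis (- (y * \<xi>)) - cis (- (x * \<xi>))"
  proof (rule integral_FTC_Icc[OF assms])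
    show "((\<lambda>z. cis (- (z * \<xi>))) has_vector_derivative - (\<i> * \<xi>) * cis (- (z * \<xi>))) (at z within {x..y})" for z
    proof -
      have "((\<lambda>w. exp (- (\<i> * \<xi>) * w)) has_field_derivative - (\<i> * \<xi>) * exp (- (\<i> * \<xi>) * of_real z)) (at (of_real z))"
        by (auto intro!: derivative_eq_intros)
      from has_vector_derivative_real_field[OF this] show ?thesis
        by (simp add: cis_conv_exp mult_ac)
    qed
    show "continuous_on {x..y} (\<lambda>z. - (\<i> * \<xi>) * cis (- (z * \<xi>)))"
      by (intro continuous_intros)
  qed
  then show "- (\<i> * \<xi>) * fourier (indicat_real {x..y}) \<xi> = cis (- (y * \<xi>)) - cis (- (x * \<xi>))"
    unfolding fourier_def by (simp add: scaleR_conv_of_real mult_ac flip: integral_mult_right_zero)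
qed

section \<open>Growth from a square integrable derivative, and absence of jumps\<close>

lemma LINT_mult_indicator_Icc:
  fixes g :: "real \<Rightarrow> real"
  assumes [measurable]: "g \<in> borel_measurable borel"
  shows "(LINT z|lborel. g z * indicat_real {x..y} z) = (LINT z:{x<..y}|lborel. g z)"
  unfolding set_lebesgue_integral_def
proof (rule integral_cong_AE)
  show "AE z in lborel. g z * indicat_real {x..y} z = indicat_real {x<..y} z *\<^sub>R g z"
    using AE_lborel_singleton[of x] by eventually_elim (auto simp: indicator_def)
qed auto

text \<open>The increment of \<open>f\<close> is the pairing of \<open>g\<close> with the indicator
  of \<open>[x, y]\<close>, whose transform is at most \<open>y - x\<close> and decays like the
  inverse frequency. A weighted form of \<open>2 a b \<le> a^2 + b^2\<close> then gives a bound
  linear in the length, with a constant depending on \<open>g\<close> only through \<open>B\<close>;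
  this makes it uniform in time later.\<close>

lemma weak_deriv_growth:
  assumes f: "continuous_on UNIV f" and fg: "weak_deriv 1 f g" and gh: "has_fourier g h"
    and hB: "(\<integral>\<^sup>+\<xi>. ennreal ((cmod (h \<xi>))\<^sup>2) \<partial>lborel) \<le> ennreal B" and B: "0 \<le> B" and xy: "x \<le> y"
  shows "\<bar>f y - f x\<bar> \<le> (1 + (y - x)) * (B + 5 * pi)"
proof -
  define L where "L = 1 + (y - x)"
  have L: "1 \<le> L" using xy by (simp add: L_def)
  let ?\<psi> = "indicat_real {x..y}"
  have [measurable]: "h \<in> borel_measurable borel" "g \<in> borel_measurable borel"
    using gh by (auto simp: has_fourier_def)
  have "(LINT z:{x<..y}|lborel. g z) = f y - f x"
  proof (rule weak_deriv_difference[of f "x" "y + 1"])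
    show "set_integrable lborel {x..y + 1} g"
      using fg by (auto simp: weak_deriv_def locally_integrable_on_def)
    show "(LINT z|lborel. f z * deriv \<phi> z) = - (LINT z|lborel. g z * \<phi> z)" if "test_function \<phi>" for \<phi>
      using fg that by (simp add: weak_deriv_def)
  qed (use f xy in auto)
  then have eq: "(LINT z|lborel. g z * ?\<psi> z) = f y - f x"
    by (subst LINT_mult_indicator_Icc) auto
  \<comment> \<open>The constant 5 is 1 + 4: the squared transform is at most \<open>L^2\<close>,
    and its product with the squared frequency at most 4, hence at most
    \<open>4 L^2\<close>.\<close>
  have F2: "(cmod (fourier ?\<psi> \<xi>))\<^sup>2 \<le> 5 * L\<^sup>2 * (1 / (1 + \<xi>\<^sup>2))" for \<xi>
  proof -
    let ?b = "cmod (fourier ?\<psi> \<xi>)"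
    have "?b \<le> L" using fourier_indicator(1)[OF xy, of \<xi>] by (simp add: L_def)
    then have 1: "?b\<^sup>2 \<le> L\<^sup>2" by (intro power_mono) auto
    have "\<bar>\<xi>\<bar> * ?b = cmod (cis (- (y * \<xi>)) - cis (- (x * \<xi>)))"
      by (subst fourier_indicator(2)[OF xy, symmetric]) (simp add: norm_mult)
    also have "\<dots> \<le> 1 + 1" by (rule order_trans[OF norm_triangle_ineq4]) simp
    finally have "(\<bar>\<xi>\<bar> * ?b)\<^sup>2 \<le> 2\<^sup>2" by (intro power_mono) auto
    moreover have "1 \<le> L\<^sup>2" using L by simp
    ultimately have "?b\<^sup>2 * (1 + \<xi>\<^sup>2) \<le> 5 * L\<^sup>2"
      using 1 by (simp add: power_mult_distrib distrib_right distrib_left mult.commute)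
    then show ?thesis by (simp add: field_simps add_pos_nonneg)
  qed
  have ci: "(\<integral>\<^sup>+\<xi>. ennreal (c * (1 / (1 + \<xi>\<^sup>2))) \<partial>lborel) = ennreal (c * pi)" if "0 \<le> c" for c
  proof -
    have "(\<integral>\<^sup>+\<xi>. ennreal (c * (1 / (1 + \<xi>\<^sup>2))) \<partial>lborel) = ennreal (LINT \<xi>|lborel. c * (1 / (1 + \<xi>\<^sup>2)))"
      using that by (intro nn_integral_eq_integral integrable_mult_right
          integrable_inverse_1_plus_square_lborel AE_I2) simp
    then show ?thesis by (simp only: integral_mult_right_zero LINT_inverse_1_plus_square)
  qed
  have sq: "(\<integral>\<^sup>+\<xi>. ennreal ((cmod (fourier ?\<psi> \<xi>))\<^sup>2) \<partial>lborel) < \<infinity>"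
  proof -
    have "(\<integral>\<^sup>+\<xi>. ennreal ((cmod (fourier ?\<psi> \<xi>))\<^sup>2) \<partial>lborel) \<le>
        (\<integral>\<^sup>+\<xi>. ennreal (5 * L\<^sup>2 * (1 / (1 + \<xi>\<^sup>2))) \<partial>lborel)"
      by (intro nn_integral_mono ennreal_leI F2)
    also have "\<dots> < \<infinity>" by (subst ci) auto
    finally show ?thesis .
  qed
  have "ennreal \<bar>f y - f x\<bar> \<le> ennreal (1 / (2 * pi)) * (\<integral>\<^sup>+\<xi>. ennreal (cmod (h \<xi>) * cmod (fourier ?\<psi> \<xi>)) \<partial>lborel)"
    unfolding eq[symmetric]
  proof (rule fourier_pairing_bound[OF gh, where K = "\<bar>x\<bar> + \<bar>y\<bar>"])
    show "\<bar>z\<bar> \<le> \<bar>x\<bar> + \<bar>y\<bar>" if "?\<psi> z \<noteq> 0" for z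
      using that by (auto simp: indicator_def split: if_splits)
    show "AE z in lborel. isCont ?\<psi> z"
      using AE_lborel_singleton[of x] AE_lborel_singleton[of y]
      by eventually_elim (use xy in \<open>auto simp: isCont_indicator frontier_def\<close>)
    show "\<bar>?\<psi> z\<bar> \<le> 1" for z
      by (simp add: indicator_def)
    show "?\<psi> \<in> borel_measurable borel" by measurable
  qed (rule sq)
  also have "\<dots> \<le> 1 * (\<integral>\<^sup>+\<xi>. ennreal L * ennreal ((cmod (h \<xi>))\<^sup>2) + ennreal (5 * L * (1 / (1 + \<xi>\<^sup>2))) \<partial>lborel)"
  proof (intro mult_mono nn_integral_mono)
    show "ennreal (1 / (2 * pi)) \<le> 1"
      using pi_gt3 by (simp add: field_simps)
    fix \<xi>
    let ?a = "cmod (h \<xi>)" and ?b = "cmod (fourier ?\<psi> \<xi>)"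
    \<comment> \<open>This yields \<open>p q \<le> p^2 + q^2\<close> for \<open>p = L * ?a\<close>
      and \<open>q = ?b\<close>; after division by \<open>L\<close> both terms grow only linearly in
      \<open>L\<close>.\<close>
    have "0 \<le> (L * ?a - ?b)\<^sup>2 + (L * ?a)\<^sup>2 + ?b\<^sup>2" by simp
    then have "L * (?a * ?b) \<le> (L * ?a)\<^sup>2 + ?b\<^sup>2"
      by (simp add: power2_eq_square algebra_simps)
    also have "\<dots> \<le> (L * ?a)\<^sup>2 + 5 * L\<^sup>2 * (1 / (1 + \<xi>\<^sup>2))" using F2 by simp
    also have "\<dots> = L * (L * ?a\<^sup>2 + 5 * L * (1 / (1 + \<xi>\<^sup>2)))"
      by (simp add: power2_eq_square algebra_simps)
    finally have "?a * ?b \<le> L * ?a\<^sup>2 + 5 * L * (1 / (1 + \<xi>\<^sup>2))"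
      using L by (simp only: mult_le_cancel_left_pos)
    then show "ennreal (?a * ?b) \<le> ennreal L * ennreal (?a\<^sup>2) + ennreal (5 * L * (1 / (1 + \<xi>\<^sup>2)))"
      using L by (simp add: ennreal_leI add_nonneg_nonneg flip: ennreal_mult' ennreal_plus)
  qed auto
  also have "\<dots> = ennreal L * (\<integral>\<^sup>+\<xi>. ennreal ((cmod (h \<xi>))\<^sup>2) \<partial>lborel) + ennreal (5 * L * pi)"
    using L by (simp add: nn_integral_add nn_integral_cmult ci[of "5 * L", simplified])
  also have "\<dots> \<le> ennreal L * ennreal B + ennreal (5 * L * pi)"
    by (intro add_right_mono mult_left_mono hB) simp
  also have "\<dots> = ennreal (L * (B + 5 * pi))"
    using L B by (simp add: distrib_left mult_ac flip: ennreal_mult' ennreal_plus)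
  finally show ?thesis
    using L B by (simp add: L_def)
qed

lemma fourier_diff:
  assumes "integrable lborel f" "integrable lborel g"
  shows "fourier (\<lambda>x. f x - g x) \<xi> = fourier f \<xi> - fourier g \<xi>"
proof -
  have "integrable lborel (\<lambda>x. cis (- (x * \<xi>)) * complex_of_real (k x))"
    if k: "integrable lborel k" for k
  proof (rule Bochner_Integration.integrable_bound[OF k])
    show "AE x in lborel. norm (cis (- (x * \<xi>)) * complex_of_real (k x)) \<le> norm (k x)"
      by (simp add: norm_mult)
  qed (use k in measurable)
  then show ?thesis
    using assms by (simp add: fourier_def right_diff_distrib)
qed

text \<open>Testing with \<open>1\<close> on \<open>(0, s)\<close> and \<open>-1\<close> on \<open>(-s, 0)\<close>, divided by \<open>s\<close>, measures the jump of \<open>g\<close>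
  at \<open>0\<close>, while these test functions tend to \<open>0\<close> weakly, and stay bounded, in \<open>H\<^sup>-\<^sup>1\<^sup>/\<^sup>2\<close>.\<close>

lemma half_derivative_no_jump:
  assumes f: "\<And>x. (f has_real_derivative f' x) (at x)" "continuous_on UNIV f'"
    and fg: "weak_deriv 2 f g" and gh: "has_fourier g h"
    and fin: "(\<integral>\<^sup>+\<xi>. ennreal ((1 + \<xi>\<^sup>2) powr r * (cmod (h \<xi>))\<^sup>2) \<partial>lborel) < \<infinity>" and r: "1 / 2 \<le> r"
    and s: "\<And>n. 0 < s n" "s \<longlonglongrightarrow> 0"
  shows "(\<lambda>n. (f' (s n) - 2 * f' 0 + f' (- s n)) / s n) \<longlonglongrightarrow> 0"
proof -
  have [measurable]: "h \<in> borel_measurable borel" "g \<in> borel_measurable borel"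
    using gh by (auto simp: has_fourier_def)
  have diff: "(LINT z:{x<..y}|lborel. g z) = f' y - f' x" if "x \<le> y" for x y
  proof (rule weak_deriv_difference[of f' "x" "y + 1"])
    show "set_integrable lborel {x..y + 1} g"
      using fg by (auto simp: weak_deriv_def locally_integrable_on_def)
    show "(LINT z|lborel. f' z * deriv \<phi> z) = - (LINT z|lborel. g z * \<phi> z)" if "test_function \<phi>" for \<phi>
      using fg that LINT_parts_test_function[OF f test_function_deriv[OF that]]
      by (simp add: weak_deriv_def numeral_2_eq_2)
  qed (use f that in auto)
  define \<psi> where "\<psi> n z = indicat_real {0..s n} z - indicat_real {- s n..0} z" for n z
  have \<psi>_meas [measurable]: "\<psi> n \<in> borel_measurable borel" for n
    unfolding \<psi>_def by measurable
  have gi: "set_integrable lborel {a..b} g" for a b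
    using fg by (auto simp: weak_deriv_def locally_integrable_on_def)
  have gi': "integrable lborel (\<lambda>z. g z * indicat_real {a..b} z)" for a b
    using gi[of a b] by (simp add: set_integrable_def mult.commute)
  have eq: "(LINT z|lborel. g z * \<psi> n z) = f' (s n) - 2 * f' 0 + f' (- s n)" for n
  proof -
    have "(LINT z|lborel. g z * \<psi> n z) =
        (LINT z|lborel. g z * indicat_real {0..s n} z) - (LINT z|lborel. g z * indicat_real {- s n..0} z)"
      by (simp add: \<psi>_def right_diff_distrib gi')
    also have "\<dots> = (f' (s n) - f' 0) - (f' 0 - f' (- s n))"
      using s(1)[of n] by (simp add: LINT_mult_indicator_Icc diff)
    finally show ?thesis by simp
  qed
  \<comment> \<open>Two bounds for \<open>|\<xi>|\<close> times the transform are merged into one: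
    \<open>s^2 \<xi>^2\<close>, good at low frequencies, and 4, good at high ones. Their sum of
    constants is the 5.\<close>
  have F: "cmod (fourier (\<psi> n) \<xi>) \<le> 5 * (s n)\<^sup>2 * \<bar>\<xi>\<bar> / (1 + (s n)\<^sup>2 * \<xi>\<^sup>2)" if "\<xi> \<noteq> 0" for n \<xi>
  proof -
    let ?s = "s n" and ?b = "cmod (fourier (\<psi> n) \<xi>)"
    have pos: "0 < ?s" by (rule s)
    have "- (\<i> * \<xi>) * fourier (\<psi> n) \<xi> = - (\<i> * \<xi>) * fourier (indicat_real {0..?s}) \<xi> -
        (- (\<i> * \<xi>) * fourier (indicat_real {- ?s..0}) \<xi>)"
      unfolding \<psi>_def
      by (subst fourier_diff) (auto simp: emeasure_lborel_Icc_eq right_diff_distrib)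
    also have "\<dots> = complex_of_real (2 * cos (?s * \<xi>) - 2)"
      using pos by (subst (1 2) fourier_indicator(2)) (auto simp: complex_eq_iff)
    finally have "cmod (- (\<i> * \<xi>) * fourier (\<psi> n) \<xi>) = \<bar>2 * cos (?s * \<xi>) - 2\<bar>"
      by (simp only: norm_of_real)
    then have b: "\<bar>\<xi>\<bar> * ?b = 2 - 2 * cos (?s * \<xi>)" by (simp add: norm_mult)
    have "2 - 2 * cos (?s * \<xi>) = 4 * (sin (?s * \<xi> / 2))\<^sup>2"
      using cos_double_sin[of "?s * \<xi> / 2"] by simp
    moreover have "(sin (?s * \<xi> / 2))\<^sup>2 \<le> (?s * \<xi> / 2)\<^sup>2"
      using abs_sin_x_le_abs_x[of "?s * \<xi> / 2"] unfolding abs_le_square_iff .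
    ultimately have b1: "\<bar>\<xi>\<bar> * ?b \<le> ?s\<^sup>2 * \<xi>\<^sup>2"
      using b by (simp add: power_mult_distrib power_divide)
    have b2: "\<bar>\<xi>\<bar> * ?b \<le> 4"
      using b cos_ge_minus_one[of "?s * \<xi>"] by linarith
    have "(\<bar>\<xi>\<bar> * ?b) * (1 + ?s\<^sup>2 * \<xi>\<^sup>2) = \<bar>\<xi>\<bar> * ?b + (\<bar>\<xi>\<bar> * ?b) * (?s\<^sup>2 * \<xi>\<^sup>2)"
      by (simp add: distrib_left)
    also have "\<dots> \<le> ?s\<^sup>2 * \<xi>\<^sup>2 + 4 * (?s\<^sup>2 * \<xi>\<^sup>2)"
      by (intro add_mono b1 mult_right_mono b2) simp
    also have "\<dots> = \<bar>\<xi>\<bar> * (5 * ?s\<^sup>2 * \<bar>\<xi>\<bar>)" by (simp add: power2_eq_square[of \<xi>])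
    finally have "\<bar>\<xi>\<bar> * (?b * (1 + ?s\<^sup>2 * \<xi>\<^sup>2)) \<le> \<bar>\<xi>\<bar> * (5 * ?s\<^sup>2 * \<bar>\<xi>\<bar>)"
      by (simp only: mult.assoc)
    then have "?b * (1 + ?s\<^sup>2 * \<xi>\<^sup>2) \<le> 5 * ?s\<^sup>2 * \<bar>\<xi>\<bar>"
      by (rule mult_left_le_imp_le) (use that in simp)
    moreover have "0 < 1 + ?s\<^sup>2 * \<xi>\<^sup>2" by (intro add_pos_nonneg) auto
    ultimately show ?thesis by (simp only: pos_le_divide_eq)
  qed
  have ci: "(\<integral>\<^sup>+\<xi>. ennreal (c * (s n / (1 + (s n)\<^sup>2 * \<xi>\<^sup>2))) \<partial>lborel) = ennreal (c * pi)" if "0 \<le> c" for c n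
  proof -
    have "0 \<le> s n / (1 + (s n)\<^sup>2 * \<xi>\<^sup>2)" for \<xi>
      using s(1)[of n] by (intro divide_nonneg_nonneg add_nonneg_nonneg) auto
    then have "(\<integral>\<^sup>+\<xi>. ennreal (c * (s n / (1 + (s n)\<^sup>2 * \<xi>\<^sup>2))) \<partial>lborel) =
        ennreal (LINT \<xi>|lborel. c * (s n / (1 + (s n)\<^sup>2 * \<xi>\<^sup>2)))"
      using that by (intro nn_integral_eq_integral integrable_mult_right
          integrable_cauchy_kernel s(1) AE_I2 mult_nonneg_nonneg)
    then show ?thesis by (simp only: integral_mult_right_zero LINT_cauchy_kernel[OF s(1)])
  qed
  have sq: "(\<integral>\<^sup>+\<xi>. ennreal ((cmod (fourier (\<psi> n) \<xi>))\<^sup>2) \<partial>lborel) < \<infinity>" for n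
  proof -
    have "(\<integral>\<^sup>+\<xi>. ennreal ((cmod (fourier (\<psi> n) \<xi>))\<^sup>2) \<partial>lborel) \<le>
        (\<integral>\<^sup>+\<xi>. ennreal (25 * s n * (s n / (1 + (s n)\<^sup>2 * \<xi>\<^sup>2))) \<partial>lborel)"
    proof (rule nn_integral_mono_AE, use AE_lborel_singleton[of 0] in eventually_elim, rule ennreal_leI)
      fix \<xi> :: real assume "\<xi> \<noteq> 0"
      let ?d = "1 + (s n)\<^sup>2 * \<xi>\<^sup>2"
      have d: "0 < ?d" by (intro add_pos_nonneg) auto
      have "(cmod (fourier (\<psi> n) \<xi>))\<^sup>2 \<le> (5 * (s n)\<^sup>2 * \<bar>\<xi>\<bar> / ?d)\<^sup>2"
        by (intro power_mono F \<open>\<xi> \<noteq> 0\<close>) simp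
      also have "\<dots> = 25 * s n * (s n / ?d) * ((s n)\<^sup>2 * \<xi>\<^sup>2 / ?d)"
        by (simp add: power_mult_distrib power_divide power2_eq_square)
      also have "\<dots> \<le> 25 * s n * (s n / ?d) * 1"
      proof (rule mult_left_mono)
        show "(s n)\<^sup>2 * \<xi>\<^sup>2 / ?d \<le> 1" using d by (simp add: field_simps)
        show "0 \<le> 25 * s n * (s n / ?d)" using d s(1)[of n] by simp
      qed
      finally show "(cmod (fourier (\<psi> n) \<xi>))\<^sup>2 \<le> 25 * s n * (s n / ?d)" by simp
    qed
    also have "\<dots> < \<infinity>" using s(1)[of n] by (subst ci) auto
    finally show ?thesis .
  qed
  \<comment> \<open>Here the exponent enters: for \<open>r \<ge> 1/2\<close> the weight of the norm
    dominates \<open>|\<xi>|\<close>, which is exactly the growth that the test functions leave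
    over.\<close>
  have hint: "integrable lborel (\<lambda>\<xi>. (cmod (h \<xi>))\<^sup>2 * \<bar>\<xi>\<bar>)"
  proof (rule integrableI_bounded)
    have "(\<integral>\<^sup>+\<xi>. ennreal (norm ((cmod (h \<xi>))\<^sup>2 * \<bar>\<xi>\<bar>)) \<partial>lborel) \<le>
        (\<integral>\<^sup>+\<xi>. ennreal ((1 + \<xi>\<^sup>2) powr r * (cmod (h \<xi>))\<^sup>2) \<partial>lborel)"
    proof (rule nn_integral_mono, rule ennreal_leI)
      fix \<xi> :: real
      have "\<bar>\<xi>\<bar> = sqrt (\<xi>\<^sup>2)" by simp
      also have "\<dots> \<le> sqrt (1 + \<xi>\<^sup>2)" by (intro real_sqrt_le_mono) simp
      also have "\<dots> = (1 + \<xi>\<^sup>2) powr (1 / 2)" by (simp add: powr_half_sqrt add_nonneg_nonneg)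
      also have "\<dots> \<le> (1 + \<xi>\<^sup>2) powr r" using r by (intro powr_mono) auto
      finally show "norm ((cmod (h \<xi>))\<^sup>2 * \<bar>\<xi>\<bar>) \<le> (1 + \<xi>\<^sup>2) powr r * (cmod (h \<xi>))\<^sup>2"
        using mult_right_mono[of "\<bar>\<xi>\<bar>" "(1 + \<xi>\<^sup>2) powr r" "(cmod (h \<xi>))\<^sup>2"]
        by (simp add: abs_mult mult.commute)
    qed
    with fin show "(\<integral>\<^sup>+\<xi>. ennreal (norm ((cmod (h \<xi>))\<^sup>2 * \<bar>\<xi>\<bar>)) \<partial>lborel) < \<infinity>"
      by (rule le_less_trans[rotated])
  qed measurable
  \<comment> \<open>An integrable function times a factor in [0, 1] that tends to 0 at each
    frequency as the scale shrinks, so its integral tends to 0 by dominated convergence.\<close>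
  define k where "k n \<xi> = (cmod (h \<xi>))\<^sup>2 * \<bar>\<xi>\<bar> * (s n * \<bar>\<xi>\<bar> / (1 + (s n)\<^sup>2 * \<xi>\<^sup>2))" for n \<xi>
  have kfac: "0 \<le> s n * \<bar>\<xi>\<bar> / (1 + (s n)\<^sup>2 * \<xi>\<^sup>2)" "s n * \<bar>\<xi>\<bar> / (1 + (s n)\<^sup>2 * \<xi>\<^sup>2) \<le> 1" for n \<xi>
  proof -
    have d: "0 < 1 + (s n)\<^sup>2 * \<xi>\<^sup>2" by (intro add_pos_nonneg) auto
    show "0 \<le> s n * \<bar>\<xi>\<bar> / (1 + (s n)\<^sup>2 * \<xi>\<^sup>2)" using d s(1)[of n] by simp
    have "0 \<le> (s n * \<bar>\<xi>\<bar> - 1)\<^sup>2 + s n * \<bar>\<xi>\<bar>" using s(1)[of n] by simp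
    then have "s n * \<bar>\<xi>\<bar> \<le> 1 + (s n)\<^sup>2 * \<xi>\<^sup>2"
      by (simp add: power2_diff power_mult_distrib algebra_simps)
    with d show "s n * \<bar>\<xi>\<bar> / (1 + (s n)\<^sup>2 * \<xi>\<^sup>2) \<le> 1" by simp
  qed
  have k_bound: "\<bar>k n \<xi>\<bar> \<le> (cmod (h \<xi>))\<^sup>2 * \<bar>\<xi>\<bar>" for n \<xi>
  proof -
    have "\<bar>X * Y\<bar> \<le> X" if "0 \<le> X" "0 \<le> Y" "Y \<le> 1" for X Y :: real
      using that by (simp add: abs_mult mult_left_le)
    then show ?thesis
      unfolding k_def using kfac[of n \<xi>] by (metis abs_ge_zero mult_nonneg_nonneg zero_le_power2)
  qed
  have k_int: "integrable lborel (k n)" for n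
  proof (rule Bochner_Integration.integrable_bound[OF hint])
    show "k n \<in> borel_measurable lborel" unfolding k_def by measurable
    show "AE \<xi> in lborel. norm (k n \<xi>) \<le> norm ((cmod (h \<xi>))\<^sup>2 * \<bar>\<xi>\<bar>)"
      using k_bound[of n] by (intro AE_I2) simp
  qed
  have k_nonneg: "0 \<le> k n \<xi>" for n \<xi>
    unfolding k_def by (intro mult_nonneg_nonneg kfac(1)) auto
  have k_lim: "(\<lambda>n. LINT \<xi>|lborel. k n \<xi>) \<longlonglongrightarrow> (LINT (\<xi>::real)|lborel. 0)"
  proof (rule integral_dominated_convergence[where w = "\<lambda>\<xi>. (cmod (h \<xi>))\<^sup>2 * \<bar>\<xi>\<bar>"])
    show "AE \<xi> in lborel. (\<lambda>n. k n \<xi>) \<longlonglongrightarrow> 0"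
    proof (rule AE_I2)
      fix \<xi>
      have "(\<lambda>n. k n \<xi>) \<longlonglongrightarrow> (cmod (h \<xi>))\<^sup>2 * \<bar>\<xi>\<bar> * (0 * \<bar>\<xi>\<bar> / (1 + 0\<^sup>2 * \<xi>\<^sup>2))"
        unfolding k_def by (intro tendsto_intros s) simp
      then show "(\<lambda>n. k n \<xi>) \<longlonglongrightarrow> 0" by simp
    qed
  qed (use hint k_bound k_int in auto)
  \<comment> \<open>The parameter \<open>d\<close> is free because the two terms behave differently:
    for fixed \<open>d\<close> the first tends to 0 with \<open>n\<close>, whereas
    \<open>d * pi\<close>, the mass of the Cauchy kernel, does not shrink with the scale and is made
    small by the choice of \<open>d\<close>.\<close>
  have main: "\<bar>(f' (s n) - 2 * f' 0 + f' (- s n)) / s n\<bar> \<le> 5 * (1 / d * (LINT \<xi>|lborel. k n \<xi>) + d * pi)"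
    if d: "0 < d" for n d
  proof -
    have pos: "0 < s n" by (rule s)
    have "ennreal \<bar>f' (s n) - 2 * f' 0 + f' (- s n)\<bar> \<le>
        ennreal (1 / (2 * pi)) * (\<integral>\<^sup>+\<xi>. ennreal (cmod (h \<xi>) * cmod (fourier (\<psi> n) \<xi>)) \<partial>lborel)"
      unfolding eq[symmetric]
    proof (rule fourier_pairing_bound[OF gh, where K = "s n"])
      show "\<bar>z\<bar> \<le> s n" if "\<psi> n z \<noteq> 0" for z
        using that pos by (auto simp: \<psi>_def indicator_def of_bool_def abs_if split: if_splits)
      show "\<bar>\<psi> n z\<bar> \<le> 1" for z
        by (auto simp: \<psi>_def indicator_def)
      show "AE z in lborel. isCont (\<psi> n) z"
        using AE_lborel_singleton[of 0] AE_lborel_singleton[of "s n"] AE_lborel_singleton[of "- s n"]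
        unfolding \<psi>_def
        by eventually_elim
           (use pos in \<open>auto simp: isCont_indicator frontier_def intro!: isCont_diff\<close>)
    qed (rule \<psi>_meas sq)+
    also have "\<dots> \<le> 1 * (\<integral>\<^sup>+\<xi>. ennreal (5 * s n / d * k n \<xi>) + ennreal (5 * s n * d * (s n / (1 + (s n)\<^sup>2 * \<xi>\<^sup>2))) \<partial>lborel)"
    proof (intro mult_mono nn_integral_mono_AE)
      show "ennreal (1 / (2 * pi)) \<le> 1"
        using pi_gt3 by (simp add: field_simps)
      show "AE \<xi> in lborel. ennreal (cmod (h \<xi>) * cmod (fourier (\<psi> n) \<xi>)) \<le>
          ennreal (5 * s n / d * k n \<xi>) + ennreal (5 * s n * d * (s n / (1 + (s n)\<^sup>2 * \<xi>\<^sup>2)))"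
        using AE_lborel_singleton[of 0]
      proof eventually_elim
        fix \<xi> :: real assume "\<xi> \<noteq> 0"
        define q where "q = s n / (1 + (s n)\<^sup>2 * \<xi>\<^sup>2)"
        have q: "0 \<le> q" unfolding q_def using pos by (intro divide_nonneg_nonneg add_nonneg_nonneg) auto
        let ?a = "cmod (h \<xi>)"
        have "\<bar>\<xi>\<bar> * \<bar>\<xi>\<bar> = \<xi>\<^sup>2"
          by (simp add: power2_eq_square)
        moreover have "k n \<xi> = ?a\<^sup>2 * (\<bar>\<xi>\<bar> * \<bar>\<xi>\<bar>) * q"
          unfolding k_def q_def by simp
        ultimately have kq: "k n \<xi> = ?a\<^sup>2 * \<xi>\<^sup>2 * q"
          by simp
        have "?a * cmod (fourier (\<psi> n) \<xi>) \<le> ?a * (5 * (s n)\<^sup>2 * \<bar>\<xi>\<bar> / (1 + (s n)\<^sup>2 * \<xi>\<^sup>2))"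
          by (intro mult_left_mono F \<open>\<xi> \<noteq> 0\<close>) simp
        also have "\<dots> = 5 * s n * q * (?a * \<bar>\<xi>\<bar>)"
          by (simp add: q_def power2_eq_square)
        also have "\<dots> \<le> 5 * s n * q * (1 / d * (?a\<^sup>2 * \<xi>\<^sup>2) + d)"
        proof (rule mult_left_mono)
          have "0 \<le> (?a * \<bar>\<xi>\<bar> - d)\<^sup>2 + d * (?a * \<bar>\<xi>\<bar>)" using d by simp
          then have "d * (?a * \<bar>\<xi>\<bar>) \<le> d * (1 / d * (?a\<^sup>2 * \<xi>\<^sup>2) + d)"
            using d by (simp add: power2_diff power_mult_distrib distrib_left power2_eq_square[of d] mult_ac)
          then show "?a * \<bar>\<xi>\<bar> \<le> 1 / d * (?a\<^sup>2 * \<xi>\<^sup>2) + d"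
            using d by (simp only: mult_le_cancel_left_pos)
        qed (use pos q in simp)
        also have "\<dots> = 5 * s n / d * k n \<xi> + 5 * s n * d * q"
          by (simp add: kq distrib_left)
        finally have le: "?a * cmod (fourier (\<psi> n) \<xi>) \<le> 5 * s n / d * k n \<xi> + 5 * s n * d * q" .
        have "0 \<le> 5 * s n / d * k n \<xi>" "0 \<le> 5 * s n * d * q"
          using pos d q k_nonneg[of n \<xi>] by simp_all
        from ennreal_leI[OF le, unfolded ennreal_plus[OF this]]
        show "ennreal (?a * cmod (fourier (\<psi> n) \<xi>)) \<le>
            ennreal (5 * s n / d * k n \<xi>) + ennreal (5 * s n * d * (s n / (1 + (s n)\<^sup>2 * \<xi>\<^sup>2)))"
          unfolding q_def .
      qed
    qed auto
    also have "\<dots> = (\<integral>\<^sup>+\<xi>. ennreal (5 * s n / d * k n \<xi>) \<partial>lborel) +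
        (\<integral>\<^sup>+\<xi>. ennreal (5 * s n * d * (s n / (1 + (s n)\<^sup>2 * \<xi>\<^sup>2))) \<partial>lborel)"
      using k_int[of n] by (simp add: nn_integral_add)
    also have "(\<integral>\<^sup>+\<xi>. ennreal (5 * s n / d * k n \<xi>) \<partial>lborel) = ennreal (5 * s n / d * (LINT \<xi>|lborel. k n \<xi>))"
      using k_int[of n] k_nonneg pos d by (subst nn_integral_eq_integral) auto
    also have "(\<integral>\<^sup>+\<xi>. ennreal (5 * s n * d * (s n / (1 + (s n)\<^sup>2 * \<xi>\<^sup>2))) \<partial>lborel) = ennreal (5 * s n * d * pi)"
      using pos d by (subst ci) auto
    finally have "\<bar>f' (s n) - 2 * f' 0 + f' (- s n)\<bar> \<le> 5 * s n / d * (LINT \<xi>|lborel. k n \<xi>) + 5 * s n * d * pi"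
      using pos d k_nonneg by (simp add: integral_nonneg flip: ennreal_plus)
    also have "\<dots> = s n * (5 * (1 / d * (LINT \<xi>|lborel. k n \<xi>) + d * pi))"
      using pos d by (simp add: distrib_left mult_ac)
    finally show ?thesis using pos by (simp add: pos_divide_le_eq mult.commute)
  qed
  show ?thesis
  proof (rule LIMSEQ_I)
    fix e :: real assume "0 < e"
    define d where "d = e / (10 * pi)"
    have d: "0 < d" "5 * (d * pi) = e / 2" using \<open>0 < e\<close> by (auto simp: d_def)
    have "(\<lambda>n. 5 * (1 / d * (LINT \<xi>|lborel. k n \<xi>) + d * pi)) \<longlonglongrightarrow> 5 * (1 / d * (LINT (\<xi>::real)|lborel. 0) + d * pi)"
      by (intro tendsto_intros k_lim)
    then have "eventually (\<lambda>n. 5 * (1 / d * (LINT \<xi>|lborel. k n \<xi>) + d * pi) < e) sequentially"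
      by (rule order_tendstoD) (use d \<open>0 < e\<close> in simp)
    then show "\<exists>N. \<forall>n\<ge>N. norm ((f' (s n) - 2 * f' 0 + f' (- s n)) / s n - 0) < e"
      unfolding eventually_sequentially
    proof (elim exE, intro exI allI impI)
      fix N n assume N: "\<forall>n\<ge>N. 5 * (1 / d * (LINT \<xi>|lborel. k n \<xi>) + d * pi) < e" "N \<le> n"
      show "norm ((f' (s n) - 2 * f' 0 + f' (- s n)) / s n - 0) < e"
        using le_less_trans[OF main[OF d(1), of n]] N by simp
    qed
  qed
qed

section \<open>Second differences and the maximum principle\<close>

text \<open>Integration by parts against the tent, separately on its two halves. The second
  derivative may be missing at 0, since the boundary terms there cancel as long as \<open>f\<close>
  and \<open>f'\<close> are continuous; this is how the matching of values and slopes at the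
  interface enters.\<close>

lemma second_difference_FTC:
  fixes f f' f'' :: "real \<Rightarrow> real"
  assumes f: "\<And>z. (f has_real_derivative f' z) (at z)"
    and f': "continuous_on UNIV f'"
    and f'': "\<And>z. z \<noteq> 0 \<Longrightarrow> (f' has_real_derivative f'' z) (at z)"
    and h: "0 < h"
  shows "((\<lambda>z. f'' z * (h - \<bar>z - x\<bar>)) has_integral (f (x + h) - 2 * f x + f (x - h))) {x - h..x + h}"
proof -
  have contf: "continuous_on A f" for A
    by (meson DERIV_continuous_on f has_field_derivative_at_within)
  have contf': "continuous_on A f'" for A
    using f' continuous_on_subset by blast
  have "((\<lambda>z. f'' z * (h - (x - z))) has_integral
      ((h - (x - x)) * f' x - f x) - ((h - (x - (x - h))) * f' (x - h) - f (x - h))) {x - h..x}"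
  proof (rule fundamental_theorem_of_calculus_interior_strong[of "{0}"])
    show "((\<lambda>z. (h - (x - z)) * f' z - f z) has_vector_derivative f'' z * (h - (x - z))) (at z)"
      if "z \<in> {x - h<..<x} - {0}" for z
      unfolding has_real_derivative_iff_has_vector_derivative[symmetric]
      using that by (auto intro!: derivative_eq_intros f f'')
    show "continuous_on {x - h..x} (\<lambda>z. (h - (x - z)) * f' z - f z)"
      by (intro continuous_intros contf contf')
  qed (use h in auto)
  then have 1: "((\<lambda>z. f'' z * (h - \<bar>z - x\<bar>)) has_integral (h * f' x - f x + f (x - h))) {x - h..x}"
    by (rule has_integral_eq_rhs[OF has_integral_eq, rotated]) auto
  have "((\<lambda>z. f'' z * (h - (z - x))) has_integral
      ((h - (x + h - x)) * f' (x + h) + f (x + h)) - ((h - (x - x)) * f' x + f x)) {x..x + h}"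
  proof (rule fundamental_theorem_of_calculus_interior_strong[of "{0}"])
    show "((\<lambda>z. (h - (z - x)) * f' z + f z) has_vector_derivative f'' z * (h - (z - x))) (at z)"
      if "z \<in> {x<..<x + h} - {0}" for z
      unfolding has_real_derivative_iff_has_vector_derivative[symmetric]
      using that by (auto intro!: derivative_eq_intros f f'')
    show "continuous_on {x..x + h} (\<lambda>z. (h - (z - x)) * f' z + f z)"
      by (intro continuous_intros contf contf')
  qed (use h in auto)
  then have 2: "((\<lambda>z. f'' z * (h - \<bar>z - x\<bar>)) has_integral (f (x + h) - h * f' x - f x)) {x..x + h}"
    by (rule has_integral_eq_rhs[OF has_integral_eq, rotated]) auto
  have "((\<lambda>z. f'' z * (h - \<bar>z - x\<bar>)) has_integral
      (h * f' x - f x + f (x - h)) + (f (x + h) - h * f' x - f x)) {x - h..x + h}"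
    by (rule has_integral_combine[OF _ _ 1 2]) (use h in auto)
  then show ?thesis by (simp add: algebra_simps)
qed

lemma tent_has_integral:
  assumes "0 < (h :: real)"
  shows "((\<lambda>z. h - \<bar>z - x\<bar>) has_integral h\<^sup>2) {x - h..x + h}"
proof -
  have "((\<lambda>z. 1 * (h - \<bar>z - x\<bar>)) has_integral ((x + h)\<^sup>2 / 2 - 2 * (x\<^sup>2 / 2) + (x - h)\<^sup>2 / 2)) {x - h..x + h}"
    by (rule second_difference_FTC[of "\<lambda>z. z\<^sup>2 / 2" "\<lambda>z. z"])
       (use assms in \<open>auto intro!: derivative_eq_intros continuous_intros\<close>)
  moreover have "(x + h)\<^sup>2 / 2 - 2 * (x\<^sup>2 / 2) + (x - h)\<^sup>2 / 2 = h\<^sup>2"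
    by (simp add: power2_eq_square field_simps)
  ultimately show ?thesis by simp
qed

text \<open>At a positive maximum of \<open>W - \<epsilon> (x\<^sup>2 + 5 t)\<close> the function \<open>w = W\<^sub>t\<close> is at least \<open>5 \<epsilon>\<close>, whereas the
  second difference of \<open>W\<close> is at most that of \<open>\<epsilon> x\<^sup>2\<close>; because \<open>a \<le> 2\<close> this is a contradiction.
  Working with second differences makes the interface harmless.\<close>

lemma second_difference_max_principle:
  fixes W w :: "real \<Rightarrow> real \<Rightarrow> real"
  assumes contW: "continuous_on ({0..T} \<times> UNIV) (\<lambda>(t, x). W t x)"
    and W0: "\<And>x. W 0 x = 0"
    and der: "\<And>t x. 0 < t \<Longrightarrow> t \<le> T \<Longrightarrow> ((\<lambda>s. W s x) has_real_derivative w t x) (at t within {0..T})"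
    and contw: "\<And>t. 0 < t \<Longrightarrow> t \<le> T \<Longrightarrow> continuous_on UNIV (w t)"
    and growth: "\<And>t x. t \<in> {0..T} \<Longrightarrow> \<bar>W t x\<bar> \<le> C * (1 + \<bar>x\<bar>)"
    and eq: "\<And>t x h. 0 < t \<Longrightarrow> t \<le> T \<Longrightarrow> 0 < h \<Longrightarrow>
      ((\<lambda>z. w t z / coeff_a z * (h - \<bar>z - x\<bar>)) has_integral (W t (x + h) - 2 * W t x + W t (x - h)))
        {x - h..x + h}"
    and t1: "t1 \<in> {0..T}"
  shows "W t1 x1 \<le> 0"
proof (rule ccontr)
  assume "\<not> W t1 x1 \<le> 0"
  then have pos: "0 < W t1 x1" by simp
  have C: "0 \<le> C" using growth[OF t1, of 0] by simp
  \<comment> \<open>With this choice the penalty at \<open>(t1, x1)\<close> stays below half of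
    \<open>W t1 x1\<close>; the added 1 keeps the denominator positive at the origin.\<close>
  define \<epsilon> where "\<epsilon> = W t1 x1 / (2 * (x1\<^sup>2 + 5 * t1 + 1))"
  have den: "0 < x1\<^sup>2 + 5 * t1 + 1" using t1 by (auto intro!: add_nonneg_pos)
  have \<epsilon>: "0 < \<epsilon>" using pos den by (simp add: \<epsilon>_def)
  define V where "V t x = W t x - \<epsilon> * (x\<^sup>2 + 5 * t)" for t x
  have V1: "0 < V t1 x1"
  proof -
    have "\<epsilon> * (x1\<^sup>2 + 5 * t1) < \<epsilon> * (2 * (x1\<^sup>2 + 5 * t1 + 1))"
      using \<epsilon> den by (intro mult_strict_left_mono) auto
    also have "\<dots> = W t1 x1" using den by (simp add: \<epsilon>_def)
    finally show ?thesis by (simp add: V_def)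
  qed
  \<comment> \<open>Beyond \<open>N\<close> the quadratic penalty beats the linear growth,
    \<open>C (1 + |x|) \<le> 2 C |x| \<le> \<epsilon> x^2\<close>, so the maximum may be sought on a
    compact rectangle.\<close>
  define N where "N = max \<bar>x1\<bar> (2 * C / \<epsilon> + 1)"
  have N: "1 \<le> N" "2 * C / \<epsilon> \<le> N" "\<bar>x1\<bar> \<le> N"
    using C \<epsilon> by (auto simp: N_def le_max_iff_disj)
  have outside: "V t x \<le> 0" if "t \<in> {0..T}" "N \<le> \<bar>x\<bar>" for t x
  proof -
    have "W t x \<le> C * (1 + \<bar>x\<bar>)" using growth[OF that(1), of x] by simp
    also have "\<dots> \<le> C * (2 * \<bar>x\<bar>)" using C N(1) that(2) by (intro mult_left_mono) auto
    also have "\<dots> = 2 * C * \<bar>x\<bar>" by simp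
    also have "\<dots> \<le> (\<epsilon> * \<bar>x\<bar>) * \<bar>x\<bar>"
    proof (rule mult_right_mono)
      have "2 * C / \<epsilon> \<le> \<bar>x\<bar>" using N(2) that(2) by simp
      then show "2 * C \<le> \<epsilon> * \<bar>x\<bar>" using \<epsilon> by (simp add: field_simps)
    qed simp
    also have "\<dots> = \<epsilon> * x\<^sup>2" by (simp add: power2_eq_square)
    also have "\<epsilon> * x\<^sup>2 \<le> \<epsilon> * (x\<^sup>2 + 5 * t)"
      using \<epsilon> that(1) by (intro mult_left_mono) auto
    finally show ?thesis by (simp add: V_def)
  qed
  have contV: "continuous_on ({0..T} \<times> {-N..N}) (\<lambda>(t, x). V t x)"
    unfolding V_def case_prod_unfold
    using continuous_on_subset[OF contW, of "{0..T} \<times> {-N..N}"]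
    by (intro continuous_intros) (auto simp: case_prod_unfold)
  have "\<exists>p\<in>{0..T} \<times> {-N..N}. \<forall>q\<in>{0..T} \<times> {-N..N}. (\<lambda>(t, x). V t x) q \<le> (\<lambda>(t, x). V t x) p"
    using t1 N by (intro continuous_attains_sup contV compact_Times) auto
  then obtain t0 x0 where m: "t0 \<in> {0..T}" "\<And>t x. t \<in> {0..T} \<Longrightarrow> x \<in> {-N..N} \<Longrightarrow> V t x \<le> V t0 x0"
    by fastforce
  have V0: "0 < V t0 x0"
    using V1 m(2)[OF t1, of x1] N(3) by (auto simp: abs_le_iff)
  have max: "V t x \<le> V t0 x0" if "t \<in> {0..T}" for t x
  proof (cases "N \<le> \<bar>x\<bar>")
    case True
    then show ?thesis using outside[OF that] V0 by fastforce
  next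
    case False
    then have "x \<in> {-N..N}" by (auto simp: abs_if split: if_splits)
    then show ?thesis by (rule m(2)[OF that])
  qed
  have "t0 \<noteq> 0"
  proof
    assume "t0 = 0"
    then have "V t0 x0 = - (\<epsilon> * x0\<^sup>2)" by (simp add: V_def W0)
    also have "\<dots> \<le> 0" using \<epsilon> by simp
    finally show False using V0 by simp
  qed
  then have t0: "0 < t0" "t0 \<le> T" using m(1) by auto
  \<comment> \<open>The maximum is compared with earlier times only, so that \<open>t0 = T\<close>
    is covered.\<close>
  have w0: "5 * \<epsilon> \<le> w t0 x0"
  proof (rule ccontr)
    assume "\<not> 5 * \<epsilon> \<le> w t0 x0"
    moreover have "((\<lambda>s. V s x0) has_real_derivative w t0 x0 - \<epsilon> * 5) (at t0 within {0..T})"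
      unfolding V_def by (auto intro!: derivative_eq_intros der t0)
    ultimately obtain d where d: "0 < d" "\<And>h. 0 < h \<Longrightarrow> t0 - h \<in> {0..T} \<Longrightarrow> h < d \<Longrightarrow> V t0 x0 < V (t0 - h) x0"
      using has_real_derivative_neg_dec_left[of "\<lambda>s. V s x0" "w t0 x0 - \<epsilon> * 5" t0 "{0..T}"] by auto
    define k where "k = min (d / 2) t0"
    have "0 < k" "k < d" "t0 - k \<in> {0..T}" using d(1) t0 by (auto simp: k_def min_def)
    then have "V t0 x0 < V (t0 - k) x0" using d(2) by blast
    then show False using max[OF \<open>t0 - k \<in> {0..T}\<close>, of x0] by simp
  qed
  have "isCont (w t0) x0"
    using contw[OF t0] by (simp add: continuous_on_eq_continuous_at)
  then obtain d where d: "0 < d" "\<And>z. dist z x0 < d \<Longrightarrow> dist (w t0 z) (w t0 x0) < \<epsilon> / 2"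
    unfolding continuous_at_eps_delta using \<epsilon> by (metis half_gt_zero)
  define h where "h = d / 2"
  have h: "0 < h" using d by (simp add: h_def)
  \<comment> \<open>Near \<open>x0\<close> continuity gives
    \<open>w \<ge> 5 \<epsilon> - \<epsilon> / 2\<close>, and division by \<open>a \<le> 2\<close>
    leaves \<open>9 \<epsilon> / 4\<close>. This exceeds the coefficient \<open>2 \<epsilon>\<close>
    of the second difference of the penalty; the weight 5 of \<open>t\<close> is chosen to make this
    gap.\<close>
  have "9 / 4 * \<epsilon> * h\<^sup>2 \<le> W t0 (x0 + h) - 2 * W t0 x0 + W t0 (x0 - h)"
  proof (rule has_integral_le)
    show "((\<lambda>z. 9 / 4 * \<epsilon> * (h - \<bar>z - x0\<bar>)) has_integral 9 / 4 * \<epsilon> * h\<^sup>2) {x0 - h..x0 + h}"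
      by (intro has_integral_mult_right tent_has_integral h)
    show "((\<lambda>z. w t0 z / coeff_a z * (h - \<bar>z - x0\<bar>)) has_integral
        W t0 (x0 + h) - 2 * W t0 x0 + W t0 (x0 - h)) {x0 - h..x0 + h}"
      by (intro eq t0 h)
    fix z assume z: "z \<in> {x0 - h..x0 + h}"
    then have "dist z x0 < d" using d(1) by (auto simp: h_def dist_real_def)
    then have "9 / 2 * \<epsilon> \<le> w t0 z" using d(2)[of z] w0 by (simp add: dist_real_def abs_if split: if_splits)
    moreover from this have "w t0 z / 2 \<le> w t0 z / coeff_a z"
      using \<epsilon> by (auto simp: coeff_a_def)
    ultimately have "9 / 4 * \<epsilon> \<le> w t0 z / coeff_a z" by linarith
    then show "9 / 4 * \<epsilon> * (h - \<bar>z - x0\<bar>) \<le> w t0 z / coeff_a z * (h - \<bar>z - x0\<bar>)"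
      by (rule mult_right_mono) (use z in auto)
  qed
  also have "\<dots> = V t0 (x0 + h) - 2 * V t0 x0 + V t0 (x0 - h) + 2 * \<epsilon> * h\<^sup>2"
    by (simp add: V_def power2_eq_square algebra_simps)
  also have "\<dots> \<le> 2 * \<epsilon> * h\<^sup>2"
    using max[OF m(1), of "x0 + h"] max[OF m(1), of "x0 - h"] by simp
  finally show False using \<epsilon> h by simp
qed

text \<open>Continuity is required for positive times only, together with bounds up to
  \<open>t = 0\<close> that are locally uniform in \<open>x\<close>: the explicit solution is shown
  below to attain its initial values only pointwise and off the interface. A Lebesgue integral over
  \<open>(0, t]\<close> tolerates this.\<close>

lemma time_integral_properties:
  fixes v :: "real \<Rightarrow> real \<Rightarrow> real"
  assumes cont: "continuous_on ({0<..T} \<times> UNIV) (\<lambda>(t, x). v t x)"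
    and bound: "\<And>M. \<exists>C. \<forall>t\<in>{0<..T}. \<forall>x. \<bar>x\<bar> \<le> M \<longrightarrow> \<bar>v t x\<bar> \<le> C"
  defines "W \<equiv> \<lambda>t x. LINT s:{0<..t}|lborel. v s x"
  shows time_integrable: "\<And>a b x. 0 \<le> a \<Longrightarrow> b \<le> T \<Longrightarrow> set_integrable lborel {a<..b} (\<lambda>s. v s x)"
    and time_integral_continuous: "continuous_on ({0..T} \<times> UNIV) (\<lambda>(t, x). W t x)"
    and time_integral_DERIV: "\<And>t x. 0 < t \<Longrightarrow> t \<le> T \<Longrightarrow>
      ((\<lambda>s. W s x) has_real_derivative v t x) (at t within {0..T})"
proof -
  have contx: "continuous_on {0<..T} (\<lambda>s. v s x)" for x
  proof -
    have "continuous_on {0<..T} (\<lambda>s. (\<lambda>(t, x). v t x) (s, x))"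
      by (rule continuous_on_compose2[OF cont]) (auto intro!: continuous_intros)
    then show ?thesis by simp
  qed
  show int: "set_integrable lborel {a<..b} (\<lambda>s. v s x)" if ab: "0 \<le> a" "b \<le> T" for a b x
  proof -
    obtain C where C: "\<And>t. t \<in> {0<..T} \<Longrightarrow> \<bar>v t x\<bar> \<le> C" using bound[of "\<bar>x\<bar>"] by (metis order_refl)
    have "(\<lambda>s. indicat_real {a<..b} s *\<^sub>R v s x) \<in> borel_measurable borel"
      by (rule borel_measurable_continuous_on_indicator)
         (use ab in \<open>auto intro: continuous_on_subset[OF contx]\<close>)
    then have m: "(\<lambda>s. indicat_real {a<..b} s *\<^sub>R v s x) \<in> borel_measurable lborel"
      by simp
    show ?thesis unfolding set_integrable_def
    proof (rule Bochner_Integration.integrable_bound[OF _ m])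
      show "integrable lborel (\<lambda>s. C * indicat_real {a<..b} s)"
        by (intro integrable_mult_right integrable_real_indicator emeasure_bounded_finite
              bounded_subset[OF bounded_cbox[of a b]]) auto
      show "AE s in lborel. norm (indicat_real {a<..b} s *\<^sub>R v s x) \<le> norm (C * indicat_real {a<..b} s)"
        using C ab by (intro AE_I2) (auto simp: indicator_def intro: order_trans[OF _ abs_ge_self])
    qed
  qed
  show "continuous_on ({0..T} \<times> UNIV) (\<lambda>(t, x). W t x)"
    unfolding continuous_on_sequentially
  proof (intro ballI allI impI, elim conjE)
    fix q p assume p: "p \<in> {0..T} \<times> UNIV" and q: "\<forall>n. q n \<in> {0..T} \<times> (UNIV :: real set)" "q \<longlonglongrightarrow> p"
    define t x where "t = fst p" and "x = snd p"
    define tn where "tn = (\<lambda>n. fst (q n))"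
    define xn where "xn = (\<lambda>n. snd (q n))"
    have tn: "tn \<longlonglongrightarrow> t" "\<And>n. tn n \<in> {0..T}" and xn: "xn \<longlonglongrightarrow> x" and t: "t \<in> {0..T}"
      using p q tendsto_fst[OF q(2)] tendsto_snd[OF q(2)]
      by (auto simp: t_def x_def tn_def xn_def mem_Times_iff)
    obtain M where M: "\<And>n. \<bar>xn n\<bar> \<le> M"
      using convergent_imp_bounded[OF xn] by (auto simp: bounded_iff)
    obtain C0 where C0: "\<And>s y. s \<in> {0<..T} \<Longrightarrow> \<bar>y\<bar> \<le> M \<Longrightarrow> \<bar>v s y\<bar> \<le> C0"
      using bound[of M] by metis
    define C where "C = max 0 C0"
    have C: "\<And>s y. s \<in> {0<..T} \<Longrightarrow> \<bar>y\<bar> \<le> M \<Longrightarrow> \<bar>v s y\<bar> \<le> C" and "0 \<le> C"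
      using C0 by (auto simp: C_def le_max_iff_disj)
    have "(\<lambda>n. W (tn n) (xn n)) \<longlonglongrightarrow> W t x"
      unfolding W_def set_lebesgue_integral_def
    proof (rule integral_dominated_convergence[where w = "\<lambda>s. C * indicat_real {0<..T} s"])
      show "integrable lborel (\<lambda>s. C * indicat_real {0<..T} s)"
        by (intro integrable_mult_right integrable_real_indicator emeasure_bounded_finite
              bounded_subset[OF bounded_cbox[of 0 T]]) auto
      show "(\<lambda>s. indicat_real {0<..t} s *\<^sub>R v s x) \<in> borel_measurable lborel"
        using int[of 0 t x] t by (auto simp: set_integrable_def)
      show "(\<lambda>s. indicat_real {0<..tn n} s *\<^sub>R v s (xn n)) \<in> borel_measurable lborel" for n
        using int[of 0 "tn n" "xn n"] tn(2)[of n] by (auto simp: set_integrable_def)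
      show "AE s in lborel. norm (indicat_real {0<..tn n} s *\<^sub>R v s (xn n)) \<le> C * indicat_real {0<..T} s" for n
        using C[OF _ M] tn(2)[of n] \<open>0 \<le> C\<close> by (intro AE_I2) (auto simp: indicator_def)
      show "AE s in lborel. (\<lambda>n. indicat_real {0<..tn n} s *\<^sub>R v s (xn n)) \<longlonglongrightarrow> indicat_real {0<..t} s *\<^sub>R v s x"
        using AE_lborel_singleton[of t]
      proof eventually_elim
        fix s assume "s \<noteq> t"
        consider "s \<le> 0" | "0 < s" "s < t" | "t < s" using \<open>s \<noteq> t\<close> by linarith
        then show "(\<lambda>n. indicat_real {0<..tn n} s *\<^sub>R v s (xn n)) \<longlonglongrightarrow> indicat_real {0<..t} s *\<^sub>R v s x"
        proof cases
          case 2
          have "continuous_on UNIV (\<lambda>y. v s y)"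
          proof -
            have "continuous_on UNIV (\<lambda>y. (\<lambda>(t, x). v t x) (s, y))"
              by (rule continuous_on_compose2[OF cont]) (use 2 t in \<open>auto intro!: continuous_intros\<close>)
            then show ?thesis by simp
          qed
          then have "isCont (v s) x" by (simp add: continuous_on_eq_continuous_at)
          then have "(\<lambda>n. v s (xn n)) \<longlonglongrightarrow> v s x" by (rule isCont_tendsto_compose[OF _ xn])
          moreover have "eventually (\<lambda>n. s < tn n) sequentially"
            by (rule order_tendstoD(1)[OF tn(1) 2(2)])
          then have "eventually (\<lambda>n. v s (xn n) = indicat_real {0<..tn n} s *\<^sub>R v s (xn n)) sequentially"
            by eventually_elim (use 2 in simp)
          ultimately have "(\<lambda>n. indicat_real {0<..tn n} s *\<^sub>R v s (xn n)) \<longlonglongrightarrow> v s x"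
            by (rule Lim_transform_eventually)
          then show ?thesis using 2 by simp
        next
          case 3
          have "eventually (\<lambda>n. tn n < s) sequentially"
            by (rule order_tendstoD(2)[OF tn(1) 3])
          then have "eventually (\<lambda>n. indicat_real {0<..tn n} s *\<^sub>R v s (xn n) =
              indicat_real {0<..t} s *\<^sub>R v s x) sequentially"
            by eventually_elim (use 3 in simp)
          then show ?thesis by (rule tendsto_eventually)
        qed (simp add: indicator_def)
      qed
    qed
    then show "((\<lambda>(t, x). W t x) \<circ> q) \<longlonglongrightarrow> (\<lambda>(t, x). W t x) p"
      by (simp add: tn_def xn_def t_def x_def case_prod_unfold comp_def)
  qed
  show "((\<lambda>s. W s x) has_real_derivative v t x) (at t within {0..T})" if t: "0 < t" "t \<le> T" for t x
  proof -
    \<comment> \<open>A base point strictly inside \<open>(0, t)\<close>: on \<open>[d, T]\<close>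
      the integrand is continuous and the fundamental theorem applies; the integral up to
      \<open>d\<close> is a constant.\<close>
    define d where "d = t / 2"
    have d: "0 < d" "d < t" using t by (auto simp: d_def)
    have Weq: "W s x = W d x + integral {d..s} (\<lambda>s. v s x)" if "d \<le> s" "s \<le> T" for s
    proof -
      have "W s x = (LINT s:{0<..d} \<union> {d<..s}|lborel. v s x)"
        unfolding W_def using d that by (simp add: ivl_disj_un_two(6))
      also have "\<dots> = W d x + (LINT s:{d<..s}|lborel. v s x)"
        unfolding W_def by (rule set_integral_Un) (use d that int t in auto)
      also have "(LINT s:{d<..s}|lborel. v s x) = (LINT s:{d..s}|lborel. v s x)"
        unfolding set_lebesgue_integral_def
      proof (rule integral_cong_AE)
        show "(\<lambda>r. indicat_real {d<..s} r *\<^sub>R v r x) \<in> borel_measurable lborel"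
          using int[of d s x] that d by (auto simp: set_integrable_def)
        have "(\<lambda>r. indicat_real {d..s} r *\<^sub>R v r x) \<in> borel_measurable borel"
          by (rule borel_measurable_continuous_on_indicator)
             (use d that in \<open>auto intro: continuous_on_subset[OF contx]\<close>)
        then show "(\<lambda>r. indicat_real {d..s} r *\<^sub>R v r x) \<in> borel_measurable lborel" by simp
        show "AE r in lborel. indicat_real {d<..s} r *\<^sub>R v r x = indicat_real {d..s} r *\<^sub>R v r x"
          using AE_lborel_singleton[of d] by eventually_elim (auto simp: indicator_def)
      qed
      also have "\<dots> = integral {d..s} (\<lambda>s. v s x)"
        by (intro set_borel_integral_eq_integral(2) borel_integrable_atLeastAtMost' continuous_on_subset[OF contx])
           (use d that in auto)
      finally show ?thesis .
    qed
    have "((\<lambda>s. integral {d..s} (\<lambda>s. v s x)) has_real_derivative v t x) (at t within {d..T})"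
      by (rule integral_has_real_derivative) (use d t in \<open>auto intro!: continuous_on_subset[OF contx]\<close>)
    then have "((\<lambda>s. W d x + integral {d..s} (\<lambda>s. v s x)) has_real_derivative v t x) (at t within {d..T})"
      by (auto intro!: derivative_eq_intros)
    then have "((\<lambda>s. W s x) has_real_derivative v t x) (at t within {d..T})"
    proof (rule has_field_derivative_transform_within[where d = 1])
      show "t \<in> {d..T}" using d t by simp
      show "W d x + integral {d..s} (\<lambda>s. v s x) = W s x" if "s \<in> {d..T}" for s
        using Weq[of s] that by simp
    qed simp
    moreover have "at t within {d..T} = at t within {0..T}"
    proof (rule at_within_nhd[of t "{d<..}"])
      show "{d..T} \<inter> {d<..} - {t} = {0..T} \<inter> {d<..} - {t}" using d by force
    qed (use d in auto)
    ultimately show ?thesis by simp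
  qed
qed

section \<open>Strong solutions\<close>

lemma integrable_mult_supported:
  fixes v G :: "'a::euclidean_space \<Rightarrow> real"
  assumes v: "set_integrable lborel K v" and G [measurable]: "G \<in> borel_measurable borel"
    and bound: "\<And>p. \<bar>G p\<bar> \<le> B" and supp: "\<And>p. p \<notin> K \<Longrightarrow> G p = 0"
  shows "integrable lborel (\<lambda>p. v p * G p)"
proof -
  have eq: "(\<lambda>p. v p * G p) = (\<lambda>p. (indicat_real K p *\<^sub>R v p) * G p)"
    using supp by (auto simp: indicator_def fun_eq_iff)
  have vi: "integrable lborel (\<lambda>p. indicat_real K p *\<^sub>R v p)"
    using v by (simp add: set_integrable_def)
  show ?thesis unfolding eq
  proof (rule Bochner_Integration.integrable_bound)
    show "integrable lborel (\<lambda>p. B * \<bar>indicat_real K p *\<^sub>R v p\<bar>)"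
      by (intro integrable_mult_right integrable_abs vi)
    show "(\<lambda>p. (indicat_real K p *\<^sub>R v p) * G p) \<in> borel_measurable lborel"
      using vi by (intro borel_measurable_times) (auto dest: borel_measurable_integrable)
    show "AE p in lborel. norm ((indicat_real K p *\<^sub>R v p) * G p) \<le> norm (B * \<bar>indicat_real K p *\<^sub>R v p\<bar>)"
    proof (rule AE_I2)
      fix p
      have "\<bar>indicat_real K p *\<^sub>R v p\<bar> * \<bar>G p\<bar> \<le> \<bar>indicat_real K p *\<^sub>R v p\<bar> * B"
        by (intro mult_left_mono bound) simp
      then show "norm ((indicat_real K p *\<^sub>R v p) * G p) \<le> norm (B * \<bar>indicat_real K p *\<^sub>R v p\<bar>)"
        unfolding real_norm_def abs_mult[of _ "G p"]
        by (intro order_trans[OF _ abs_ge_self]) (simp only: mult.commute[of B])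
    qed
  qed
qed

lemma borel_measurable_compose_fst:
  "f \<in> borel_measurable borel \<Longrightarrow> (\<lambda>p::real \<times> real. f (fst p)) \<in> borel_measurable borel"
  by (rule measurable_compose[of fst _ borel])
     (auto intro!: borel_measurable_continuous_onI continuous_intros)

lemma borel_measurable_compose_snd:
  "f \<in> borel_measurable borel \<Longrightarrow> (\<lambda>p::real \<times> real. f (snd p)) \<in> borel_measurable borel"
  by (rule measurable_compose[of snd _ borel])
     (auto intro!: borel_measurable_continuous_onI continuous_intros)

text \<open>All test functions of \<open>(t, x)\<close> used below are products of this kind, which
  separates the weak equation into a statement in time and one in space.\<close>

lemma smooth_with_partials_tensor:
  assumes "smooth \<theta>" "smooth \<eta>"
  shows "smooth_with_partials (\<lambda>i j p. (deriv ^^ i) \<theta> (fst p) * (deriv ^^ j) \<eta> (snd p))"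
  unfolding smooth_with_partials_def
proof (intro allI)
  fix i j and p :: "real \<times> real"
  have d: "((\<lambda>q. (deriv ^^ n) f (g q)) has_derivative (\<lambda>h. g h * (deriv ^^ Suc n) f (g p))) (at p)"
    if "smooth f" "(g has_derivative g) (at p)" for n f and g :: "real \<times> real \<Rightarrow> real"
    using DERIV_compose_FDERIV[OF smooth_imp_DERIV[OF smooth_funpow_deriv[OF that(1)]] that(2)] by simp
  have f: "(fst has_derivative fst) (at p)" "(snd has_derivative snd) (at p)"
    by (auto intro!: derivative_eq_intros)
  show "((\<lambda>p. (deriv ^^ i) \<theta> (fst p) * (deriv ^^ j) \<eta> (snd p)) has_derivative
      (\<lambda>h. fst h * ((deriv ^^ Suc i) \<theta> (fst p) * (deriv ^^ j) \<eta> (snd p)) +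
           snd h * ((deriv ^^ i) \<theta> (fst p) * (deriv ^^ Suc j) \<eta> (snd p)))) (at p)"
    by (rule has_derivative_eq_rhs[OF has_derivative_mult[OF d[OF assms(1) f(1)] d[OF assms(2) f(2)]]])
       (simp add: fun_eq_iff algebra_simps)
qed

lemma weak_partial_tensor:
  assumes w: "weak_partial ({0<..<T} \<times> UNIV) i j v w"
    and \<theta>: "smooth \<theta>" "\<And>t. \<theta> t \<noteq> 0 \<Longrightarrow> t \<in> {a..b}" "0 < a" "b < T"
    and \<eta>: "test_function \<eta>"
  shows "(LINT p|lborel. v p * ((deriv ^^ i) \<theta> (fst p) * (deriv ^^ j) \<eta> (snd p))) =
    (- 1) ^ (i + j) * (LINT p|lborel. w p * (\<theta> (fst p) * \<eta> (snd p)))"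
proof -
  obtain M where M: "0 < M" "\<And>x. M \<le> \<bar>x\<bar> \<Longrightarrow> \<eta> x = 0"
    using test_function_bounded_support[OF \<eta>] by blast
  let ?D = "\<lambda>i j p. (deriv ^^ i) \<theta> (fst p) * (deriv ^^ j) \<eta> (snd p)"
  let ?K = "{a..b} \<times> {-M..M}"
  have "{p. ?D 0 0 p \<noteq> 0} \<subseteq> ?K"
  proof
    fix p assume "p \<in> {p. ?D 0 0 p \<noteq> 0}"
    then have "\<theta> (fst p) \<noteq> 0" "\<eta> (snd p) \<noteq> 0" by auto
    then have "fst p \<in> {a..b}" "\<not> M \<le> \<bar>snd p\<bar>" using \<theta>(2) M(2) by auto
    then show "p \<in> ?K" by (auto simp: mem_Times_iff abs_if split: if_splits)
  qed
  then have cl: "closure {p. ?D 0 0 p \<noteq> 0} \<subseteq> ?K"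
    by (rule closure_minimal) (intro closed_Times closed_atLeastAtMost)
  have "compact ?K" by (intro compact_Times compact_Icc)
  then have "compact (closure {p. ?D 0 0 p \<noteq> 0})"
    unfolding compact_closure
    by (rule bounded_subset[OF compact_imp_bounded order_trans[OF closure_subset cl]])
  moreover have "?K \<subseteq> {0<..<T} \<times> UNIV" using \<theta>(3,4) by auto
  ultimately have "(LINT p|lborel. v p * ?D i j p) = (- 1) ^ (i + j) * (LINT p|lborel. w p * ?D 0 0 p)"
    using w cl smooth_with_partials_tensor[OF \<theta>(1) test_function_imp_smooth[OF \<eta>]]
    unfolding weak_partial_def by blast
  then show ?thesis by simp
qed

lemma smooth_bounded_on_support:
  assumes "smooth f" "\<And>x. f x \<noteq> 0 \<Longrightarrow> x \<in> {a..b}"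
  obtains B where "0 \<le> B" "\<And>x. \<bar>f x\<bar> \<le> B"
proof -
  have "compact (f ` {a..b})"
    by (intro compact_continuous_image smooth_imp_continuous_on assms) auto
  then obtain B where B: "\<And>x. x \<in> {a..b} \<Longrightarrow> \<bar>f x\<bar> \<le> B"
    by (metis (no_types, opaque_lifting) bounded_real compact_imp_bounded imageI)
  have "\<bar>f x\<bar> \<le> max 0 B" for x
    using B[of x] assms(2)[of x] by (cases "f x = 0") auto
  then show thesis by (intro that[of "max 0 B"]) auto
qed

lemma coeff_a_bounds: "1 \<le> coeff_a x" "coeff_a x \<le> 2"
  by (auto simp: coeff_a_def)

lemma borel_measurable_coeff_a [measurable]: "coeff_a \<in> borel_measurable borel"
  unfolding coeff_a_def by measurable

text \<open>The factor \<open>1 / a\<close> is not smooth; it is the bounded pointwise limit of smooth functions of \<open>x\<close>,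
  which may be absorbed in the test function of the weak time derivative.\<close>

lemma strong_solution_tensor:
  assumes u: "strong_solution T u0 u"
    and \<theta>: "smooth \<theta>" "\<And>t. \<theta> t \<noteq> 0 \<Longrightarrow> t \<in> {a..b}" "0 < a" "b < T"
    and \<eta>: "test_function \<eta>"
  shows "(LINT p|lborel. (case p of (t, x) \<Rightarrow> u t x) * (\<theta> (fst p) * (deriv ^^ 2) \<eta> (snd p))) =
    - (LINT p|lborel. (case p of (t, x) \<Rightarrow> u t x) * (deriv \<theta> (fst p) * (\<eta> (snd p) / coeff_a (snd p))))"
proof -
  let ?U = "\<lambda>p. case p of (t, x) \<Rightarrow> u t x" and ?\<Omega> = "{0<..<T} \<times> (UNIV :: real set)"
  obtain ut uxx where ut: "weak_partial ?\<Omega> 1 0 ?U ut" and uxx: "weak_partial ?\<Omega> 0 2 ?U uxx"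
    and eq: "AE p in lborel. p \<in> ?\<Omega> \<longrightarrow> ut p - coeff_a (snd p) * uxx p = 0"
    using u unfolding strong_solution_def by blast
  note \<eta>s = test_function_imp_smooth[OF \<eta>]
  obtain M where M: "0 < M" "\<And>x. M \<le> \<bar>x\<bar> \<Longrightarrow> \<eta> x = 0"
    using test_function_bounded_support[OF \<eta>] by blast
  have \<eta>supp: "x \<in> {-M..M}" if "\<eta> x \<noteq> 0" for x
  proof -
    have "\<not> M \<le> \<bar>x\<bar>" using M(2) that by auto
    then show ?thesis by (auto simp: abs_if split: if_splits)
  qed
  have \<theta>'supp: "t \<in> {a..b}" if "deriv \<theta> t \<noteq> 0" for t
  proof -
    have "closure {t. \<theta> t \<noteq> 0} \<subseteq> {a..b}" by (rule closure_minimal) (use \<theta>(2) in auto)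
    then show ?thesis using deriv_eq_0_outside_support[of t \<theta>] that by blast
  qed
  obtain B1 where B1: "0 \<le> B1" "\<And>x. \<bar>\<theta> x\<bar> \<le> B1"
    using smooth_bounded_on_support[OF \<theta>(1,2)] by blast
  obtain B2 where B2: "0 \<le> B2" "\<And>x. \<bar>\<eta> x\<bar> \<le> B2"
    using smooth_bounded_on_support[OF \<eta>s \<eta>supp] by blast
  obtain B3 where B3: "0 \<le> B3" "\<And>x. \<bar>deriv \<theta> x\<bar> \<le> B3"
    using smooth_bounded_on_support[OF smooth_deriv[OF \<theta>(1)] \<theta>'supp] by blast
  let ?K = "{a..b} \<times> {-M..M}"
  have K: "compact ?K" "?K \<subseteq> ?\<Omega>"
    using \<theta>(3,4) by (auto intro!: compact_Times)
  have int: "set_integrable lborel ?K ?U" "set_integrable lborel ?K ut" "set_integrable lborel ?K uxx"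
    using ut uxx K unfolding weak_partial_def locally_integrable_on_def by blast+
  have [measurable]: "\<theta> \<in> borel_measurable borel" "deriv \<theta> \<in> borel_measurable borel" "\<eta> \<in> borel_measurable borel"
    by (intro smooth_imp_borel_measurable \<theta> smooth_deriv \<eta>s)+
  \<comment> \<open>The limit is 1 for \<open>x < 0\<close> and 1/2 for \<open>x \<ge> 0\<close>,
    hence \<open>1 / coeff_a x\<close> at every point; at \<open>x = 0\<close> this holds because
    \<open>smooth_step\<close> vanishes at 0.\<close>
  define w where "w n x = 1 / 2 + (1 / 2) * smooth_step (- real n * (x - 0))" for n x
  have w_smooth: "smooth (w n)" for n
    unfolding w_def[abs_def]
    by (intro smooth_add smooth_mult smooth_const smooth_rescale smooth_smooth_step)
  have w_bound: "\<bar>w n x\<bar> \<le> 1" for n x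
    using smooth_step_bounds[of "- real n * (x - 0)"] by (simp add: w_def)
  have w_lim: "(\<lambda>n. w n x) \<longlonglongrightarrow> 1 / coeff_a x" for x
  proof -
    have "(\<lambda>n. 1 / 2 + (1 / 2) * smooth_step (real n * (- x))) \<longlonglongrightarrow> 1 / 2 + (1 / 2) * indicat_real {0<..} (- x)"
      by (intro tendsto_intros smooth_step_tendsto filterlim_real_sequentially)
    moreover have "1 / 2 + (1 / 2) * indicat_real {0<..} (- x) = 1 / coeff_a x"
      by (simp add: coeff_a_def indicator_def)
    ultimately show ?thesis by (simp add: w_def)
  qed
  have [measurable]: "w n \<in> borel_measurable borel" for n
    by (intro smooth_imp_borel_measurable w_smooth)
  have \<eta>w: "test_function (\<lambda>x. \<eta> x * w n x)" for n
    by (rule test_functionI[OF smooth_mult[OF \<eta>s w_smooth]]) (use \<eta>supp in auto)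
  \<comment> \<open>Stated for general \<open>v\<close> and \<open>\<rho>\<close> because it serves
    twice: for the weak time derivative with \<open>\<theta>\<close>, and for the solution itself
    with the derivative of \<open>\<theta>\<close>.\<close>
  have lim: "(\<lambda>n. LINT p|lborel. v p * (\<rho> (fst p) * (\<eta> (snd p) * w n (snd p)))) \<longlonglongrightarrow>
      (LINT p|lborel. v p * (\<rho> (fst p) * (\<eta> (snd p) / coeff_a (snd p))))"
    and integrable_lim: "integrable lborel (\<lambda>p. v p * (\<rho> (fst p) * (\<eta> (snd p) / coeff_a (snd p))))"
    if v: "set_integrable lborel ?K v" and \<rho>: "\<And>x. \<bar>\<rho> x\<bar> \<le> B" "0 \<le> B" "\<And>t. \<rho> t \<noteq> 0 \<Longrightarrow> t \<in> {a..b}"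
      and [measurable]: "\<rho> \<in> borel_measurable borel" for v \<rho> B
  proof -
    have b0: "\<bar>\<rho> (fst p) * \<eta> (snd p)\<bar> \<le> B * B2" for p
      unfolding abs_mult by (intro mult_mono \<rho> B2) auto
    have s0: "\<rho> (fst p) * \<eta> (snd p) = 0" if "p \<notin> ?K" for p
      using that \<rho>(3)[of "fst p"] \<eta>supp[of "snd p"] by (auto simp: mem_Times_iff)
    have base: "integrable lborel (\<lambda>p. v p * (\<rho> (fst p) * \<eta> (snd p)))"
      by (rule integrable_mult_supported[OF v _ b0 s0])
         (auto intro!: borel_measurable_times borel_measurable_compose_fst borel_measurable_compose_snd)
    have le: "\<bar>v p * (\<rho> (fst p) * (\<eta> (snd p) * c))\<bar> \<le> \<bar>v p * (\<rho> (fst p) * \<eta> (snd p))\<bar>"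
      if "\<bar>c\<bar> \<le> 1" for p c
    proof -
      have "\<bar>v p * (\<rho> (fst p) * \<eta> (snd p))\<bar> * \<bar>c\<bar> \<le> \<bar>v p * (\<rho> (fst p) * \<eta> (snd p))\<bar>"
        using that by (intro mult_left_le) auto
      then show ?thesis by (simp add: abs_mult mult_ac)
    qed
    have meas: "(\<lambda>p. v p * (\<rho> (fst p) * (\<eta> (snd p) * c p))) \<in> borel_measurable lborel"
      if [measurable]: "c \<in> borel_measurable borel" for c
    proof -
      have "(\<lambda>p. (v p * (\<rho> (fst p) * \<eta> (snd p))) * c p) \<in> borel_measurable lborel"
        using borel_measurable_integrable[OF base] by measurable
      then show ?thesis by (simp add: mult_ac)
    qed
    have a1: "\<bar>1 / coeff_a x\<bar> \<le> 1" for x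
      using coeff_a_bounds[of x] by simp
    have snd_m: "(\<lambda>p::real \<times> real. w n (snd p)) \<in> borel_measurable borel" for n
      by (intro borel_measurable_compose_snd) auto
    have snd_a: "(\<lambda>p::real \<times> real. 1 / coeff_a (snd p)) \<in> borel_measurable borel"
      by (intro borel_measurable_compose_snd[of "\<lambda>x. 1 / coeff_a x"]) auto
    have eqa: "v p * (\<rho> (fst p) * (\<eta> (snd p) / coeff_a (snd p))) =
        v p * (\<rho> (fst p) * (\<eta> (snd p) * (1 / coeff_a (snd p))))" for p by simp
    show "integrable lborel (\<lambda>p. v p * (\<rho> (fst p) * (\<eta> (snd p) / coeff_a (snd p))))"
      unfolding eqa
      by (rule Bochner_Integration.integrable_bound[OF base meas[OF snd_a]])
         (intro AE_I2, simp only: real_norm_def le[OF a1])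
    show "(\<lambda>n. LINT p|lborel. v p * (\<rho> (fst p) * (\<eta> (snd p) * w n (snd p)))) \<longlonglongrightarrow>
        (LINT p|lborel. v p * (\<rho> (fst p) * (\<eta> (snd p) / coeff_a (snd p))))"
      unfolding eqa
    proof (rule integral_dominated_convergence[where w = "\<lambda>p. \<bar>v p * (\<rho> (fst p) * \<eta> (snd p))\<bar>"])
      show "AE p in lborel. (\<lambda>n. v p * (\<rho> (fst p) * (\<eta> (snd p) * w n (snd p)))) \<longlonglongrightarrow>
          v p * (\<rho> (fst p) * (\<eta> (snd p) * (1 / coeff_a (snd p))))"
        by (intro AE_I2 tendsto_intros w_lim)
      show "AE p in lborel. norm (v p * (\<rho> (fst p) * (\<eta> (snd p) * w n (snd p)))) \<le>
          \<bar>v p * (\<rho> (fst p) * \<eta> (snd p))\<bar>" for n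
        by (intro AE_I2) (simp only: real_norm_def le[OF w_bound])
    qed (intro meas snd_m snd_a integrable_abs base)+
  qed
  have "(LINT p|lborel. ?U p * (\<theta> (fst p) * (deriv ^^ 2) \<eta> (snd p))) = (LINT p|lborel. uxx p * (\<theta> (fst p) * \<eta> (snd p)))"
    using weak_partial_tensor[OF uxx \<theta> \<eta>] by simp
  also have "\<dots> = (LINT p|lborel. ut p * (\<theta> (fst p) * (\<eta> (snd p) / coeff_a (snd p))))"
  proof (rule integral_cong_AE)
    have b0: "\<bar>\<theta> (fst p) * \<eta> (snd p)\<bar> \<le> B1 * B2" for p
      unfolding abs_mult by (intro mult_mono B1 B2) auto
    have s0: "\<theta> (fst p) * \<eta> (snd p) = 0" if "p \<notin> ?K" for p
      using that \<theta>(2)[of "fst p"] \<eta>supp[of "snd p"] by (auto simp: mem_Times_iff)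
    have "integrable lborel (\<lambda>p. uxx p * (\<theta> (fst p) * \<eta> (snd p)))"
      by (rule integrable_mult_supported[OF int(3) _ b0 s0])
         (auto intro!: borel_measurable_times borel_measurable_compose_fst borel_measurable_compose_snd)
    then show "(\<lambda>p. uxx p * (\<theta> (fst p) * \<eta> (snd p))) \<in> borel_measurable lborel"
      by (rule borel_measurable_integrable)
    show "(\<lambda>p. ut p * (\<theta> (fst p) * (\<eta> (snd p) / coeff_a (snd p)))) \<in> borel_measurable lborel"
      by (rule borel_measurable_integrable, rule integrable_lim[OF int(2) B1(2,1) \<theta>(2)]) auto
    show "AE p in lborel. uxx p * (\<theta> (fst p) * \<eta> (snd p)) = ut p * (\<theta> (fst p) * (\<eta> (snd p) / coeff_a (snd p)))"
      using eq
    proof eventually_elim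
      fix p assume p: "p \<in> ?\<Omega> \<longrightarrow> ut p - coeff_a (snd p) * uxx p = 0"
      show "uxx p * (\<theta> (fst p) * \<eta> (snd p)) = ut p * (\<theta> (fst p) * (\<eta> (snd p) / coeff_a (snd p)))"
      proof (cases "p \<in> ?\<Omega>")
        case True
        then have "ut p = coeff_a (snd p) * uxx p" using p by simp
        then show ?thesis using coeff_a_bounds(1)[of "snd p"] by simp
      next
        case False
        then have "\<theta> (fst p) = 0" using \<theta>(2)[of "fst p"] \<theta>(3,4) by (force simp: mem_Times_iff)
        then show ?thesis by simp
      qed
    qed
  qed
  also have "\<dots> = - (LINT p|lborel. ?U p * (deriv \<theta> (fst p) * (\<eta> (snd p) / coeff_a (snd p))))"
  proof (rule LIMSEQ_unique)
    show "(\<lambda>n. LINT p|lborel. ut p * (\<theta> (fst p) * (\<eta> (snd p) * w n (snd p)))) \<longlonglongrightarrow>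
        (LINT p|lborel. ut p * (\<theta> (fst p) * (\<eta> (snd p) / coeff_a (snd p))))"
      by (rule lim[OF int(2) B1(2,1) \<theta>(2)]) auto
    have "(LINT p|lborel. ut p * (\<theta> (fst p) * (\<eta> (snd p) * w n (snd p)))) =
        - (LINT p|lborel. ?U p * (deriv \<theta> (fst p) * (\<eta> (snd p) * w n (snd p))))" for n
      using weak_partial_tensor[OF ut \<theta> \<eta>w[of n]] by simp
    moreover have "(\<lambda>n. LINT p|lborel. ?U p * (deriv \<theta> (fst p) * (\<eta> (snd p) * w n (snd p)))) \<longlonglongrightarrow>
        (LINT p|lborel. ?U p * (deriv \<theta> (fst p) * (\<eta> (snd p) / coeff_a (snd p))))"
      by (rule lim[OF int(1) B3(2,1) \<theta>'supp]) auto
    ultimately show "(\<lambda>n. LINT p|lborel. ut p * (\<theta> (fst p) * (\<eta> (snd p) * w n (snd p)))) \<longlonglongrightarrow>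
        - (LINT p|lborel. ?U p * (deriv \<theta> (fst p) * (\<eta> (snd p) / coeff_a (snd p))))"
      by (simp add: tendsto_minus)
  qed
  finally show ?thesis .
qed

section \<open>The time-integrated equation of a strong solution\<close>

lemma LINT_tensor:
  fixes V :: "real \<times> real \<Rightarrow> real"
  assumes V: "continuous_on UNIV V" and [measurable]: "\<rho> \<in> borel_measurable borel" "k \<in> borel_measurable borel"
    and \<rho>: "\<And>t. \<bar>\<rho> t\<bar> \<le> A" "\<And>t. \<rho> t \<noteq> 0 \<Longrightarrow> t \<in> {a..b}"
    and k: "\<And>x. \<bar>k x\<bar> \<le> B" "\<And>x. k x \<noteq> 0 \<Longrightarrow> x \<in> {-M..M}"
  shows "(LINT p|lborel. V p * (\<rho> (fst p) * k (snd p))) = (LINT t|lborel. (LINT x|lborel. V (t, x) * k x) * \<rho> t)"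
proof -
  let ?K = "{a..b} \<times> {-M..M}"
  have "compact ?K" by (intro compact_Times compact_Icc)
  then have "set_integrable lborel ?K V"
    unfolding set_integrable_def by (intro borel_integrable_compact continuous_on_subset[OF V]) auto
  then have "integrable lborel (\<lambda>p. V p * (\<rho> (fst p) * k (snd p)))"
  proof (rule integrable_mult_supported)
    show "(\<lambda>p. \<rho> (fst p) * k (snd p)) \<in> borel_measurable borel"
      by (intro borel_measurable_times borel_measurable_compose_fst borel_measurable_compose_snd) auto
    show "\<bar>\<rho> (fst p) * k (snd p)\<bar> \<le> A * B" for p
      unfolding abs_mult by (intro mult_mono \<rho> k) (auto intro: order_trans[OF abs_ge_zero \<rho>(1)])
    show "\<rho> (fst p) * k (snd p) = 0" if "p \<notin> ?K" for p
      using that \<rho>(2)[of "fst p"] k(2)[of "snd p"] by (auto simp: mem_Times_iff)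
  qed
  then have "(LINT p|lborel. V p * (\<rho> (fst p) * k (snd p))) =
      (LINT t|lborel. LINT x|lborel. V (t, x) * (\<rho> t * k x))"
    using lborel_pair.integral_fst'[of "\<lambda>p. V p * (\<rho> (fst p) * k (snd p))"] by (simp add: lborel_prod)
  also have "\<dots> = (LINT t|lborel. LINT x|lborel. (V (t, x) * k x) * \<rho> t)"
    by (simp add: mult_ac)
  finally show ?thesis by simp
qed

lemma continuous_on_LINT_param:
  fixes V :: "real \<times> real \<Rightarrow> real"
  assumes V: "continuous_on UNIV V" and [measurable]: "k \<in> borel_measurable borel"
    and k: "\<And>x. \<bar>k x\<bar> \<le> B" "\<And>x. k x \<noteq> 0 \<Longrightarrow> x \<in> {-M..M}"
  shows "continuous_on UNIV (\<lambda>t. LINT x|lborel. V (t, x) * k x)"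
  unfolding continuous_on_sequentially
proof (intro ballI allI impI, elim conjE)
  fix t and q :: "nat \<Rightarrow> real" assume q: "q \<longlonglongrightarrow> t"
  obtain R where R: "\<And>n. \<bar>q n\<bar> \<le> R"
    using convergent_imp_bounded[OF q] by (auto simp: bounded_iff)
  have "compact (V ` ({-R..R} \<times> {-M..M}))"
    by (intro compact_continuous_image continuous_on_subset[OF V] compact_Times) auto
  then have "bounded (V ` ({-R..R} \<times> {-M..M}))" by (rule compact_imp_bounded)
  then obtain C where C': "\<forall>y\<in>V ` ({-R..R} \<times> {-M..M}). \<bar>y\<bar> \<le> C"
    unfolding bounded_real by blast
  have C: "\<bar>V p\<bar> \<le> C" if "p \<in> {-R..R} \<times> {-M..M}" for p
    using C' imageI[OF that, of V] by blast
  have [measurable]: "V \<in> borel_measurable borel"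
    by (rule borel_measurable_continuous_onI[OF V])
  have "(\<lambda>n. LINT x|lborel. V (q n, x) * k x) \<longlonglongrightarrow> (LINT x|lborel. V (t, x) * k x)"
  proof (rule integral_dominated_convergence[where w = "\<lambda>x. C * B * indicat_real {-M..M} x"])
    show "integrable lborel (\<lambda>x. C * B * indicat_real {-M..M} x)"
      by (intro integrable_mult_right integrable_real_indicator emeasure_bounded_finite) auto
    show "AE x in lborel. (\<lambda>n. V (q n, x) * k x) \<longlonglongrightarrow> V (t, x) * k x"
    proof (intro AE_I2 tendsto_intros)
      fix x
      have "isCont V (t, x)" using V by (simp add: continuous_on_eq_continuous_at)
      then show "(\<lambda>n. V (q n, x)) \<longlonglongrightarrow> V (t, x)"
        by (rule isCont_tendsto_compose) (intro tendsto_intros q)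
    qed
    show "AE x in lborel. norm (V (q n, x) * k x) \<le> C * B * indicat_real {-M..M} x" for n
    proof (rule AE_I2)
      fix x
      show "norm (V (q n, x) * k x) \<le> C * B * indicat_real {-M..M} x"
      proof (cases "x \<in> {-M..M}")
        case True
        have "(q n, x) \<in> {-R..R} \<times> {-M..M}" using R[of n] True by (auto simp: abs_le_iff)
        then have "\<bar>V (q n, x)\<bar> * \<bar>k x\<bar> \<le> C * B"
          by (intro mult_mono C k order_trans[OF abs_ge_zero C[OF \<open>(q n, x) \<in> {-R..R} \<times> {-M..M}\<close>]]) auto
        then show ?thesis using True by (simp add: abs_mult)
      next
        case False
        then have "k x = 0" using k(2) by blast
        then show ?thesis using False by simp
      qed
    qed
  qed measurable
  then show "((\<lambda>t. LINT x|lborel. V (t, x) * k x) \<circ> q) \<longlonglongrightarrow> (LINT x|lborel. V (t, x) * k x)"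
    by (simp add: comp_def)
qed

text \<open>For fixed \<open>\<eta>\<close>, the function \<open>m s\<close>, the integral of
  \<open>u s x * \<eta> x / a x\<close>, has the weak derivative \<open>p s\<close>, the integral of
  \<open>u s x\<close> against the second derivative of \<open>\<eta>\<close>. Both are continuous
  up to the endpoints, so \<open>m t - m 0\<close> is the ordinary integral of \<open>p\<close>.
  Exchanging the order of integration turns this into a weak equation for the time integral
  \<open>F\<close>, to which the tent test functions apply.\<close>

lemma strong_solution_second_difference:
  assumes u: "strong_solution T u0 u" and T: "0 < T" and t: "t \<in> {0..T}" and h: "0 < h"
  shows "((\<lambda>z. (u t z - u0 z) / coeff_a z * (h - \<bar>z - x\<bar>)) has_integral
    ((LINT s:{0<..t}|lborel. u s (x + h)) - 2 * (LINT s:{0<..t}|lborel. u s x) +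
     (LINT s:{0<..t}|lborel. u s (x - h)))) {x - h..x + h}"
proof -
  \<comment> \<open>Freezing \<open>u\<close> in time outside \<open>[0, T]\<close> makes it
    continuous on the whole plane, which spares domain conditions in the Fubini and continuity
    lemmas.\<close>
  define V where "V = (\<lambda>p::real \<times> real. u (max 0 (min T (fst p))) (snd p))"
  have contu: "continuous_on ({0..T} \<times> UNIV) (\<lambda>(t, x). u t x)" and u_0: "\<And>x. u 0 x = u0 x"
    using u by (auto simp: strong_solution_def)
  have "continuous_on UNIV (\<lambda>p::real \<times> real. (\<lambda>(t, x). u t x) (max 0 (min T (fst p)), snd p))"
    by (rule continuous_on_compose2[OF contu]) (use T in \<open>auto intro!: continuous_intros\<close>)
  then have V: "continuous_on UNIV V" by (simp add: V_def)
  have Vu: "V (s, z) = u s z" if "s \<in> {0..T}" for s z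
    using that by (simp add: V_def)
  have contVx: "continuous_on A (\<lambda>x. V (s, x))" for A s
    by (rule continuous_on_compose2[OF V]) (auto intro!: continuous_intros)
  have contVt: "continuous_on A (\<lambda>s. V (s, x))" for A x
    by (rule continuous_on_compose2[OF V]) (auto intro!: continuous_intros)
  define F where "F z = integral {0..t} (\<lambda>s. V (s, z))" for z
  have F_LINT: "F z = (LINT s:{0<..t}|lborel. u s z)" for z
  proof -
    have "F z = (LINT s:{0..t}|lborel. V (s, z))"
      unfolding F_def by (intro set_borel_integral_eq_integral(2)[symmetric] borel_integrable_atLeastAtMost' contVt)
    also have "\<dots> = (LINT s|lborel. V (s, z) * indicat_real {0..t} s)"
      by (simp add: set_lebesgue_integral_def mult.commute)
    also have "\<dots> = (LINT s:{0<..t}|lborel. V (s, z))"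
      by (intro LINT_mult_indicator_Icc borel_measurable_continuous_onI contVt)
    also have "\<dots> = (LINT s:{0<..t}|lborel. u s z)"
      by (intro set_lebesgue_integral_cong) (use t Vu in auto)
    finally show ?thesis .
  qed
  have contF: "continuous_on UNIV F"
  proof -
    have "continuous_on (UNIV \<times> cbox 0 t) (\<lambda>(z, s). V (s, z))"
      unfolding case_prod_unfold
      by (rule continuous_on_compose2[OF V]) (auto intro!: continuous_intros)
    from integral_continuous_on_param[OF this] show ?thesis
      by (simp add: F_def)
  qed
  define f where "f z = (u t z - u0 z) / coeff_a z" for z
  have f_eq: "f z = (V (t, z) - V (0, z)) * (1 / coeff_a z)" for z
    using Vu[OF t] Vu[of 0] T by (simp add: f_def u_0)
  have f_int: "set_integrable lborel {c..d} f" for c d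
    unfolding f_eq[abs_def] set_integrable_def
  proof (rule Bochner_Integration.integrable_bound)
    have "set_integrable lborel {c..d} (\<lambda>z. V (t, z) - V (0, z))"
      by (intro borel_integrable_atLeastAtMost' continuous_intros contVx)
    then show "integrable lborel (\<lambda>z. indicat_real {c..d} z *\<^sub>R (V (t, z) - V (0, z)))"
      by (simp add: set_integrable_def)
    have [measurable]: "(\<lambda>z. V (s, z)) \<in> borel_measurable borel" for s
      by (intro borel_measurable_continuous_onI contVx)
    show "(\<lambda>z. indicat_real {c..d} z *\<^sub>R ((V (t, z) - V (0, z)) * (1 / coeff_a z))) \<in> borel_measurable lborel"
      by measurable
    show "AE z in lborel. norm (indicat_real {c..d} z *\<^sub>R ((V (t, z) - V (0, z)) * (1 / coeff_a z))) \<le>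
        norm (indicat_real {c..d} z *\<^sub>R (V (t, z) - V (0, z)))"
    proof (rule AE_I2)
      fix z
      have "\<bar>V (t, z) - V (0, z)\<bar> * \<bar>1 / coeff_a z\<bar> \<le> \<bar>V (t, z) - V (0, z)\<bar>"
        using coeff_a_bounds[of z] by (intro mult_left_le) auto
      then show "norm (indicat_real {c..d} z *\<^sub>R ((V (t, z) - V (0, z)) * (1 / coeff_a z))) \<le>
        norm (indicat_real {c..d} z *\<^sub>R (V (t, z) - V (0, z)))"
        by (simp add: abs_mult indicator_def)
    qed
  qed
  have weak: "(LINT z|lborel. F z * (deriv ^^ 2) \<eta> z) = (LINT z|lborel. f z * \<eta> z)"
    if \<eta>: "test_function \<eta>" for \<eta>
  proof -
    note \<eta>s = test_function_imp_smooth[OF \<eta>]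
    obtain M0 where M0: "0 < M0" "\<And>x. M0 \<le> \<bar>x\<bar> \<Longrightarrow> \<eta> x = 0"
      using test_function_bounded_support[OF \<eta>] by blast
    have \<eta>2: "test_function ((deriv ^^ 2) \<eta>)"
      by (simp add: numeral_2_eq_2 test_function_deriv \<eta>)
    obtain M2 where M2: "0 < M2" "\<And>x. M2 \<le> \<bar>x\<bar> \<Longrightarrow> (deriv ^^ 2) \<eta> x = 0"
      using test_function_bounded_support[OF \<eta>2] by blast
    define M where "M = max M0 M2"
    have supp: "x \<in> {-M..M}" if "\<eta> x \<noteq> 0 \<or> (deriv ^^ 2) \<eta> x \<noteq> 0" for x
    proof -
      have "\<not> M \<le> \<bar>x\<bar>" using M0(2)[of x] M2(2)[of x] that by (auto simp: M_def)
      then show ?thesis by (auto simp: abs_if split: if_splits)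
    qed
    have supp1: "x \<in> {-M..M}" if "\<eta> x \<noteq> 0" for x using supp that by blast
    have supp2: "x \<in> {-M..M}" if "(deriv ^^ 2) \<eta> x \<noteq> 0" for x using supp that by blast
    obtain B where B: "\<And>x. \<bar>\<eta> x\<bar> \<le> B"
      using smooth_bounded_on_support[OF \<eta>s supp1] by blast
    obtain B2 where B2: "\<And>x. \<bar>(deriv ^^ 2) \<eta> x\<bar> \<le> B2"
      using smooth_bounded_on_support[OF smooth_funpow_deriv[OF \<eta>s] supp2] by blast
    have [measurable]: "\<eta> \<in> borel_measurable borel" "(deriv ^^ 2) \<eta> \<in> borel_measurable borel"
      by (intro smooth_imp_borel_measurable \<eta>s smooth_funpow_deriv)+
    let ?k = "\<lambda>x. \<eta> x / coeff_a x"
    have k: "\<bar>?k x\<bar> \<le> B" "?k x \<noteq> 0 \<Longrightarrow> x \<in> {-M..M}" for x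
    proof -
      have "\<bar>?k x\<bar> \<le> \<bar>\<eta> x\<bar>" using coeff_a_bounds[of x] by (simp add: abs_divide divide_le_eq mult_le_cancel_left1)
      then show "\<bar>?k x\<bar> \<le> B" using B[of x] by linarith
      show "?k x \<noteq> 0 \<Longrightarrow> x \<in> {-M..M}" using supp1[of x] by auto
    qed
    define m where "m s = (LINT x|lborel. V (s, x) * ?k x)" for s
    define p where "p s = (LINT x|lborel. V (s, x) * (deriv ^^ 2) \<eta> x)" for s
    have contm: "continuous_on A m" and contp: "continuous_on A p" for A
      unfolding m_def p_def
      by (rule continuous_on_subset[OF continuous_on_LINT_param[OF V _ k]], auto)
         (rule continuous_on_subset[OF continuous_on_LINT_param[OF V _ B2 supp2]], auto)
    have diff: "(LINT s:{y<..z}|lborel. p s) = m z - m y" if "0 < y" "y \<le> z" "z < T" for y z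
    proof (rule weak_deriv_difference[of m y "(z + T) / 2"])
      show "continuous_on UNIV m" by (rule contm)
      show "set_integrable lborel {y..(z + T) / 2} p"
        by (rule borel_integrable_atLeastAtMost'[OF contp])
      fix \<theta> assume \<theta>: "test_function \<theta>" and \<theta>supp: "\<And>z'. \<theta> z' \<noteq> 0 \<Longrightarrow> z' \<in> {y..(z + T) / 2}"
      note \<theta>s = test_function_imp_smooth[OF \<theta>]
      have b: "(z + T) / 2 < T" using that by simp
      have \<theta>'supp: "s \<in> {y..(z + T) / 2}" if "deriv \<theta> s \<noteq> 0" for s
      proof -
        have "closure {s. \<theta> s \<noteq> 0} \<subseteq> {y..(z + T) / 2}"
          by (rule closure_minimal) (use \<theta>supp in auto)
        then show ?thesis using deriv_eq_0_outside_support[of s \<theta>] that by blast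
      qed
      obtain A where A: "\<And>x. \<bar>\<theta> x\<bar> \<le> A"
        using smooth_bounded_on_support[OF \<theta>s \<theta>supp] by blast
      obtain A' where A': "\<And>x. \<bar>deriv \<theta> x\<bar> \<le> A'"
        using smooth_bounded_on_support[OF smooth_deriv[OF \<theta>s] \<theta>'supp] by blast
      have [measurable]: "\<theta> \<in> borel_measurable borel" "deriv \<theta> \<in> borel_measurable borel"
        by (intro smooth_imp_borel_measurable \<theta>s smooth_deriv)+
      have UV: "(case q of (t, x) \<Rightarrow> u t x) * (\<rho> (fst q) * c) = V q * (\<rho> (fst q) * c)"
        if "\<And>s. \<rho> s \<noteq> 0 \<Longrightarrow> s \<in> {y..(z + T) / 2}" for \<rho> :: "real \<Rightarrow> real" and c q
      proof (cases "\<rho> (fst q) = 0")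
        case False
        then have "fst q \<in> {0..T}" using that[of "fst q"] b \<open>0 < y\<close> by auto
        then show ?thesis using Vu[of "fst q" "snd q"] by (simp add: case_prod_unfold)
      qed simp
      have UV1: "(case q of (t, x) \<Rightarrow> u t x) * (deriv \<theta> (fst q) * c) = V q * (deriv \<theta> (fst q) * c)" for q c
        by (rule UV, rule \<theta>'supp)
      have UV2: "(case q of (t, x) \<Rightarrow> u t x) * (\<theta> (fst q) * c) = V q * (\<theta> (fst q) * c)" for q c
        by (rule UV, rule \<theta>supp)
      have "(LINT s|lborel. m s * deriv \<theta> s) = (LINT q|lborel. V q * (deriv \<theta> (fst q) * (\<eta> (snd q) / coeff_a (snd q))))"
        unfolding m_def by (rule LINT_tensor[OF V _ _ A' \<theta>'supp k, symmetric]) auto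
      also have "\<dots> = (LINT q|lborel. (case q of (t, x) \<Rightarrow> u t x) * (deriv \<theta> (fst q) * (\<eta> (snd q) / coeff_a (snd q))))"
        by (simp only: UV1)
      also have "\<dots> = - (LINT q|lborel. (case q of (t, x) \<Rightarrow> u t x) * (\<theta> (fst q) * (deriv ^^ 2) \<eta> (snd q)))"
        using strong_solution_tensor[OF u \<theta>s \<theta>supp \<open>0 < y\<close> b \<eta>] by simp
      also have "\<dots> = - (LINT q|lborel. V q * (\<theta> (fst q) * (deriv ^^ 2) \<eta> (snd q)))"
        by (simp only: UV2)
      also have "\<dots> = - (LINT s|lborel. p s * \<theta> s)"
        unfolding p_def by (subst LINT_tensor[OF V _ _ A \<theta>supp B2 supp2]) auto
      finally show "(LINT s|lborel. m s * deriv \<theta> s) = - (LINT s|lborel. p s * \<theta> s)" .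
    qed (use that in auto)
    \<comment> \<open>The weak derivatives live in the open strip, so the identity is first known on
      compact parts of \<open>(0, T)\<close>, where it says that \<open>G\<close> is constant.
      Continuity of \<open>G\<close> on \<open>[0, T]\<close> carries it to both endpoints.\<close>
    define G where "G s = m s - integral {0..s} p" for s
    have p_io: "p integrable_on {c..d}" for c d
      by (intro integrable_continuous_real contp)
    have contG: "continuous_on {0..T} G"
      unfolding G_def by (intro continuous_intros contm indefinite_integral_continuous_1 p_io)
    have Gle: "G z = G y" if "0 < y" "y \<le> z" "z < T" for y z
    proof -
      have "m z - m y = (LINT s|lborel. p s * indicat_real {y..z} s)"
        using diff[OF that] by (simp add: LINT_mult_indicator_Icc borel_measurable_continuous_onI contp)
      also have "\<dots> = (LINT s:{y..z}|lborel. p s)"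
        by (simp add: set_lebesgue_integral_def mult.commute)
      also have "\<dots> = integral {y..z} p"
        by (intro set_borel_integral_eq_integral(2) borel_integrable_atLeastAtMost' contp)
      also have "\<dots> = integral {0..z} p - integral {0..y} p"
        using Henstock_Kurzweil_Integration.integral_combine[of 0 y z p] that p_io by simp
      finally show ?thesis by (simp add: G_def)
    qed
    have Gmid: "G s = G (T / 2)" if "s \<in> {0<..<T}" for s
    proof (cases "s \<le> T / 2")
      case True
      show ?thesis by (rule Gle[symmetric]) (use that T True in auto)
    next
      case False
      show ?thesis by (rule Gle) (use that T False in auto)
    qed
    have cl: "closure {0<..<T} = {0..T}" using T by simp
    have Gc: "G s = G (T / 2)" if "s \<in> {0..T}" for s
    proof (rule continuous_constant_on_closure[of "{0<..<T}" G])
      show "continuous_on (closure {0<..<T}) G" using contG by (simp only: cl)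
      show "s \<in> closure {0<..<T}" using that by (simp only: cl)
    qed (rule Gmid)
    have "(LINT z|lborel. F z * (deriv ^^ 2) \<eta> z) = integral {-M..M} (\<lambda>z. F z * (deriv ^^ 2) \<eta> z)"
    proof (rule integrable_continuous_compact_support(2))
      show "continuous_on {-M..M} (\<lambda>z. F z * (deriv ^^ 2) \<eta> z)"
        by (intro continuous_on_mult continuous_on_subset[OF contF] smooth_imp_continuous_on
            smooth_funpow_deriv \<eta>s) simp
      show "F z * (deriv ^^ 2) \<eta> z \<noteq> 0 \<Longrightarrow> z \<in> {-M..M}" for z
        using supp2[of z] by simp
    qed
    also have "\<dots> = integral {-M..M} (\<lambda>z. integral {0..t} (\<lambda>s. V (s, z) * (deriv ^^ 2) \<eta> z))"
      by (simp add: F_def)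
    also have "\<dots> = integral {0..t} (\<lambda>s. integral {-M..M} (\<lambda>z. V (s, z) * (deriv ^^ 2) \<eta> z))"
    proof -
      have "continuous_on A (\<lambda>q. (deriv ^^ 2) \<eta> (fst q))" for A :: "(real \<times> real) set"
        by (rule continuous_on_compose2[OF smooth_imp_continuous_on[OF smooth_funpow_deriv[OF \<eta>s], of UNIV]])
           (auto intro!: continuous_intros)
      moreover have "continuous_on A (\<lambda>q. V (snd q, fst q))" for A
        by (rule continuous_on_compose2[OF V]) (auto intro!: continuous_intros)
      ultimately have "continuous_on A (\<lambda>(z, s). V (s, z) * (deriv ^^ 2) \<eta> z)" for A
        unfolding case_prod_unfold by (intro continuous_on_mult)
      then show ?thesis
        using integral_swap_continuous[of "-M" 0 M t "\<lambda>z s. V (s, z) * (deriv ^^ 2) \<eta> z"]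
        by (simp only: box_real)
    qed
    also have "\<dots> = integral {0..t} p"
    proof (rule integral_cong)
      fix s
      show "integral {-M..M} (\<lambda>z. V (s, z) * (deriv ^^ 2) \<eta> z) = p s"
        unfolding p_def
      proof (rule integrable_continuous_compact_support(2)[symmetric])
        show "continuous_on {-M..M} (\<lambda>z. V (s, z) * (deriv ^^ 2) \<eta> z)"
          by (intro continuous_on_mult contVx smooth_imp_continuous_on smooth_funpow_deriv \<eta>s)
        show "V (s, z) * (deriv ^^ 2) \<eta> z \<noteq> 0 \<Longrightarrow> z \<in> {-M..M}" for z
          using supp2[of z] by simp
      qed
    qed
    also have "\<dots> = m t - m 0"
      using Gc[OF t] Gc[of 0] T by (simp add: G_def)
    also have "\<dots> = (LINT x|lborel. V (t, x) * ?k x - V (0, x) * ?k x)"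
    proof -
      have "set_integrable lborel {-M..M} (\<lambda>x. V (s, x))" for s
        by (intro borel_integrable_atLeastAtMost' contVx)
      then have "integrable lborel (\<lambda>x. V (s, x) * ?k x)" for s
        by (rule integrable_mult_supported[OF _ _ k(1)]) (use k(2) in auto)
      then show ?thesis by (simp add: m_def)
    qed
    also have "\<dots> = (LINT z|lborel. f z * \<eta> z)"
      by (rule Bochner_Integration.integral_cong) (auto simp: f_eq left_diff_distrib diff_divide_distrib)
    finally show ?thesis .
  qed
  have "(LINT z:{x - h..x + h}|lborel. f z * (h - \<bar>z - x\<bar>)) = F (x + h) - 2 * F x + F (x - h)"
    by (rule weak_second_difference[OF contF f_int h weak])
  moreover have fi: "set_integrable lborel {x - h..x + h} (\<lambda>z. f z * (h - \<bar>z - x\<bar>))"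
    unfolding set_integrable_def
  proof (rule Bochner_Integration.integrable_bound)
    have fm: "integrable lborel (\<lambda>z. indicat_real {x - h..x + h} z *\<^sub>R f z)"
      using f_int[of "x - h" "x + h"] by (simp add: set_integrable_def)
    then show "integrable lborel (\<lambda>z. h * (indicat_real {x - h..x + h} z *\<^sub>R f z))" by simp
    have "(\<lambda>z. (indicat_real {x - h..x + h} z *\<^sub>R f z) * (h - \<bar>z - x\<bar>)) \<in> borel_measurable lborel"
      using borel_measurable_integrable[OF fm] by measurable
    then show "(\<lambda>z. indicat_real {x - h..x + h} z *\<^sub>R (f z * (h - \<bar>z - x\<bar>))) \<in> borel_measurable lborel"
      by (simp add: mult.assoc)
    show "AE z in lborel. norm (indicat_real {x - h..x + h} z *\<^sub>R (f z * (h - \<bar>z - x\<bar>))) \<le>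
        norm (h * (indicat_real {x - h..x + h} z *\<^sub>R f z))"
    proof (rule AE_I2)
      fix z
      show "norm (indicat_real {x - h..x + h} z *\<^sub>R (f z * (h - \<bar>z - x\<bar>))) \<le>
        norm (h * (indicat_real {x - h..x + h} z *\<^sub>R f z))"
      proof (cases "z \<in> {x - h..x + h}")
        case True
        then have "\<bar>h - \<bar>z - x\<bar>\<bar> \<le> h" by auto
        from mult_left_mono[OF this, of "\<bar>f z\<bar>"] show ?thesis
          using True h by (simp add: abs_mult mult.commute)
      qed simp
    qed
  qed
  ultimately have "integral {x - h..x + h} (\<lambda>z. f z * (h - \<bar>z - x\<bar>)) = F (x + h) - 2 * F x + F (x - h)"
    using set_borel_integral_eq_integral(2)[OF fi] by simp
  then have "((\<lambda>z. f z * (h - \<bar>z - x\<bar>)) has_integral F (x + h) - 2 * F x + F (x - h)) {x - h..x + h}"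
    using integrable_integral[OF set_borel_integral_eq_integral(1)[OF fi]] by simp
  then show ?thesis by (simp add: f_def F_LINT)
qed

section \<open>The explicit solution\<close>

definition heat :: "real \<Rightarrow> real \<Rightarrow> real" where
  "heat t x = exp (- x\<^sup>2 / (4 * t)) / sqrt (4 * pi * t)"

definition heat_x :: "real \<Rightarrow> real \<Rightarrow> real" where
  "heat_x t x = - (x / (2 * t)) * heat t x"

text \<open>By the heat equation this is the second space derivative as well as the time derivative,
  so one kernel serves for both.\<close>

definition heat_t :: "real \<Rightarrow> real \<Rightarrow> real" where
  "heat_t t x = (x\<^sup>2 / (4 * t\<^sup>2) - 1 / (2 * t)) * heat t x"

lemma DERIV_heat:
  assumes "0 < t"
  shows "(heat t has_real_derivative heat_x t x) (at x)"
    and "(heat_x t has_real_derivative heat_t t x) (at x)"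
    and "((\<lambda>t. heat t x) has_real_derivative heat_t t x) (at t)"
proof -
  have s: "0 < sqrt (4 * pi * t)" using assms by simp
  show 1: "(heat t has_real_derivative heat_x t x) (at x)" for x
    unfolding heat_def[abs_def] heat_x_def
    using assms s by (auto intro!: derivative_eq_intros simp: field_simps)
  have "((\<lambda>x. - (x / (2 * t)) * heat t x) has_real_derivative
      - (1 / (2 * t)) * heat t x + heat_x t x * - (x / (2 * t))) (at x)"
    by (rule DERIV_mult[OF _ 1]) (use assms in \<open>auto intro!: derivative_eq_intros\<close>)
  also have "- (1 / (2 * t)) * heat t x + heat_x t x * - (x / (2 * t)) = heat_t t x"
    using assms by (simp add: heat_x_def heat_t_def field_simps power2_eq_square)
  finally show "(heat_x t has_real_derivative heat_t t x) (at x)"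
    by (simp add: heat_x_def[abs_def])
  have e: "((\<lambda>t. exp (- x\<^sup>2 / (4 * t))) has_real_derivative exp (- x\<^sup>2 / (4 * t)) * (x\<^sup>2 / (4 * t\<^sup>2))) (at t)"
    using assms by (auto intro!: derivative_eq_intros simp: field_simps power2_eq_square)
  have r: "((\<lambda>t. sqrt (4 * pi * t)) has_real_derivative (4 * pi) / (2 * sqrt (4 * pi * t))) (at t)"
    using assms by (auto intro!: derivative_eq_intros simp: field_simps mult_less_0_iff)
  have "((\<lambda>t. heat t x) has_real_derivative
      (exp (- x\<^sup>2 / (4 * t)) * (x\<^sup>2 / (4 * t\<^sup>2)) * sqrt (4 * pi * t) -
       exp (- x\<^sup>2 / (4 * t)) * ((4 * pi) / (2 * sqrt (4 * pi * t)))) /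
      (sqrt (4 * pi * t) * sqrt (4 * pi * t))) (at t)"
    unfolding heat_def by (rule DERIV_divide[OF e r]) (use assms in simp)
  also have "(exp (- x\<^sup>2 / (4 * t)) * (x\<^sup>2 / (4 * t\<^sup>2)) * sqrt (4 * pi * t) -
       exp (- x\<^sup>2 / (4 * t)) * ((4 * pi) / (2 * sqrt (4 * pi * t)))) /
      (sqrt (4 * pi * t) * sqrt (4 * pi * t)) = heat_t t x"
  proof -
    have ss: "sqrt (4 * pi * t) * sqrt (4 * pi * t) = 4 * pi * t" using assms by simp
    have "(E * A * q - E * ((4 * pi) / (2 * q))) / (q * q) = (A - 1 / (2 * t)) * (E / q)"
      if "q * q = 4 * pi * t" "0 < q" for E A q :: real
    proof -
      have "E * ((4 * pi) / (2 * q)) / (q * q) = E * (4 * pi) / (2 * q * (4 * pi * t))"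
        by (simp add: that(1))
      also have "\<dots> = 1 / (2 * t) * (E / q)" using assms that(2) by (simp add: field_simps)
      finally show ?thesis using that(2) by (simp add: diff_divide_distrib left_diff_distrib)
    qed
    from this[OF ss s] show ?thesis by (simp only: heat_t_def heat_def)
  qed
  finally show "((\<lambda>t. heat t x) has_real_derivative heat_t t x) (at t)" .
qed

lemma continuous_on_heat:
  "continuous_on ({0<..} \<times> UNIV) (\<lambda>(t, x). heat t x)"
  "continuous_on ({0<..} \<times> UNIV) (\<lambda>(t, x). heat_x t x)"
  "continuous_on ({0<..} \<times> UNIV) (\<lambda>(t, x). heat_t t x)"
  unfolding heat_def heat_x_def heat_t_def case_prod_unfold
  by (auto intro!: continuous_intros)

lemma heat_eq_gauss: "0 < t \<Longrightarrow> heat t (sqrt (2 * t) * z) = gauss z / sqrt (2 * t)"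
  by (simp add: heat_def std_normal_density_def power_mult_distrib real_sqrt_mult field_simps)

text \<open>The kernel is a parameter, so that continuity and differentiation need to be treated
  only once for \<open>heat\<close>, \<open>heat_x\<close> and \<open>heat_t\<close>. The factor
  \<open>c\<close> rescales the half of the datum in which the diffusion coefficient is not
  1.\<close>

definition potential ::
  "(real \<Rightarrow> real \<Rightarrow> real) \<Rightarrow> (real \<Rightarrow> real) \<Rightarrow> real \<Rightarrow> real \<Rightarrow> real \<Rightarrow> real \<Rightarrow> real \<Rightarrow> real" where
  "potential K w c a b t \<xi> = integral {a..b} (\<lambda>y. K t (\<xi> - c * y) * w y)"

lemma continuous_on_potential_integrand:
  fixes K :: "real \<Rightarrow> real \<Rightarrow> real" and w :: "real \<Rightarrow> real"
  assumes K: "continuous_on ({0<..} \<times> UNIV) (\<lambda>(t, x). K t x)" and w: "continuous_on {a..b} w"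
  shows "continuous_on (({0<..} \<times> UNIV) \<times> {a..b}) (\<lambda>(p, y). K (fst p) (snd p - c * y) * w y)"
  unfolding case_prod_unfold
proof (intro continuous_on_mult)
  have "continuous_on (({0<..} \<times> UNIV) \<times> {a..b})
      (\<lambda>q::(real \<times> real) \<times> real. (\<lambda>(t, x). K t x) (fst (fst q), snd (fst q) - c * snd q))"
    by (rule continuous_on_compose2[OF K]) (auto intro!: continuous_intros)
  then show "continuous_on (({0<..} \<times> UNIV) \<times> {a..b})
      (\<lambda>q::(real \<times> real) \<times> real. K (fst (fst q)) (snd (fst q) - c * snd q))"
    by simp
  show "continuous_on (({0<..} \<times> UNIV) \<times> {a..b}) (\<lambda>q::(real \<times> real) \<times> real. w (snd q))"
    by (rule continuous_on_compose2[OF w]) (auto intro!: continuous_intros)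
qed

lemma continuous_on_potential:
  assumes "continuous_on ({0<..} \<times> UNIV) (\<lambda>(t, x). K t x)" "continuous_on {a..b} w"
  shows "continuous_on ({0<..} \<times> UNIV) (\<lambda>(t, x). potential K w c a b t x)"
  using integral_continuous_on_param[of "{0<..} \<times> UNIV" a b "\<lambda>p y. K (fst p) (snd p - c * y) * w y"]
    continuous_on_potential_integrand[OF assms, of c]
  by (simp add: potential_def case_prod_unfold)

lemma potential_integrable:
  fixes K :: "real \<Rightarrow> real \<Rightarrow> real" and w :: "real \<Rightarrow> real"
  assumes "continuous_on ({0<..} \<times> UNIV) (\<lambda>(t, x). K t x)" "continuous_on {a..b} w" "0 < t"
  shows "continuous_on {a..b} (\<lambda>y. K t (\<xi> - c * y) * w y)"
proof -
  have "continuous_on {a..b} (\<lambda>y. (\<lambda>(p, y). K (fst p) (snd p - c * y) * w y) ((t, \<xi>), y))"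
    by (rule continuous_on_compose2[OF continuous_on_potential_integrand[OF assms(1,2)]])
       (use assms(3) in \<open>auto intro!: continuous_intros\<close>)
  then show ?thesis by simp
qed

lemma DERIV_potential_x:
  assumes K: "continuous_on ({0<..} \<times> UNIV) (\<lambda>(t, x). K t x)"
    and K': "continuous_on ({0<..} \<times> UNIV) (\<lambda>(t, x). K' t x)"
    and d: "\<And>x. (K t has_real_derivative K' t x) (at x)"
    and w: "continuous_on {a..b} w" and t: "0 < t"
  shows "(potential K w c a b t has_real_derivative potential K' w c a b t \<xi>) (at \<xi>)"
proof -
  have "((\<lambda>\<xi>. integral (cbox a b) (\<lambda>y. K t (\<xi> - c * y) * w y)) has_field_derivative
      integral (cbox a b) (\<lambda>y. K' t (\<xi> - c * y) * w y)) (at \<xi> within UNIV)"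
  proof (rule leibniz_rule_field_derivative[where f = "\<lambda>\<xi> y. K t (\<xi> - c * y) * w y"
        and fx = "\<lambda>\<xi> y. K' t (\<xi> - c * y) * w y"])
    fix \<xi> y
    have "((\<lambda>\<xi>. K t (\<xi> - c * y)) has_real_derivative K' t (\<xi> - c * y) * 1) (at \<xi>)"
      by (rule DERIV_chain2[OF d]) (auto intro!: derivative_eq_intros)
    then show "((\<lambda>\<xi>. K t (\<xi> - c * y) * w y) has_real_derivative K' t (\<xi> - c * y) * w y) (at \<xi> within UNIV)"
      by (auto intro!: derivative_eq_intros)
  next
    show "(\<lambda>y. K t (\<xi> - c * y) * w y) integrable_on cbox a b" for \<xi>
      using potential_integrable[OF K w t] by (intro integrable_continuous) simp
  next
    have "continuous_on (UNIV \<times> {a..b}) (\<lambda>q. (\<lambda>(p, y). K' (fst p) (snd p - c * y) * w y) ((t, fst q), snd q))"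
      by (rule continuous_on_compose2[OF continuous_on_potential_integrand[OF K' w]])
         (use t in \<open>auto intro!: continuous_intros\<close>)
    then show "continuous_on (UNIV \<times> cbox a b) (\<lambda>(\<xi>, y). K' t (\<xi> - c * y) * w y)"
      by (simp add: case_prod_unfold)
  qed auto
  then show ?thesis by (simp add: potential_def[abs_def])
qed

lemma DERIV_potential_t:
  assumes K: "continuous_on ({0<..} \<times> UNIV) (\<lambda>(t, x). K t x)"
    and K': "continuous_on ({0<..} \<times> UNIV) (\<lambda>(t, x). K' t x)"
    and d: "\<And>t x. 0 < t \<Longrightarrow> ((\<lambda>t. K t x) has_real_derivative K' t x) (at t)"
    and w: "continuous_on {a..b} w" and t: "0 < t"
  shows "((\<lambda>t. potential K w c a b t \<xi>) has_real_derivative potential K' w c a b t \<xi>) (at t)"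
proof -
  have "((\<lambda>t. integral (cbox a b) (\<lambda>y. K t (\<xi> - c * y) * w y)) has_field_derivative
      integral (cbox a b) (\<lambda>y. K' t (\<xi> - c * y) * w y)) (at t within {0<..})"
  proof (rule leibniz_rule_field_derivative[where f = "\<lambda>t y. K t (\<xi> - c * y) * w y"
        and fx = "\<lambda>t y. K' t (\<xi> - c * y) * w y"])
    fix s y :: real assume "s \<in> {0<..}"
    then have "((\<lambda>t. K t (\<xi> - c * y)) has_real_derivative K' s (\<xi> - c * y)) (at s within {0<..})"
      using has_field_derivative_at_within[OF d] by simp
    then show "((\<lambda>t. K t (\<xi> - c * y) * w y) has_real_derivative K' s (\<xi> - c * y) * w y) (at s within {0<..})"
      by (auto intro!: derivative_eq_intros)
  next
    show "(\<lambda>y. K s (\<xi> - c * y) * w y) integrable_on cbox a b" if "s \<in> {0<..}" for s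
      using potential_integrable[OF K w, of s] that by (intro integrable_continuous) simp
  next
    have "continuous_on ({0<..} \<times> {a..b}) (\<lambda>q. (\<lambda>(p, y). K' (fst p) (snd p - c * y) * w y) ((fst q, \<xi>), snd q))"
      by (rule continuous_on_compose2[OF continuous_on_potential_integrand[OF K' w]])
         (auto intro!: continuous_intros)
    then show "continuous_on ({0<..} \<times> cbox a b) (\<lambda>(t, y). K' t (\<xi> - c * y) * w y)"
      by (simp add: case_prod_unfold)
  qed (use t in auto)
  moreover have "at t within {0<..} = at t" by (rule at_within_open) (use t in simp_all)
  ultimately show ?thesis by (simp add: potential_def)
qed

text \<open>The substitution \<open>y = (\<xi> - sqrt (2 * t) * z) / c\<close> moves the time
  dependence from the kernel to the density. Bounds and limits as \<open>t\<close> tends to 0 are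
  then taken against one fixed Gaussian.\<close>

lemma potential_heat_gauss:
  assumes w: "continuous_on {a..b} w" and t: "0 < t" and c: "0 < c"
  shows "potential heat w c a b t \<xi> =
    1 / c * (LINT z|lborel. gauss z * (indicat_real {a..b} ((\<xi> - sqrt (2 * t) * z) / c) * w ((\<xi> - sqrt (2 * t) * z) / c)))"
proof -
  let ?s = "sqrt (2 * t)"
  have s: "0 < ?s" using t by simp
  have "potential heat w c a b t \<xi> = (LINT y:{a..b}|lborel. heat t (\<xi> - c * y) * w y)"
    unfolding potential_def
    by (intro set_borel_integral_eq_integral(2)[symmetric] borel_integrable_atLeastAtMost'
        potential_integrable continuous_on_heat w t)
  also have "\<dots> = (LINT y|lborel. indicat_real {a..b} y * (heat t (\<xi> - c * y) * w y))"
    by (simp add: set_lebesgue_integral_def)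
  also have "\<dots> = \<bar>- ?s / c\<bar> *\<^sub>R (LINT z|lborel. indicat_real {a..b} (\<xi> / c + (- ?s / c) * z) *
      (heat t (\<xi> - c * (\<xi> / c + (- ?s / c) * z)) * w (\<xi> / c + (- ?s / c) * z)))"
    by (rule lborel_integral_real_affine) (use s c in simp)
  also have "(\<lambda>z. indicat_real {a..b} (\<xi> / c + (- ?s / c) * z) *
      (heat t (\<xi> - c * (\<xi> / c + (- ?s / c) * z)) * w (\<xi> / c + (- ?s / c) * z))) =
      (\<lambda>z. 1 / ?s * (gauss z * (indicat_real {a..b} ((\<xi> - ?s * z) / c) * w ((\<xi> - ?s * z) / c))))"
  proof
    fix z
    have 1: "\<xi> / c + (- ?s / c) * z = (\<xi> - ?s * z) / c" by (simp add: diff_divide_distrib)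
    have 2: "\<xi> - c * ((\<xi> - ?s * z) / c) = ?s * z" using c by simp
    show "indicat_real {a..b} (\<xi> / c + (- ?s / c) * z) *
      (heat t (\<xi> - c * (\<xi> / c + (- ?s / c) * z)) * w (\<xi> / c + (- ?s / c) * z)) =
      1 / ?s * (gauss z * (indicat_real {a..b} ((\<xi> - ?s * z) / c) * w ((\<xi> - ?s * z) / c)))"
      unfolding 1 2 heat_eq_gauss[OF t] by simp
  qed
  finally show ?thesis using s c by (simp only: integral_mult_right_zero) simp
qed

text \<open>The density cut off to \<open>[a, b]\<close> may jump at the endpoints, notably at the
  interface; convergence is therefore claimed only where the truncated density is
  continuous.\<close>

lemma potential_heat_bound_and_limit:
  assumes w: "continuous_on {a..b} w" and c: "0 < c" and B: "\<And>y. \<bar>w y\<bar> \<le> B"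
  shows potential_heat_bound: "0 < t \<Longrightarrow> \<bar>potential heat w c a b t \<xi>\<bar> \<le> B / c"
    and potential_heat_limit: "\<lbrakk>\<And>n. 0 < \<tau> n; \<tau> \<longlonglongrightarrow> 0; isCont (\<lambda>y. indicat_real {a..b} y * w y) (\<xi> / c)\<rbrakk> \<Longrightarrow>
      (\<lambda>n. potential heat w c a b (\<tau> n) \<xi>) \<longlonglongrightarrow> 1 / c * (indicat_real {a..b} (\<xi> / c) * w (\<xi> / c))"
proof -
  let ?k = "\<lambda>y. indicat_real {a..b} y * w y"
  have "(\<lambda>y. indicat_real {a..b} y *\<^sub>R w y) \<in> borel_measurable borel"
    by (rule borel_measurable_continuous_on_indicator[OF _ w]) simp
  then have km [measurable]: "?k \<in> borel_measurable borel" by simp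
  have meas: "(\<lambda>z. gauss z * ?k ((\<xi> - s * z) / c)) \<in> borel_measurable lborel" for s \<xi>
    using measurable_compose[OF _ km, of "\<lambda>z. (\<xi> - s * z) / c" borel] by measurable
  have kB: "\<bar>?k y\<bar> \<le> B" for y
    using B[of y] order_trans[OF abs_ge_zero B[of y]] by (simp add: indicator_def)
  have B0: "0 \<le> B" using order_trans[OF abs_ge_zero kB] .
  have le: "norm (gauss z * ?k y) \<le> B * gauss z" for z y
    unfolding real_norm_def abs_mult[of "gauss z"]
    using mult_left_mono[OF kB[of y], of "gauss z"] by (simp add: normal_density_nonneg mult.commute)
  have gB: "integrable lborel (\<lambda>z. B * gauss z)" by simp
  show "\<bar>potential heat w c a b t \<xi>\<bar> \<le> B / c" if t: "0 < t"
  proof -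
    have "\<bar>LINT z|lborel. gauss z * ?k ((\<xi> - sqrt (2 * t) * z) / c)\<bar> \<le> (LINT z|lborel. B * gauss z)"
    proof (rule order_trans[OF integral_abs_bound integral_mono])
      show "integrable lborel (\<lambda>z. \<bar>gauss z * ?k ((\<xi> - sqrt (2 * t) * z) / c)\<bar>)"
        by (rule integrable_abs[OF Bochner_Integration.integrable_bound[OF gB meas]])
           (intro AE_I2 order_trans[OF le], simp)
    qed (use le in auto)
    then have "\<bar>1 / c * (LINT z|lborel. gauss z * ?k ((\<xi> - sqrt (2 * t) * z) / c))\<bar> \<le> 1 / c * B"
      using c by (simp add: abs_mult divide_right_mono)
    then show ?thesis by (simp add: potential_heat_gauss[OF w t c])
  qed
  show "(\<lambda>n. potential heat w c a b (\<tau> n) \<xi>) \<longlonglongrightarrow> 1 / c * ?k (\<xi> / c)"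
    if \<tau>: "\<And>n. 0 < \<tau> n" "\<tau> \<longlonglongrightarrow> 0" and cont: "isCont ?k (\<xi> / c)"
  proof -
    have "(\<lambda>n. LINT z|lborel. gauss z * ?k ((\<xi> - sqrt (2 * \<tau> n) * z) / c)) \<longlonglongrightarrow>
        (LINT z|lborel. gauss z * ?k (\<xi> / c))"
    proof (rule integral_dominated_convergence[where w = "\<lambda>z. B * gauss z"])
      show "AE z in lborel. (\<lambda>n. gauss z * ?k ((\<xi> - sqrt (2 * \<tau> n) * z) / c)) \<longlonglongrightarrow> gauss z * ?k (\<xi> / c)"
      proof (intro AE_I2 tendsto_mult[OF tendsto_const])
        fix z
        have "(\<lambda>n. (\<xi> - sqrt (2 * \<tau> n) * z) / c) \<longlonglongrightarrow> (\<xi> - sqrt (2 * 0) * z) / c"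
          by (intro tendsto_intros \<tau>) (use c in simp)
        then have "(\<lambda>n. (\<xi> - sqrt (2 * \<tau> n) * z) / c) \<longlonglongrightarrow> \<xi> / c" by simp
        from isCont_tendsto_compose[OF cont this]
        show "(\<lambda>n. ?k ((\<xi> - sqrt (2 * \<tau> n) * z) / c)) \<longlonglongrightarrow> ?k (\<xi> / c)" .
      qed
      show "AE z in lborel. norm (gauss z * ?k ((\<xi> - sqrt (2 * \<tau> n) * z) / c)) \<le> B * gauss z" for n
        by (intro AE_I2 le)
    qed (use gB meas in auto)
    then have "(\<lambda>n. 1 / c * (LINT z|lborel. gauss z * ?k ((\<xi> - sqrt (2 * \<tau> n) * z) / c))) \<longlonglongrightarrow>
        1 / c * (LINT z|lborel. gauss z * ?k (\<xi> / c))"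
      by (intro tendsto_intros)
    then show ?thesis by (simp add: potential_heat_gauss[OF w \<tau>(1) c])
  qed
qed

section \<open>Gluing two solutions at the interface\<close>

lemma DERIV_glue:
  fixes f g :: "real \<Rightarrow> real"
  assumes f: "(f has_real_derivative d) (at 0)" and g: "(g has_real_derivative d) (at 0)" and eq: "f 0 = g 0"
  shows "((\<lambda>x. if x < 0 then f x else g x) has_real_derivative d) (at 0)"
proof -
  let ?h = "\<lambda>x. if x < 0 then f x else g x"
  have "((\<lambda>y. (f y - f 0) / (y - 0)) \<longlongrightarrow> d) (at_left 0)"
    using f unfolding has_field_derivative_iff by (rule filterlim_mono) (simp_all add: at_le)
  then have l: "((\<lambda>y. (?h y - ?h 0) / (y - 0)) \<longlongrightarrow> d) (at_left 0)"
    by (rule Lim_transform_eventually)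
       (auto simp: eventually_at_left_field eq intro!: exI[of _ "-1"])
  have "((\<lambda>y. (g y - g 0) / (y - 0)) \<longlongrightarrow> d) (at_right 0)"
    using g unfolding has_field_derivative_iff by (rule filterlim_mono) (simp_all add: at_le)
  then have r: "((\<lambda>y. (?h y - ?h 0) / (y - 0)) \<longlongrightarrow> d) (at_right 0)"
    by (rule Lim_transform_eventually)
       (auto simp: eventually_at_right_field eq intro!: exI[of _ "1"])
  show ?thesis
    unfolding has_field_derivative_iff by (rule filterlim_split_at[OF l r])
qed

lemma continuous_on_glue:
  fixes f g :: "real \<Rightarrow> real \<Rightarrow> real"
  assumes f: "continuous_on (S \<times> UNIV) (\<lambda>(t, x). f t x)" and g: "continuous_on (S \<times> UNIV) (\<lambda>(t, x). g t x)"
    and eq: "\<And>t. t \<in> S \<Longrightarrow> f t 0 = g t 0"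
  shows "continuous_on (S \<times> UNIV) (\<lambda>(t, x). if x < 0 then f t x else g t x)"
proof -
  have "continuous_on (S \<times> UNIV) (\<lambda>p. if snd p \<le> 0 then (\<lambda>(t, x). f t x) p else (\<lambda>(t, x). g t x) p)"
    by (rule continuous_on_cases_le)
       (auto intro!: continuous_on_subset[OF f] continuous_on_subset[OF g] continuous_intros simp: eq)
  then show ?thesis
    by (rule continuous_on_eq) (auto simp: eq)
qed

text \<open>Fixing a bound for the support turns the integrals over half-lines into integrals over
  compact intervals, where differentiation under the integral sign applies directly.\<close>

locale interface_problem =
  fixes u0 :: "real \<Rightarrow> real" and M :: real
  assumes test: "test_function u0" and M_pos: "0 < M"
    and supp: "\<And>x. M \<le> \<bar>x\<bar> \<Longrightarrow> u0 x = 0"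
begin

lemma cont_u0: "continuous_on A u0"
  by (rule smooth_imp_continuous_on[OF test_function_imp_smooth[OF test]])

lemma u0_bound: obtains B where "0 \<le> B" "\<And>x. \<bar>u0 x\<bar> \<le> B"
proof (rule smooth_bounded_on_support[OF test_function_imp_smooth[OF test]])
  show "x \<in> {-M..M}" if "u0 x \<noteq> 0" for x
    using supp[of x] that by (cases "M \<le> \<bar>x\<bar>") (auto simp: abs_if split: if_splits)
qed (rule that)

text \<open>In the variable \<open>\<xi> = x\<close> for \<open>x < 0\<close>, \<open>\<xi> = x / \<surd>2\<close> for \<open>x > 0\<close>, both formulas are combinations of
  the heat potentials of the two halves of the datum.\<close>

definition PL :: "(real \<Rightarrow> real \<Rightarrow> real) \<Rightarrow> real \<Rightarrow> real \<Rightarrow> real" where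
  "PL K t \<xi> = potential K u0 1 (- M) 0 t \<xi>"

definition PR :: "(real \<Rightarrow> real \<Rightarrow> real) \<Rightarrow> real \<Rightarrow> real \<Rightarrow> real" where
  "PR K t \<xi> = potential K u0 (1 / sqrt 2) 0 M t \<xi>"

text \<open>The constants are transmission and reflection coefficients. A profile
  \<open>p(x)\<close> from the left is accompanied by \<open>R p(-x)\<close> on the left and
  continued by \<open>S p(x / sqrt 2)\<close> on the right. Equal values, \<open>1 + R = S\<close>,
  and equal slopes, \<open>1 - R = S / sqrt 2\<close>, give \<open>R = 3 - 2 sqrt 2\<close> and
  \<open>S = 4 - 2 sqrt 2\<close>. From the right the reflection coefficient is \<open>-R\<close>,
  and the transmitted part is \<open>(1 - R) / sqrt 2 = 2 - sqrt 2\<close> times \<open>PR\<close>,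
  the factor \<open>1 / sqrt 2\<close> being the normalisation of the rescaled density.\<close>

definition left :: "(real \<Rightarrow> real \<Rightarrow> real) \<Rightarrow> real \<Rightarrow> real \<Rightarrow> real" where
  "left K t x = (2 - sqrt 2) * PR K t x + PL K t x + (3 - 2 * sqrt 2) * PL K t (- x)"

definition right :: "(real \<Rightarrow> real \<Rightarrow> real) \<Rightarrow> real \<Rightarrow> real \<Rightarrow> real" where
  "right K t x = (4 - 2 * sqrt 2) * PL K t (x / sqrt 2) +
     (1 / sqrt 2) * (PR K t (x / sqrt 2) + (2 * sqrt 2 - 3) * PR K t (- (x / sqrt 2)))"

definition left_x :: "real \<Rightarrow> real \<Rightarrow> real" where
  "left_x t x = (2 - sqrt 2) * PR heat_x t x + PL heat_x t x - (3 - 2 * sqrt 2) * PL heat_x t (- x)"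

definition right_x :: "real \<Rightarrow> real \<Rightarrow> real" where
  "right_x t x = (1 / sqrt 2) * ((4 - 2 * sqrt 2) * PL heat_x t (x / sqrt 2) +
     (1 / sqrt 2) * (PR heat_x t (x / sqrt 2) - (2 * sqrt 2 - 3) * PR heat_x t (- (x / sqrt 2))))"

definition sol :: "real \<Rightarrow> real \<Rightarrow> real" where
  "sol t x = (if x < 0 then left heat t x else right heat t x)"

definition sol_x :: "real \<Rightarrow> real \<Rightarrow> real" where
  "sol_x t x = (if x < 0 then left_x t x else right_x t x)"

definition sol_t :: "real \<Rightarrow> real \<Rightarrow> real" where
  "sol_t t x = (if x < 0 then left heat_t t x else right heat_t t x)"

lemma sqrt2: "sqrt 2 * sqrt 2 = (2 :: real)" "1 / sqrt 2 = sqrt 2 / 2"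
  by (simp_all add: field_simps)

text \<open>An arbitrary kernel is allowed because two instances matter: \<open>heat\<close> gives
  continuity of the solution, \<open>heat_t\<close> continuity of its time derivative. Since the
  second space derivative is the time derivative divided by \<open>a\<close>, the latter determines
  its jump.\<close>

lemma left_right_0: "left K t 0 = right K t 0"
proof -
  have "sqrt 2 / 2 * (a + (2 * sqrt 2 - 3) * a) = (2 - sqrt 2) * a" for a :: real
    using sqrt2(1) by (simp add: algebra_simps)
  then show ?thesis by (simp add: left_def right_def sqrt2(2) algebra_simps)
qed

lemma left_right_x_0: "left_x t 0 = right_x t 0"
proof -
  have "(2 - q) * r + l - (3 - 2 * q) * l = q / 2 * ((4 - 2 * q) * l + q / 2 * (r - (2 * q - 3) * r))"
    if "q * q = 2" for q l r :: real
  proof -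
    have "q / 2 * ((4 - 2 * q) * l + q / 2 * (r - (2 * q - 3) * r)) =
        (2 * q - q * q) * l + (q * q) * ((2 - q) / 2 * r)"
      by (simp add: field_simps)
    also have "\<dots> = (2 - q) * r + l - (3 - 2 * q) * l"
      unfolding that by (simp add: field_simps)
    finally show ?thesis ..
  qed
  from this[OF sqrt2(1)] show ?thesis
    by (simp add: left_x_def right_x_def sqrt2(2))
qed

lemma continuous_on_PL: "continuous_on ({0<..} \<times> UNIV) (\<lambda>(t, x). K t x) \<Longrightarrow>
    continuous_on ({0<..} \<times> UNIV) (\<lambda>(t, x). PL K t x)"
  and continuous_on_PR: "continuous_on ({0<..} \<times> UNIV) (\<lambda>(t, x). K t x) \<Longrightarrow>
    continuous_on ({0<..} \<times> UNIV) (\<lambda>(t, x). PR K t x)"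
  unfolding PL_def PR_def by (intro continuous_on_potential cont_u0; assumption)+

lemma continuous_on_PL_scaled:
  assumes "continuous_on ({0<..} \<times> UNIV) (\<lambda>(t, x). K t x)"
  shows "continuous_on ({0<..} \<times> UNIV) (\<lambda>p. PL K (fst p) (c * snd p))"
    and "continuous_on ({0<..} \<times> UNIV) (\<lambda>p. PR K (fst p) (c * snd p))"
proof -
  have "continuous_on ({0<..} \<times> UNIV) (\<lambda>p::real \<times> real. (\<lambda>(t, x). PL K t x) (fst p, c * snd p))"
    by (rule continuous_on_compose2[OF continuous_on_PL[OF assms]]) (auto intro!: continuous_intros)
  then show "continuous_on ({0<..} \<times> UNIV) (\<lambda>p. PL K (fst p) (c * snd p))" by simp
  have "continuous_on ({0<..} \<times> UNIV) (\<lambda>p::real \<times> real. (\<lambda>(t, x). PR K t x) (fst p, c * snd p))"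
    by (rule continuous_on_compose2[OF continuous_on_PR[OF assms]]) (auto intro!: continuous_intros)
  then show "continuous_on ({0<..} \<times> UNIV) (\<lambda>p. PR K (fst p) (c * snd p))" by simp
qed

lemma continuous_on_branches:
  assumes K: "continuous_on ({0<..} \<times> UNIV) (\<lambda>(t, x). K t x)"
  shows continuous_on_left: "continuous_on ({0<..} \<times> UNIV) (\<lambda>(t, x). left K t x)"
    and continuous_on_right: "continuous_on ({0<..} \<times> UNIV) (\<lambda>(t, x). right K t x)"
  using continuous_on_PL_scaled[OF K, of 1] continuous_on_PL_scaled[OF K, of "-1"]
    continuous_on_PL_scaled[OF K, of "1 / sqrt 2"] continuous_on_PL_scaled[OF K, of "- 1 / sqrt 2"]
  unfolding left_def right_def case_prod_unfold by (auto intro!: continuous_intros)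

lemma continuous_on_branches_x:
  "continuous_on ({0<..} \<times> UNIV) (\<lambda>(t, x). left_x t x)"
  "continuous_on ({0<..} \<times> UNIV) (\<lambda>(t, x). right_x t x)"
  using continuous_on_PL_scaled[OF continuous_on_heat(2), of 1]
    continuous_on_PL_scaled[OF continuous_on_heat(2), of "-1"]
    continuous_on_PL_scaled[OF continuous_on_heat(2), of "1 / sqrt 2"]
    continuous_on_PL_scaled[OF continuous_on_heat(2), of "- 1 / sqrt 2"]
  unfolding left_x_def right_x_def case_prod_unfold by (auto intro!: continuous_intros)

lemma continuous_on_sol:
  "continuous_on ({0<..} \<times> UNIV) (\<lambda>(t, x). sol t x)"
  "continuous_on ({0<..} \<times> UNIV) (\<lambda>(t, x). sol_x t x)"
  "continuous_on ({0<..} \<times> UNIV) (\<lambda>(t, x). sol_t t x)"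
  unfolding sol_def sol_x_def sol_t_def
  by (intro continuous_on_glue continuous_on_branches continuous_on_branches_x continuous_on_heat
      left_right_0 left_right_x_0)+

lemma DERIV_scaled:
  assumes "(f has_real_derivative d) (at (c * x))"
  shows "((\<lambda>x. f (c * x)) has_real_derivative c * d) (at x)"
proof -
  have "((\<lambda>x. c * x) has_real_derivative c) (at x)" by (auto intro!: derivative_eq_intros)
  from DERIV_chain2[where f = f and g = "\<lambda>x. c * x", OF assms this] show ?thesis
    by (simp add: mult.commute)
qed

lemma DERIV_PL_PR:
  assumes "0 < t"
  shows "(PL heat t has_real_derivative PL heat_x t x) (at x)"
    and "(PR heat t has_real_derivative PR heat_x t x) (at x)"
    and "(PL heat_x t has_real_derivative PL heat_t t x) (at x)"
    and "(PR heat_x t has_real_derivative PR heat_t t x) (at x)"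
    and "((\<lambda>t. PL heat t x) has_real_derivative PL heat_t t x) (at t)"
    and "((\<lambda>t. PR heat t x) has_real_derivative PR heat_t t x) (at t)"
  unfolding PL_def[abs_def] PR_def[abs_def]
  by (intro DERIV_potential_x DERIV_potential_t continuous_on_heat DERIV_heat cont_u0 assms; assumption)+

text \<open>On the right the chain rule produces \<open>1 / sqrt 2\<close> twice; the resulting 1/2
  is the value of \<open>1 / a\<close> there. Reflected terms change sign with each space
  derivative, which accounts for the signs in \<open>left_x\<close> and
  \<open>right_x\<close>.\<close>

lemma DERIV_branches:
  assumes t: "0 < t"
  shows "(left heat t has_real_derivative left_x t x) (at x)"
    and "(right heat t has_real_derivative right_x t x) (at x)"
    and "(left_x t has_real_derivative left heat_t t x) (at x)"
    and "(right_x t has_real_derivative right heat_t t x / 2) (at x)"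
    and "((\<lambda>t. left heat t x) has_real_derivative left heat_t t x) (at t)"
    and "((\<lambda>t. right heat t x) has_real_derivative right heat_t t x) (at t)"
proof -
  note d = DERIV_PL_PR[OF t]
  show "(left heat t has_real_derivative left_x t x) (at x)"
    unfolding left_def[abs_def] left_x_def
    using DERIV_scaled[OF d(1), of "-1" x]
    by (auto intro!: derivative_eq_intros d)
  show "(left_x t has_real_derivative left heat_t t x) (at x)"
    unfolding left_def left_x_def[abs_def]
    using DERIV_scaled[OF d(3), of "-1" x]
    by (auto intro!: derivative_eq_intros d)
  show "((\<lambda>t. left heat t x) has_real_derivative left heat_t t x) (at t)"
    unfolding left_def by (auto intro!: derivative_eq_intros d)
  show "((\<lambda>t. right heat t x) has_real_derivative right heat_t t x) (at t)"
    unfolding right_def by (intro DERIV_add DERIV_cmult d)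
  let ?c = "1 / sqrt 2"
  have r: "((\<lambda>x. f (x / sqrt 2)) has_real_derivative ?c * f' (x / sqrt 2)) (at x)"
      "((\<lambda>x. f (- (x / sqrt 2))) has_real_derivative - (?c * f' (- (x / sqrt 2)))) (at x)"
    if "\<And>x. (f has_real_derivative f' x) (at x)" for f f' :: "real \<Rightarrow> real"
    using DERIV_scaled[OF that, of ?c x] DERIV_scaled[OF that, of "- ?c" x] by simp_all
  have alg_x: "(4 - 2 * sqrt 2) * (c * l) + c * (c * r + k * - (c * r')) =
      c * ((4 - 2 * sqrt 2) * l + c * (r - k * r'))" for c k l r r' :: real
    by (simp add: algebra_simps)
  show "(right heat t has_real_derivative right_x t x) (at x)"
    unfolding right_def[abs_def] right_x_def
    by (rule DERIV_cong[OF DERIV_add[OF DERIV_cmult[OF r(1)[OF d(1)]]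
          DERIV_cmult[OF DERIV_add[OF r(1)[OF d(2)] DERIV_cmult[OF r(2)[OF d(2)]]]]]])
       (rule alg_x)
  have cc: "?c * ?c = 1 / 2" by (simp add: field_simps)
  have "c * (p * (c * a) + c * (c * b - k * - (c * b'))) = (c * c) * (p * a + c * (b + k * b'))"
    for a b b' c k p :: real
    by (simp add: algebra_simps)
  from this[of ?c] have alg: "?c * ((4 - 2 * sqrt 2) * (?c * a) + ?c * (?c * b - (2 * sqrt 2 - 3) * - (?c * b'))) =
      ((4 - 2 * sqrt 2) * a + ?c * (b + (2 * sqrt 2 - 3) * b')) / 2" for a b b'
    unfolding cc by simp
  show "(right_x t has_real_derivative right heat_t t x / 2) (at x)"
    unfolding right_def right_x_def[abs_def]
    by (rule DERIV_cong[OF DERIV_cmult[OF DERIV_add[OF DERIV_cmult[OF r(1)[OF d(3)]]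
          DERIV_cmult[OF DERIV_diff[OF r(1)[OF d(4)] DERIV_cmult[OF r(2)[OF d(4)]]]]]]])
       (rule alg)
qed

lemma DERIV_sol:
  assumes t: "0 < t"
  shows DERIV_sol_x: "(sol t has_real_derivative sol_x t x) (at x)"
    and DERIV_sol_xx: "x \<noteq> 0 \<Longrightarrow> (sol_x t has_real_derivative sol_t t x / coeff_a x) (at x)"
    and DERIV_sol_t: "((\<lambda>t. sol t x) has_real_derivative sol_t t x) (at t)"
proof -
  note d = DERIV_branches[OF t]
  have glue: "((\<lambda>x. if x < 0 then f x else g x) has_real_derivative (if x < 0 then f' else g')) (at x)"
    if "x \<noteq> 0" "(f has_real_derivative f') (at x)" "(g has_real_derivative g') (at x)"
    for f g :: "real \<Rightarrow> real" and f' g'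
  proof (cases "x < 0")
    case True
    have "((\<lambda>x. if x < 0 then f x else g x) has_real_derivative f') (at x)"
      by (rule has_field_derivative_transform_within_open[OF that(2), of "{..<0}"]) (use True in auto)
    then show ?thesis using True by simp
  next
    case False
    have "((\<lambda>x. if x < 0 then f x else g x) has_real_derivative g') (at x)"
      by (rule has_field_derivative_transform_within_open[OF that(3), of "{0<..}"]) (use False that(1) in auto)
    then show ?thesis using False by simp
  qed
  show "(sol t has_real_derivative sol_x t x) (at x)"
  proof (cases "x = 0")
    case True
    then show ?thesis
      using DERIV_glue[of "left heat t" "left_x t 0" "right heat t"] d(1)[of 0] d(2)[of 0]
      by (simp add: sol_def[abs_def] sol_x_def left_right_x_0 left_right_0)
  next
    case False
    then show ?thesis
      using glue[OF False d(1,2)] by (simp add: sol_def[abs_def] sol_x_def)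
  qed
  show "(sol_x t has_real_derivative sol_t t x / coeff_a x) (at x)" if "x \<noteq> 0"
    using glue[OF that d(3,4)] by (simp add: sol_x_def[abs_def] sol_t_def coeff_a_def split: if_splits)
  show "((\<lambda>t. sol t x) has_real_derivative sol_t t x) (at t)"
    using d(5,6) by (simp add: sol_def sol_t_def)
qed

lemma sol_bounded: obtains C where "0 \<le> C" "\<And>t x. 0 < t \<Longrightarrow> \<bar>sol t x\<bar> \<le> C"
proof -
  obtain B where B: "0 \<le> B" "\<And>x. \<bar>u0 x\<bar> \<le> B" using u0_bound by blast
  have L: "\<bar>PL heat t x\<bar> \<le> B" if "0 < t" for t x
    using potential_heat_bound[OF cont_u0 _ B(2) that, of 1] by (simp add: PL_def)
  have R: "\<bar>PR heat t x\<bar> \<le> sqrt 2 * B" if "0 < t" for t x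
    using potential_heat_bound[OF cont_u0 _ B(2) that, of "1 / sqrt 2"] by (simp add: PR_def mult.commute)
  have tri: "\<bar>a * x + b * y + c * z\<bar> \<le> \<bar>a\<bar> * X + \<bar>b\<bar> * X + \<bar>c\<bar> * X"
    if "\<bar>x\<bar> \<le> X" "\<bar>y\<bar> \<le> X" "\<bar>z\<bar> \<le> X" for a b c x y z X :: real
  proof -
    have "\<bar>a * x + b * y + c * z\<bar> \<le> \<bar>a * x\<bar> + \<bar>b * y\<bar> + \<bar>c * z\<bar>" by linarith
    also have "\<dots> \<le> \<bar>a\<bar> * X + \<bar>b\<bar> * X + \<bar>c\<bar> * X"
      unfolding abs_mult by (intro add_mono mult_left_mono that) auto
    finally show ?thesis .
  qed
  let ?X = "sqrt 2 * B"
  have "B * 1 \<le> B * sqrt 2" using B(1) by (intro mult_left_mono) auto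
  then have BX: "B \<le> ?X" by (simp add: mult.commute)
  define C1 where "C1 = \<bar>2 - sqrt 2\<bar> * ?X + \<bar>1\<bar> * ?X + \<bar>3 - 2 * sqrt 2\<bar> * ?X"
  define C2 where "C2 = \<bar>4 - 2 * sqrt 2\<bar> * ?X + \<bar>1 / sqrt 2\<bar> * ?X + \<bar>1 / sqrt 2 * (2 * sqrt 2 - 3)\<bar> * ?X"
  have X0: "0 \<le> ?X" using B(1) by simp
  have "\<bar>left heat t x\<bar> \<le> C1" if "0 < t" for t x
    using tri[OF R[OF that] order_trans[OF L[OF that] BX] order_trans[OF L[OF that] BX], of "2 - sqrt 2" x 1 x "3 - 2 * sqrt 2" "- x"]
    by (simp add: left_def C1_def)
  moreover have "\<bar>right heat t x\<bar> \<le> C2" if "0 < t" for t x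
    using tri[OF order_trans[OF L[OF that] BX] R[OF that] R[OF that], of "4 - 2 * sqrt 2" "x / sqrt 2" "1 / sqrt 2" "x / sqrt 2" "1 / sqrt 2 * (2 * sqrt 2 - 3)" "- (x / sqrt 2)"]
    unfolding right_def C2_def by (simp add: distrib_left mult.assoc)
  ultimately have "\<bar>sol t x\<bar> \<le> max C1 C2" if "0 < t" for t x
    using that by (auto simp: sol_def le_max_iff_disj)
  moreover have "0 \<le> C1" unfolding C1_def using B(1) by (intro add_nonneg_nonneg mult_nonneg_nonneg) auto
  ultimately show thesis by (intro that[of "max C1 C2"]) auto
qed

text \<open>Off the interface the truncated halves of the datum are continuous, so all potentials
  converge. The reflected and transmitted ones are evaluated on the side where their density
  vanishes, and only the direct one survives.\<close>

lemma sol_initial: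
  assumes \<tau>: "\<And>n. 0 < \<tau> n" "\<tau> \<longlonglongrightarrow> 0" and x: "x \<noteq> 0"
  shows "(\<lambda>n. sol (\<tau> n) x) \<longlonglongrightarrow> u0 x"
proof -
  obtain B where B: "0 \<le> B" "\<And>x. \<bar>u0 x\<bar> \<le> B" using u0_bound by blast
  have kl: "indicat_real {-M..0} y * u0 y = (if y \<le> 0 then u0 y else 0)" for y
    using supp[of y] by (auto simp: indicator_def)
  have kr: "indicat_real {0..M} y * u0 y = (if 0 \<le> y then u0 y else 0)" for y
    using supp[of y] by (auto simp: indicator_def)
  have cont_if: "isCont (\<lambda>y. if y \<le> 0 then u0 y else 0) y" "isCont (\<lambda>y. if 0 \<le> y then u0 y else 0) y"
    if "y \<noteq> 0" for y
  proof -
    have u: "isCont u0 y" using cont_u0[of UNIV] by (simp add: continuous_on_eq_continuous_at)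
    have neg: "eventually (\<lambda>z. z < 0) (nhds y)" if "y < 0" using that by (rule eventually_nhds_in_open[of "{..<0}", simplified, rotated]) simp
    have pos: "eventually (\<lambda>z. 0 < z) (nhds y)" if "0 < y" using that by (rule eventually_nhds_in_open[of "{0<..}", simplified, rotated]) simp
    have cong: "isCont f y" if "isCont g y" "eventually (\<lambda>z. f z = g z) (nhds y)" for f g :: "real \<Rightarrow> real"
      using that isCont_cong[of f g y] by blast
    show "isCont (\<lambda>y. if y \<le> 0 then u0 y else 0) y"
    proof (cases "y < 0")
      case True
      show ?thesis by (rule cong[OF u]) (use neg[OF True] in \<open>auto elim!: eventually_mono\<close>)
    next
      case False
      then have "0 < y" using that by simp
      show ?thesis
        by (rule cong[of "\<lambda>_. 0"]) (use pos[OF \<open>0 < y\<close>] in \<open>auto elim!: eventually_mono\<close>)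
    qed
    show "isCont (\<lambda>y. if 0 \<le> y then u0 y else 0) y"
    proof (cases "y < 0")
      case True
      show ?thesis
        by (rule cong[of "\<lambda>_. 0"]) (use neg[OF True] in \<open>auto elim!: eventually_mono\<close>)
    next
      case False
      then have "0 < y" using that by simp
      show ?thesis by (rule cong[OF u]) (use pos[OF \<open>0 < y\<close>] in \<open>auto elim!: eventually_mono\<close>)
    qed
  qed
  have L: "(\<lambda>n. PL heat (\<tau> n) \<xi>) \<longlonglongrightarrow> (if \<xi> \<le> 0 then u0 \<xi> else 0)" if "\<xi> \<noteq> 0" for \<xi>
    using potential_heat_limit[OF cont_u0 _ B(2) \<tau>, where c = 1 and a = "-M" and b = 0 and \<xi> = \<xi>] cont_if(1)[OF that] that
    by (simp add: PL_def kl)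
  have R: "(\<lambda>n. PR heat (\<tau> n) \<xi>) \<longlonglongrightarrow> (if 0 \<le> \<xi> then sqrt 2 * u0 (sqrt 2 * \<xi>) else 0)" if "\<xi> \<noteq> 0" for \<xi>
  proof -
    have "(\<lambda>n. potential heat u0 (1 / sqrt 2) 0 M (\<tau> n) \<xi>) \<longlonglongrightarrow>
        1 / (1 / sqrt 2) * (indicat_real {0..M} (\<xi> / (1 / sqrt 2)) * u0 (\<xi> / (1 / sqrt 2)))"
      by (rule potential_heat_limit[OF cont_u0 _ B(2) \<tau>])
         (use cont_if(2)[of "\<xi> / (1 / sqrt 2)"] that in \<open>simp_all add: kr\<close>)
    also have "1 / (1 / sqrt 2) * (indicat_real {0..M} (\<xi> / (1 / sqrt 2)) * u0 (\<xi> / (1 / sqrt 2))) =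
        (if 0 \<le> \<xi> then sqrt 2 * u0 (sqrt 2 * \<xi>) else 0)"
      unfolding kr by (simp add: zero_le_mult_iff mult.commute)
    finally show ?thesis by (simp only: PR_def)
  qed
  show ?thesis
  proof (cases "x < 0")
    case True
    have "(\<lambda>n. left heat (\<tau> n) x) \<longlonglongrightarrow> (2 - sqrt 2) * (if 0 \<le> x then sqrt 2 * u0 (sqrt 2 * x) else 0) +
        (if x \<le> 0 then u0 x else 0) + (3 - 2 * sqrt 2) * (if - x \<le> 0 then u0 (- x) else 0)"
      unfolding left_def by (intro tendsto_intros L R) (use True in auto)
    then show ?thesis using True by (simp add: sol_def)
  next
    case False
    then have pos: "0 < x" using x by simp
    let ?y = "x / sqrt 2"
    have "(\<lambda>n. right heat (\<tau> n) x) \<longlonglongrightarrow> (4 - 2 * sqrt 2) * (if ?y \<le> 0 then u0 ?y else 0) +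
        (1 / sqrt 2) * ((if 0 \<le> ?y then sqrt 2 * u0 (sqrt 2 * ?y) else 0) +
        (2 * sqrt 2 - 3) * (if 0 \<le> - ?y then sqrt 2 * u0 (sqrt 2 * - ?y) else 0))"
      unfolding right_def by (intro tendsto_intros L R) (use pos in auto)
    moreover have "0 < ?y" using pos by simp
    moreover from this have "\<not> ?y \<le> 0" "0 \<le> ?y" "\<not> 0 \<le> - ?y" by linarith+
    moreover have "sqrt 2 * ?y = x" by simp
    ultimately show ?thesis using pos by (simp add: sol_def)
  qed
qed

end

section \<open>The time-integrated equation for the explicit solution, and uniqueness\<close>

context interface_problem
begin

lemma continuous_on_sol_slices:
  "0 < t \<Longrightarrow> continuous_on A (sol t)"
  "0 < t \<Longrightarrow> continuous_on A (sol_x t)"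
  "0 < t \<Longrightarrow> continuous_on A (sol_t t)"
  "0 < d \<Longrightarrow> continuous_on {d..t} (\<lambda>s. sol s z)"
  "0 < d \<Longrightarrow> continuous_on {d..t} (\<lambda>s. sol_x s z)"
  "continuous_on {0<..} (\<lambda>s. sol_t s z)"
proof -
  have sl: "continuous_on A (f t)" if "0 < t" "continuous_on ({0<..} \<times> UNIV) (\<lambda>(t, x). f t x)"
    for f :: "real \<Rightarrow> real \<Rightarrow> real" and A t
  proof -
    have "continuous_on A (\<lambda>x. (\<lambda>(t, x). f t x) (t, x))"
      by (rule continuous_on_compose2[OF that(2)]) (use that(1) in \<open>auto intro!: continuous_intros\<close>)
    then show ?thesis by simp
  qed
  have st: "continuous_on {0<..} (\<lambda>s. f s z)" if "continuous_on ({0<..} \<times> UNIV) (\<lambda>(t, x). f t x)"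
    for f :: "real \<Rightarrow> real \<Rightarrow> real" and z
  proof -
    have "continuous_on {0<..} (\<lambda>s. (\<lambda>(t, x). f t x) (s, z))"
      by (rule continuous_on_compose2[OF that]) (auto intro!: continuous_intros)
    then show ?thesis by simp
  qed
  show "0 < t \<Longrightarrow> continuous_on A (sol t)" by (rule sl[OF _ continuous_on_sol(1)])
  show "0 < t \<Longrightarrow> continuous_on A (sol_x t)" by (rule sl[OF _ continuous_on_sol(2)])
  show "0 < t \<Longrightarrow> continuous_on A (sol_t t)" by (rule sl[OF _ continuous_on_sol(3)])
  show "continuous_on {0<..} (\<lambda>s. sol_t s z)" by (rule st[OF continuous_on_sol(3)])
  show "0 < d \<Longrightarrow> continuous_on {d..t} (\<lambda>s. sol s z)" "0 < d \<Longrightarrow> continuous_on {d..t} (\<lambda>s. sol_x s z)"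
    by (rule continuous_on_subset[OF st[OF continuous_on_sol(1)]], auto)
       (rule continuous_on_subset[OF st[OF continuous_on_sol(2)]], auto)
qed

text \<open>Starting at \<open>d > 0\<close> stays away from the initial singularity of the kernel,
  so Leibniz' rule applies: the time integral is continuously differentiable across 0, and off 0 its
  second derivative is the integral of \<open>sol_t / a\<close>, that is
  \<open>(sol t - sol d) / a\<close>.\<close>

lemma sol_second_difference_from:
  assumes d: "0 < d" "d < t" and h: "0 < h"
  shows "((\<lambda>z. (sol t z - sol d z) / coeff_a z * (h - \<bar>z - x\<bar>)) has_integral
    (integral {d..t} (\<lambda>s. sol s (x + h)) - 2 * integral {d..t} (\<lambda>s. sol s x) +
     integral {d..t} (\<lambda>s. sol s (x - h)))) {x - h..x + h}"
proof (rule second_difference_FTC[OF _ _ _ h])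
  have cont: "continuous_on (U \<times> {d..t}) (\<lambda>(z, s). f s z)"
    if "continuous_on ({0<..} \<times> UNIV) (\<lambda>(t, x). f t x)" for f :: "real \<Rightarrow> real \<Rightarrow> real" and U
  proof -
    have "continuous_on (U \<times> {d..t}) (\<lambda>p. (\<lambda>(t, x). f t x) (snd p, fst p))"
      by (rule continuous_on_compose2[OF that]) (use d in \<open>auto intro!: continuous_intros\<close>)
    then show ?thesis by (simp add: case_prod_unfold)
  qed
  have "((\<lambda>z. integral (cbox d t) (\<lambda>s. sol s z)) has_field_derivative integral (cbox d t) (\<lambda>s. sol_x s z))
      (at z within UNIV)" for z
  proof (rule leibniz_rule_field_derivative[where f = "\<lambda>z s. sol s z" and fx = "\<lambda>z s. sol_x s z"])
    show "((\<lambda>z. sol s z) has_field_derivative sol_x s z) (at z within UNIV)" if "s \<in> cbox d t" for s z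
      by (rule DERIV_sol_x) (use that d in simp)
    show "(\<lambda>s. sol s z) integrable_on cbox d t" for z
      using continuous_on_sol_slices(4)[OF d(1)] by (auto intro: integrable_continuous_real)
    show "continuous_on (UNIV \<times> cbox d t) (\<lambda>(z, s). sol_x s z)"
      using cont[OF continuous_on_sol(2)] by simp
  qed auto
  then show "((\<lambda>z. integral {d..t} (\<lambda>s. sol s z)) has_real_derivative integral {d..t} (\<lambda>s. sol_x s z)) (at z)" for z
    by simp
  have "continuous_on (UNIV \<times> cbox d t) (\<lambda>(z, s). sol_x s z)"
    using cont[OF continuous_on_sol(2)] by simp
  from integral_continuous_on_param[OF this]
  show "continuous_on UNIV (\<lambda>z. integral {d..t} (\<lambda>s. sol_x s z))" by simp
  show "((\<lambda>z. integral {d..t} (\<lambda>s. sol_x s z)) has_real_derivative (sol t z - sol d z) / coeff_a z) (at z)"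
    if z: "z \<noteq> 0" for z
  proof -
    \<comment> \<open>The half-line containing \<open>z\<close>: Leibniz' rule requires a convex
      domain, and here the coefficient is constant and the interface is avoided.\<close>
    define U where "U = (if z < 0 then {..<0} else {0 :: real<..})"
    have U: "z \<in> U" "open U" "convex U" "0 \<notin> U"
      using z by (auto simp: U_def)
    have a: "coeff_a y = coeff_a z" if "y \<in> U" for y
      using that z by (auto simp: U_def coeff_a_def split: if_splits)
    have "((\<lambda>z. integral (cbox d t) (\<lambda>s. sol_x s z)) has_field_derivative
        integral (cbox d t) (\<lambda>s. sol_t s z / coeff_a z)) (at z within U)"
    proof (rule leibniz_rule_field_derivative[where f = "\<lambda>z s. sol_x s z" and fx = "\<lambda>z s. sol_t s z / coeff_a z"])
      show "((\<lambda>z. sol_x s z) has_field_derivative sol_t s y / coeff_a y) (at y within U)"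
        if "y \<in> U" "s \<in> cbox d t" for s y
        by (rule has_field_derivative_at_within[OF DERIV_sol_xx]) (use that d U(4) in auto)
      show "(\<lambda>s. sol_x s z) integrable_on cbox d t" for z
        using continuous_on_sol_slices(5)[OF d(1)] by (auto intro: integrable_continuous_real)
      have "continuous_on (U \<times> cbox d t) (\<lambda>p. (\<lambda>(z, s). sol_t s z) p / coeff_a z)"
        using cont[OF continuous_on_sol(3), of U] coeff_a_bounds(1)[of z]
        by (intro continuous_on_divide continuous_on_const) auto
      then show "continuous_on (U \<times> cbox d t) (\<lambda>(z, s). sol_t s z / coeff_a z)"
        by (rule continuous_on_eq) (auto simp: a)
    qed (use U in auto)
    moreover have "at z within U = at z" by (rule at_within_open) (use U in auto)
    moreover have int: "((\<lambda>s. sol_t s z / coeff_a z) has_integral (sol t z / coeff_a z - sol d z / coeff_a z)) {d..t}"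
    proof (rule fundamental_theorem_of_calculus)
      fix s assume "s \<in> {d..t}"
      then have "((\<lambda>s. sol s z) has_real_derivative sol_t s z) (at s within {d..t})"
        using has_field_derivative_at_within[OF DERIV_sol_t] d by simp
      then have "((\<lambda>s. sol s z / coeff_a z) has_real_derivative sol_t s z / coeff_a z) (at s within {d..t})"
        by (rule DERIV_cdivide)
      then show "((\<lambda>s. sol s z / coeff_a z) has_vector_derivative sol_t s z / coeff_a z) (at s within {d..t})"
        by (simp add: has_real_derivative_iff_has_vector_derivative)
    qed (use d in simp)
    moreover from int have "integral (cbox d t) (\<lambda>s. sol_t s z / coeff_a z) = (sol t z - sol d z) / coeff_a z"
      unfolding box_real diff_divide_distrib by (rule integral_unique)
    ultimately show ?thesis by (simp only: box_real)
  qed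
qed

lemma sol_time_integral:
  shows sol_time_integrable: "\<And>t x. set_integrable lborel {0<..t} (\<lambda>s. sol s x)"
    and sol_time_integral_limit: "\<And>t x d. 0 < t \<Longrightarrow> (\<And>n. 0 < d n \<and> d n < t) \<Longrightarrow> d \<longlonglongrightarrow> 0 \<Longrightarrow>
      (\<lambda>n. integral {d n..t} (\<lambda>s. sol s x)) \<longlonglongrightarrow> (LINT s:{0<..t}|lborel. sol s x)"
proof -
  obtain C where C: "\<And>t x. 0 < t \<Longrightarrow> \<bar>sol t x\<bar> \<le> C" using sol_bounded by blast
  have cont: "continuous_on ({0<..t} \<times> UNIV) (\<lambda>(t, x). sol t x)" for t
    by (rule continuous_on_subset[OF continuous_on_sol(1)]) auto
  have bound: "\<exists>C. \<forall>s\<in>{0<..t}. \<forall>x. \<bar>x\<bar> \<le> M \<longrightarrow> \<bar>sol s x\<bar> \<le> C" for M t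
    using C by (intro exI[of _ C]) auto
  show "set_integrable lborel {0<..t} (\<lambda>s. sol s x)" for t x
    by (rule time_integrable[OF cont bound]) auto
  fix t x and d :: "nat \<Rightarrow> real"
  assume t: "0 < t" and d: "\<And>n. 0 < d n \<and> d n < t" "d \<longlonglongrightarrow> 0"
  define W where "W s x = (LINT r:{0<..s}|lborel. sol r x)" for s x
  have contW: "continuous_on ({0..t} \<times> UNIV) (\<lambda>(s, x). W s x)"
    unfolding W_def by (rule time_integral_continuous[OF cont bound])
  have derW: "((\<lambda>s. W s x) has_real_derivative sol s x) (at s within {0..t})" if "0 < s" "s \<le> t" for s
    unfolding W_def by (rule time_integral_DERIV[OF cont bound that])
  have eq: "integral {d n..t} (\<lambda>s. sol s x) = W t x - W (d n) x" for n
  proof (rule integral_unique, rule fundamental_theorem_of_calculus)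
    fix s assume "s \<in> {d n..t}"
    then have "((\<lambda>s. W s x) has_real_derivative sol s x) (at s within {d n..t})"
      using d(1)[of n] by (intro DERIV_subset[OF derW]) auto
    then show "((\<lambda>s. W s x) has_vector_derivative sol s x) (at s within {d n..t})"
      by (simp add: has_real_derivative_iff_has_vector_derivative)
  qed (use d(1)[of n] in simp)
  have "continuous_on {0..t} (\<lambda>s. (\<lambda>(s, x). W s x) (s, x))"
    by (rule continuous_on_compose2[OF contW]) (auto intro!: continuous_intros)
  then have "continuous_on {0..t} (\<lambda>s. W s x)" by simp
  then have "(\<lambda>n. W (d n) x) \<longlonglongrightarrow> W 0 x"
    by (rule continuous_on_tendsto_compose[OF _ d(2)]) (use t d(1) in \<open>auto intro!: always_eventually less_imp_le\<close>)
  then have "(\<lambda>n. W t x - W (d n) x) \<longlonglongrightarrow> W t x - W 0 x" by (intro tendsto_intros)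
  then show "(\<lambda>n. integral {d n..t} (\<lambda>s. sol s x)) \<longlonglongrightarrow> (LINT s:{0<..t}|lborel. sol s x)"
    by (simp add: eq) (simp add: W_def set_lebesgue_integral_def)
qed

text \<open>The lower time limit tends to 0; the uniform bound on the explicit solution dominates
  the integrands.\<close>

lemma sol_second_difference:
  assumes t: "0 < t" and h: "0 < h"
  shows "((\<lambda>z. (sol t z - u0 z) / coeff_a z * (h - \<bar>z - x\<bar>)) has_integral
    ((LINT s:{0<..t}|lborel. sol s (x + h)) - 2 * (LINT s:{0<..t}|lborel. sol s x) +
     (LINT s:{0<..t}|lborel. sol s (x - h)))) {x - h..x + h}"
proof -
  define d where "d n = t * inverse (real (Suc (Suc n)))" for n
  have d: "0 < d n \<and> d n < t" for n
    using t by (auto simp: d_def field_simps intro!: add_pos_nonneg mult_nonneg_nonneg)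
  have "(\<lambda>n. t * inverse (real (Suc (Suc n)))) \<longlonglongrightarrow> t * 0"
    by (intro tendsto_intros LIMSEQ_Suc[OF LIMSEQ_inverse_real_of_nat])
  then have dlim: "d \<longlonglongrightarrow> 0" by (simp add: d_def[abs_def])
  obtain C where C: "0 \<le> C" "\<And>t x. 0 < t \<Longrightarrow> \<bar>sol t x\<bar> \<le> C" using sol_bounded by blast
  let ?I = "\<lambda>n. integral {d n..t} (\<lambda>s. sol s (x + h)) - 2 * integral {d n..t} (\<lambda>s. sol s x) +
     integral {d n..t} (\<lambda>s. sol s (x - h))"
  \<comment> \<open>The integrands are set to 0 at \<open>z = 0\<close>, where convergence to the
    datum has not been established; a single point does not affect the integrals.\<close>
  let ?f = "\<lambda>n z. if z = 0 then 0 else (sol t z - sol (d n) z) / coeff_a z * (h - \<bar>z - x\<bar>)"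
  let ?g = "\<lambda>z. if z = 0 then 0 else (sol t z - u0 z) / coeff_a z * (h - \<bar>z - x\<bar>)"
  have fi: "(?f n has_integral ?I n) {x - h..x + h}" for n
    by (rule has_integral_spike_finite[OF _ _ sol_second_difference_from[of "d n" t h x], of "{0}"])
       (use d[of n] h in auto)
  have dc: "?g integrable_on {x - h..x + h} \<and>
      (\<lambda>n. integral {x - h..x + h} (?f n)) \<longlonglongrightarrow> integral {x - h..x + h} ?g"
  proof (rule conjI; rule dominated_convergence[where h = "\<lambda>_. 2 * C * h" and f = ?f])
    show "(\<lambda>_. 2 * C * h) integrable_on {x - h..x + h}" by (rule integrable_const_ivl)
    then show "(\<lambda>_. 2 * C * h) integrable_on {x - h..x + h}" .
    show "norm (?f n z) \<le> 2 * C * h" if "z \<in> {x - h..x + h}" for n z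
    proof -
      have "\<bar>sol t z - sol (d n) z\<bar> \<le> 2 * C"
        using C(2)[OF t, of z] C(2)[of "d n" z] d[of n] by linarith
      moreover have "\<bar>h - \<bar>z - x\<bar>\<bar> \<le> h" using that by auto
      moreover have "\<bar>sol t z - sol (d n) z\<bar> / coeff_a z \<le> \<bar>sol t z - sol (d n) z\<bar>"
        using coeff_a_bounds[of z] by (simp add: divide_le_eq mult_le_cancel_left1)
      ultimately have "\<bar>sol t z - sol (d n) z\<bar> / coeff_a z * \<bar>h - \<bar>z - x\<bar>\<bar> \<le> (2 * C) * h"
        using C(1) by (intro mult_mono) auto
      then show ?thesis using coeff_a_bounds[of z] C(1) h by (auto simp: abs_mult)
    qed
    then show "norm (?f n z) \<le> 2 * C * h" if "z \<in> {x - h..x + h}" for n z using that by blast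
    show "(\<lambda>n. ?f n z) \<longlonglongrightarrow> ?g z" for z
    proof (cases "z = 0")
      case False
      have "(\<lambda>n. sol (d n) z) \<longlonglongrightarrow> u0 z" using sol_initial[OF _ dlim False] d by blast
      then have "(\<lambda>n. (sol t z - sol (d n) z) / coeff_a z * (h - \<bar>z - x\<bar>)) \<longlonglongrightarrow>
          (sol t z - u0 z) / coeff_a z * (h - \<bar>z - x\<bar>)"
        using coeff_a_bounds(1)[of z] by (intro tendsto_intros) auto
      then show ?thesis using False by simp
    qed simp
    then show "(\<lambda>n. ?f n z) \<longlonglongrightarrow> ?g z" for z .
  qed (use fi in \<open>auto intro: has_integral_integrable\<close>)
  have "?I \<longlonglongrightarrow> (LINT s:{0<..t}|lborel. sol s (x + h)) - 2 * (LINT s:{0<..t}|lborel. sol s x) +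
     (LINT s:{0<..t}|lborel. sol s (x - h))"
    by (intro tendsto_intros sol_time_integral_limit t d dlim)
  moreover have "?I = (\<lambda>n. integral {x - h..x + h} (?f n))"
    using integral_unique[OF fi] by simp
  ultimately have "(\<lambda>n. integral {x - h..x + h} (?f n)) \<longlonglongrightarrow> (LINT s:{0<..t}|lborel. sol s (x + h)) -
      2 * (LINT s:{0<..t}|lborel. sol s x) + (LINT s:{0<..t}|lborel. sol s (x - h))"
    by (simp only:)
  from LIMSEQ_unique[OF conjunct2[OF dc] this] integrable_integral[OF conjunct1[OF dc]]
  have "(?g has_integral (LINT s:{0<..t}|lborel. sol s (x + h)) -
      2 * (LINT s:{0<..t}|lborel. sol s x) + (LINT s:{0<..t}|lborel. sol s (x - h))) {x - h..x + h}"
    by (simp only:)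
  then show ?thesis
    by (rule has_integral_spike_finite[of "{0}", rotated 2]) auto
qed

text \<open>Subtracting the two time-integrated equations eliminates the datum. The maximum
  principle, applied to the time integral \<open>W\<close> of the difference and to
  \<open>- W\<close>, gives \<open>W = 0\<close>, and the difference is recovered as the time
  derivative of \<open>W\<close>.\<close>

lemma strong_solution_eq_sol:
  assumes u: "strong_solution T u0 u" and T: "0 < T"
    and growth: "\<And>t x. t \<in> {0..T} \<Longrightarrow> \<bar>u t x\<bar> \<le> C * (1 + \<bar>x\<bar>)"
    and t: "t \<in> {0<..T}"
  shows "u t x = sol t x"
proof -
  obtain D where D: "0 \<le> D" "\<And>t x. 0 < t \<Longrightarrow> \<bar>sol t x\<bar> \<le> D" using sol_bounded by blast
  have contu: "continuous_on ({0..T} \<times> UNIV) (\<lambda>(t, x). u t x)"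
    using u by (simp add: strong_solution_def)
  have C0: "0 \<le> C" using growth[of 0 0] T by simp
  define v where "v t x = u t x - sol t x" for t x
  have cont_u: "continuous_on ({0<..T} \<times> UNIV) (\<lambda>(t, x). u t x)"
    by (rule continuous_on_subset[OF contu]) auto
  have cont_s: "continuous_on ({0<..T} \<times> UNIV) (\<lambda>(t, x). sol t x)"
    by (rule continuous_on_subset[OF continuous_on_sol(1)]) auto
  have cont_v: "continuous_on ({0<..T} \<times> UNIV) (\<lambda>(t, x). v t x)"
    using continuous_on_diff[OF cont_u cont_s] by (simp add: v_def case_prod_unfold)
  have bound_u: "\<bar>u t x\<bar> \<le> C * (1 + M)" if "t \<in> {0<..T}" "\<bar>x\<bar> \<le> M" for t x M
  proof -
    have "\<bar>u t x\<bar> \<le> C * (1 + \<bar>x\<bar>)" using that by (intro growth) auto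
    also have "\<dots> \<le> C * (1 + M)" using that C0 by (intro mult_left_mono) auto
    finally show ?thesis .
  qed
  have bound_v: "\<bar>v t x\<bar> \<le> (C + D) * (1 + \<bar>x\<bar>)" if "t \<in> {0<..T}" for t x
  proof -
    have "D * 1 \<le> D * (1 + \<bar>x\<bar>)" using D(1) by (intro mult_left_mono) auto
    then show ?thesis
      using bound_u[OF that order_refl, of x] D(2)[of t x] that unfolding v_def distrib_right by auto
  qed
  have bd_u: "\<exists>C. \<forall>t\<in>{0<..T}. \<forall>x. \<bar>x\<bar> \<le> M \<longrightarrow> \<bar>u t x\<bar> \<le> C" for M
    using bound_u by (intro exI[of _ "C * (1 + M)"]) auto
  have bd_v: "\<exists>C. \<forall>t\<in>{0<..T}. \<forall>x. \<bar>x\<bar> \<le> M \<longrightarrow> \<bar>v t x\<bar> \<le> C" for M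
  proof (intro exI[of _ "(C + D) * (1 + M)"] ballI allI impI)
    fix t x assume *: "t \<in> {0<..T}" "\<bar>x\<bar> \<le> M"
    have "(C + D) * (1 + \<bar>x\<bar>) \<le> (C + D) * (1 + M)" using * C0 D(1) by (intro mult_left_mono) auto
    then show "\<bar>v t x\<bar> \<le> (C + D) * (1 + M)" using bound_v[OF *(1), of x] by linarith
  qed
  define W where "W t x = (LINT s:{0<..t}|lborel. v s x)" for t x
  have contW: "continuous_on ({0..T} \<times> UNIV) (\<lambda>(t, x). W t x)"
    unfolding W_def by (rule time_integral_continuous[OF cont_v bd_v])
  have derW: "((\<lambda>s. W s x) has_real_derivative v t x) (at t within {0..T})" if "0 < t" "t \<le> T" for t x
    unfolding W_def by (rule time_integral_DERIV[OF cont_v bd_v that])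
  have W0: "W 0 x = 0" for x by (simp add: W_def set_lebesgue_integral_def)
  have iu: "set_integrable lborel {0<..t} (\<lambda>s. u s x)" if "t \<le> T" for t x
    by (rule time_integrable[OF cont_u bd_u _ that]) simp
  have Wdiff: "W t x = (LINT s:{0<..t}|lborel. u s x) - (LINT s:{0<..t}|lborel. sol s x)" if "t \<le> T" for t x
    unfolding W_def v_def by (rule set_integral_diff(2)[OF iu[OF that] sol_time_integrable])
  have Wgrowth: "\<bar>W t x\<bar> \<le> (T * (C + D)) * (1 + \<bar>x\<bar>)" if "t \<in> {0..T}" for t x
  proof -
    have iv: "set_integrable lborel {0<..t} (\<lambda>s. v s x)"
      unfolding v_def using that by (intro set_integral_diff(1) iu sol_time_integrable) auto
    have "\<bar>W t x\<bar> \<le> (LINT s:{0<..t}|lborel. \<bar>v s x\<bar>)"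
      unfolding W_def using set_integral_norm_bound[OF iv] by simp
    also have "\<dots> \<le> (LINT s:{0<..t}|lborel. (C + D) * (1 + \<bar>x\<bar>))"
    proof (rule set_integral_mono)
      show "set_integrable lborel {0<..t} (\<lambda>s. \<bar>v s x\<bar>)" by (rule set_integrable_abs[OF iv])
      show "set_integrable lborel {0<..t} (\<lambda>s. (C + D) * (1 + \<bar>x\<bar>))"
        unfolding set_integrable_def real_scaleR_def
        by (intro integrable_mult_left integrable_real_indicator emeasure_bounded_finite
              bounded_subset[OF bounded_cbox[of 0 t]]) auto
      show "\<bar>v s x\<bar> \<le> (C + D) * (1 + \<bar>x\<bar>)" if "s \<in> {0<..t}" for s
        using that \<open>t \<in> {0..T}\<close> by (intro bound_v) auto
    qed
    also have "\<dots> = t * ((C + D) * (1 + \<bar>x\<bar>))"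
      using that by (simp add: set_lebesgue_integral_def)
    also have "\<dots> \<le> T * ((C + D) * (1 + \<bar>x\<bar>))"
      using that C0 D(1) by (intro mult_right_mono) auto
    finally show ?thesis by simp
  qed
  have contv: "continuous_on UNIV (v t)" if "0 < t" "t \<le> T" for t
  proof -
    have "continuous_on UNIV (\<lambda>x. (\<lambda>(t, x). v t x) (t, x))"
      by (rule continuous_on_compose2[OF cont_v]) (use that in \<open>auto intro!: continuous_intros\<close>)
    then show ?thesis by simp
  qed
  have eq: "((\<lambda>z. v t z / coeff_a z * (h - \<bar>z - x\<bar>)) has_integral
      (W t (x + h) - 2 * W t x + W t (x - h))) {x - h..x + h}" if "0 < t" "t \<le> T" "0 < h" for t x h
  proof -
    have "((\<lambda>z. (u t z - u0 z) / coeff_a z * (h - \<bar>z - x\<bar>) - (sol t z - u0 z) / coeff_a z * (h - \<bar>z - x\<bar>))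
       has_integral (((LINT s:{0<..t}|lborel. u s (x + h)) - 2 * (LINT s:{0<..t}|lborel. u s x) +
         (LINT s:{0<..t}|lborel. u s (x - h))) -
        ((LINT s:{0<..t}|lborel. sol s (x + h)) - 2 * (LINT s:{0<..t}|lborel. sol s x) +
         (LINT s:{0<..t}|lborel. sol s (x - h))))) {x - h..x + h}"
      using that by (intro has_integral_diff strong_solution_second_difference[OF u T] sol_second_difference) auto
    moreover have "(\<lambda>z. (u t z - u0 z) / coeff_a z * (h - \<bar>z - x\<bar>) - (sol t z - u0 z) / coeff_a z * (h - \<bar>z - x\<bar>)) =
        (\<lambda>z. v t z / coeff_a z * (h - \<bar>z - x\<bar>))"
      by (intro ext) (simp add: v_def diff_divide_distrib left_diff_distrib)
    ultimately show ?thesis using that(2) by (simp add: Wdiff algebra_simps)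
  qed
  have W_le: "W t x \<le> 0" if "t \<in> {0..T}" for t x
    by (rule second_difference_max_principle[OF contW W0 derW contv Wgrowth eq that])
  have W_ge: "- W t x \<le> 0" if "t \<in> {0..T}" for t x
  proof (rule second_difference_max_principle[where W = "\<lambda>t x. - W t x" and w = "\<lambda>t x. - v t x" and T = T])
    show "continuous_on ({0..T} \<times> UNIV) (\<lambda>(t, x). - W t x)"
      using continuous_on_minus[OF contW] by (simp add: case_prod_unfold)
    show "((\<lambda>s. - W s x) has_real_derivative - v t x) (at t within {0..T})" if "0 < t" "t \<le> T" for t x
      by (rule DERIV_minus[OF derW[OF that]])
    show "continuous_on UNIV (\<lambda>x. - v t x)" if "0 < t" "t \<le> T" for t
      by (intro continuous_on_minus contv that)
    show "\<bar>- W t x\<bar> \<le> (T * (C + D)) * (1 + \<bar>x\<bar>)" if "t \<in> {0..T}" for t x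
      using Wgrowth[OF that, of x] by simp
    show "((\<lambda>z. - v t z / coeff_a z * (h - \<bar>z - x\<bar>)) has_integral
        (- W t (x + h) - 2 * (- W t x) + - W t (x - h))) {x - h..x + h}" if "0 < t" "t \<le> T" "0 < h" for t x h
      using has_integral_neg[OF eq[OF that, of x]] by (simp add: algebra_simps)
  qed (use W0 that in auto)
  have Wz: "W t x = 0" if "t \<in> {0..T}" for t x
    using W_le[OF that, of x] W_ge[OF that, of x] by simp
  have t': "0 < t" "t \<le> T" using t by auto
  have "((\<lambda>s. 0) has_real_derivative v t x) (at t within {0..T})"
    by (rule has_field_derivative_transform_within[OF derW[OF t'], of 1]) (use t' Wz in auto)
  moreover have "((\<lambda>s. 0 :: real) has_real_derivative 0) (at t within {0..T})" by simp
  \<comment> \<open>At \<open>t = T\<close> the derivative is one-sided; it is still unique because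
    \<open>t\<close> is a limit point of the interval.\<close>
  moreover have "at t within {0..T} \<noteq> bot"
  proof -
    have "t islimpt {0..T}"
      by (rule connected_imp_perfect) (use t T in auto)
    then show ?thesis by (simp add: trivial_limit_within)
  qed
  ultimately have "v t x = 0"
    unfolding has_real_derivative_iff_has_vector_derivative
    using vector_derivative_unique_within by blast
  then show ?thesis by (simp add: v_def)
qed

section \<open>Agreement with the explicit formula\<close>

lemma LINT_atLeast_0:
  fixes g :: "real \<Rightarrow> real"
  assumes "continuous_on {0..M} g" "\<And>y. M \<le> y \<Longrightarrow> g y = 0"
  shows "(LINT y:{0..}|lborel. g y) = integral {0..M} g"
proof -
  have "(LINT y:{0..}|lborel. g y) = (LINT y:{0..M}|lborel. g y)"
    unfolding set_lebesgue_integral_def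
    by (rule Bochner_Integration.integral_cong) (use assms(2) in \<open>auto simp: indicator_def\<close>)
  also have "\<dots> = integral {0..M} g"
    by (intro set_borel_integral_eq_integral(2) borel_integrable_atLeastAtMost' assms)
  finally show ?thesis .
qed

lemma LINT_atMost_0:
  fixes g :: "real \<Rightarrow> real"
  assumes "continuous_on {-M..0} g" "\<And>y. y \<le> - M \<Longrightarrow> g y = 0"
  shows "(LINT y:{..0}|lborel. g y) = integral {-M..0} g"
proof -
  have "(LINT y:{..0}|lborel. g y) = (LINT y:{-M..0}|lborel. g y)"
    unfolding set_lebesgue_integral_def
    by (rule Bochner_Integration.integral_cong) (use assms(2) in \<open>auto simp: indicator_def\<close>)
  also have "\<dots> = integral {-M..0} g"
    by (intro set_borel_integral_eq_integral(2) borel_integrable_atLeastAtMost' assms)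
  finally show ?thesis .
qed

text \<open>The kernels with \<open>8 * t\<close> become standard heat kernels once all lengths are
  divided by \<open>sqrt 2\<close>. The factor \<open>1 / sqrt 2\<close> from
  \<open>sqrt (8 * pi * t)\<close> turns \<open>4 * sqrt 2 - 4\<close> into
  \<open>4 - 2 * sqrt 2\<close>.\<close>

lemma explicit_eq_branches:
  assumes t: "0 < t"
  shows explicit_left_eq: "explicit_left u0 t x = left heat t x"
    and explicit_right_eq: "explicit_right u0 t x = right heat t x"
proof -
  have s0: "u0 y = 0" if "M \<le> y \<or> y \<le> - M" for y using supp[of y] that M_pos by auto
  have cL: "continuous_on {-M..0} (\<lambda>y. heat t (\<xi> - 1 * y) * u0 y)" for \<xi>
    by (rule potential_integrable[OF continuous_on_heat(1) cont_u0 t])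
  have cR: "continuous_on {0..M} (\<lambda>y. heat t (\<xi> - 1 / sqrt 2 * y) * u0 y)" for \<xi>
    by (rule potential_integrable[OF continuous_on_heat(1) cont_u0 t])
  have sq8: "sqrt (8 * pi * t) = sqrt 2 * sqrt (4 * pi * t)"
    by (simp flip: real_sqrt_mult)
  have arg1: "- (sqrt 2 * x - y)\<^sup>2 / (8 * t) = - (x - 1 / sqrt 2 * y)\<^sup>2 / (4 * t)" for x y
  proof -
    have "(sqrt 2 * x - y)\<^sup>2 = (sqrt 2 * (x - 1 / sqrt 2 * y))\<^sup>2" by (simp add: right_diff_distrib)
    then show ?thesis using t by (simp add: power_mult_distrib)
  qed
  have arg2: "- (x - sqrt 2 * y)\<^sup>2 / (8 * t) = - (x / sqrt 2 - 1 * y)\<^sup>2 / (4 * t)" for x y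
  proof -
    have "(x - sqrt 2 * y)\<^sup>2 = (sqrt 2 * (x / sqrt 2 - y))\<^sup>2" by (simp add: right_diff_distrib)
    then show ?thesis using t by (simp add: power_mult_distrib)
  qed
  have arg3: "- (x - y)\<^sup>2 / (8 * t) = - (x / sqrt 2 - 1 / sqrt 2 * y)\<^sup>2 / (4 * t)" for x y
  proof -
    have "(x - y)\<^sup>2 = (sqrt 2 * (x / sqrt 2 - 1 / sqrt 2 * y))\<^sup>2" by (simp add: right_diff_distrib)
    then show ?thesis using t by (simp add: power_mult_distrib)
  qed
  have arg4: "- (x + y)\<^sup>2 / (8 * t) = - (- (x / sqrt 2) - 1 / sqrt 2 * y)\<^sup>2 / (4 * t)" for x y
    using arg3[of "- x" y] by (simp add: power2_commute[of "- x" y] add.commute)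
  have "(LINT y:{0..}|lborel. (2 - sqrt 2) * (1 / sqrt (4 * pi * t)) * exp (- (sqrt 2 * x - y)\<^sup>2 / (8 * t)) * u0 y) =
      (LINT y:{0..}|lborel. (2 - sqrt 2) * (heat t (x - 1 / sqrt 2 * y) * u0 y))"
    by (simp only: arg1 heat_def) (simp add: mult.assoc)
  also have "\<dots> = integral {0..M} (\<lambda>y. (2 - sqrt 2) * (heat t (x - 1 / sqrt 2 * y) * u0 y))"
    by (rule LINT_atLeast_0, intro continuous_on_mult[OF continuous_on_const] cR) (simp add: s0)
  finally have l1: "(LINT y:{0..}|lborel. (2 - sqrt 2) * (1 / sqrt (4 * pi * t)) * exp (- (sqrt 2 * x - y)\<^sup>2 / (8 * t)) * u0 y) =
      (2 - sqrt 2) * PR heat t x"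
    by (simp add: PR_def potential_def)
  have "(LINT y:{..0}|lborel. (1 / sqrt (4 * pi * t) * exp (- (x - y)\<^sup>2 / (4 * t)) +
         (3 - 2 * sqrt 2) * (1 / sqrt (4 * pi * t)) * exp (- (x + y)\<^sup>2 / (4 * t))) * u0 y) =
      (LINT y:{..0}|lborel. heat t (x - 1 * y) * u0 y + (3 - 2 * sqrt 2) * (heat t (- x - 1 * y) * u0 y))"
  proof -
    have "(- x - y)\<^sup>2 = (x + y)\<^sup>2" for y by (simp add: power2_eq_square algebra_simps)
    then show ?thesis by (simp add: heat_def distrib_right mult.assoc)
  qed
  also have "\<dots> = integral {-M..0} (\<lambda>y. heat t (x - 1 * y) * u0 y + (3 - 2 * sqrt 2) * (heat t (- x - 1 * y) * u0 y))"
    by (rule LINT_atMost_0, intro continuous_on_add continuous_on_mult[OF continuous_on_const] cL)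
       (simp add: s0)
  also have "\<dots> = PL heat t x + (3 - 2 * sqrt 2) * PL heat t (- x)"
    unfolding PL_def potential_def integral_mult_right[symmetric]
    by (intro Henstock_Kurzweil_Integration.integral_add integrable_continuous_real cL
        continuous_on_mult[OF continuous_on_const])
  finally show "explicit_left u0 t x = left heat t x"
    unfolding explicit_left_def left_def l1 by simp
  have "(LINT y:{..0}|lborel. (4 * sqrt 2 - 4) * (1 / sqrt (8 * pi * t)) * exp (- (x - sqrt 2 * y)\<^sup>2 / (8 * t)) * u0 y) =
      (LINT y:{..0}|lborel. (4 - 2 * sqrt 2) * (heat t (x / sqrt 2 - 1 * y) * u0 y))"
  proof -
    have "(4 * sqrt 2 - 4) * (1 / (sqrt 2 * r)) = (4 - 2 * sqrt 2) * (1 / r)" for r :: real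
    proof -
      have "(4 * sqrt 2 - 4) * (1 / (sqrt 2 * r)) = ((4 * sqrt 2 - 4) * (1 / sqrt 2)) * (1 / r)" by simp
      also have "(4 * sqrt 2 - 4) * (1 / sqrt 2) = 4 - 2 * sqrt 2"
        unfolding sqrt2(2) using sqrt2(1) by (simp add: algebra_simps)
      finally show ?thesis .
    qed
    then show ?thesis by (simp only: arg2 sq8 heat_def) (simp add: mult.assoc)
  qed
  also have "\<dots> = integral {-M..0} (\<lambda>y. (4 - 2 * sqrt 2) * (heat t (x / sqrt 2 - 1 * y) * u0 y))"
    by (rule LINT_atMost_0, intro continuous_on_mult[OF continuous_on_const] cL) (simp add: s0)
  finally have r1: "(LINT y:{..0}|lborel. (4 * sqrt 2 - 4) * (1 / sqrt (8 * pi * t)) * exp (- (x - sqrt 2 * y)\<^sup>2 / (8 * t)) * u0 y) =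
      (4 - 2 * sqrt 2) * PL heat t (x / sqrt 2)"
    by (simp add: PL_def potential_def)
  let ?A = "\<lambda>y. heat t (x / sqrt 2 - 1 / sqrt 2 * y) * u0 y"
  let ?B = "\<lambda>y. heat t (- (x / sqrt 2) - 1 / sqrt 2 * y) * u0 y"
  have "(LINT y:{0..}|lborel. (1 / sqrt (8 * pi * t) * exp (- (x - y)\<^sup>2 / (8 * t)) +
         (2 * sqrt 2 - 3) * (1 / sqrt (8 * pi * t)) * exp (- (x + y)\<^sup>2 / (8 * t))) * u0 y) =
      (LINT y:{0..}|lborel. (1 / sqrt 2) * (?A y + (2 * sqrt 2 - 3) * ?B y))"
  proof -
    have alg: "(1 / (q * r) * a + k * (1 / (q * r)) * b) * w = (1 / q) * (a / r * w + k * (b / r * w))"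
      for q r a b k w :: real by (simp add: algebra_simps add_divide_distrib)
    show ?thesis by (simp only: arg3 arg4 sq8 heat_def alg)
  qed
  also have "\<dots> = integral {0..M} (\<lambda>y. (1 / sqrt 2) * (?A y + (2 * sqrt 2 - 3) * ?B y))"
  proof (rule LINT_atLeast_0)
    show "continuous_on {0..M} (\<lambda>y. (1 / sqrt 2) * (?A y + (2 * sqrt 2 - 3) * ?B y))"
      by (intro continuous_on_mult[OF continuous_on_const] continuous_on_add cR)
  qed (use s0 in simp)
  also have "\<dots> = (1 / sqrt 2) * (integral {0..M} ?A + integral {0..M} (\<lambda>y. (2 * sqrt 2 - 3) * ?B y))"
  proof -
    have "integral {0..M} (\<lambda>y. ?A y + (2 * sqrt 2 - 3) * ?B y) =
        integral {0..M} ?A + integral {0..M} (\<lambda>y. (2 * sqrt 2 - 3) * ?B y)"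
      by (intro Henstock_Kurzweil_Integration.integral_add integrable_continuous_real cR
          continuous_on_mult[OF continuous_on_const])
    then show ?thesis by (simp only: integral_mult_right)
  qed
  finally show "explicit_right u0 t x = right heat t x"
    unfolding explicit_right_def right_def r1 by (simp add: PR_def potential_def)
qed

end

text \<open>The values at \<open>x = 0\<close> are bounded by compactness of \<open>[0, T]\<close>,
  and increments in \<open>x\<close> are bounded uniformly in time through the supremum in the
  regularity norm. For \<open>s \<ge> 0\<close> its weight is at least 1, so it controls the mean
  square of the transform.\<close>

lemma regularity_growth:
  assumes T: "0 < T" and u: "strong_solution T u0 u" and reg: "regularity_sq s T u < \<infinity>" and s: "0 \<le> s"
  obtains C where "\<And>t x. t \<in> {0..T} \<Longrightarrow> \<bar>u t x\<bar> \<le> C * (1 + \<bar>x\<bar>)"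
proof -
  have contu: "continuous_on ({0..T} \<times> UNIV) (\<lambda>(t, x). u t x)"
    using u by (simp add: strong_solution_def)
  have contx: "continuous_on UNIV (u t)" if "t \<in> {0..T}" for t
  proof -
    have "continuous_on UNIV (\<lambda>x. (\<lambda>(t, x). u t x) (t, x))"
      by (rule continuous_on_compose2[OF contu]) (use that in \<open>auto intro!: continuous_intros\<close>)
    then show ?thesis by simp
  qed
  have "continuous_on {0..T} (\<lambda>t. (\<lambda>(t, x). u t x) (t, 0))"
    by (rule continuous_on_compose2[OF contu]) (auto intro!: continuous_intros)
  then have "compact ((\<lambda>t. u t 0) ` {0..T})" by (intro compact_continuous_image) auto
  then have "bounded ((\<lambda>t. u t 0) ` {0..T})" by (rule compact_imp_bounded)
  then obtain C0 where C0': "\<forall>y\<in>(\<lambda>t. u t 0) ` {0..T}. \<bar>y\<bar> \<le> C0"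
    unfolding bounded_real by blast
  have C0: "\<bar>u t 0\<bar> \<le> C0" if "t \<in> {0..T}" for t
    using C0' imageI[OF that, of "\<lambda>t. u t 0"] by blast
  have "(SUP t\<in>{0..T}. deriv_sobolev_norm_sq 1 s (u t)) < \<infinity>"
    using reg unfolding regularity_sq_def by (rule le_less_trans[rotated]) simp
  then obtain B where B: "(SUP t\<in>{0..T}. deriv_sobolev_norm_sq 1 s (u t)) = ennreal B" "0 \<le> B"
    by (metis ennreal_cases infinity_ennreal_def less_irrefl)
  have diff: "\<bar>u t y - u t x\<bar> \<le> (1 + (y - x)) * ((B + 1) + 5 * pi)" if t: "t \<in> {0..T}" and "x \<le> y" for t x y
  proof -
    have "deriv_sobolev_norm_sq 1 s (u t) \<le> ennreal B"
      unfolding B(1)[symmetric] by (rule SUP_upper[OF t])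
    \<comment> \<open>The infima over weak derivatives and over transforms need not be attained; a
      strict bound provides actual representatives below it.\<close>
    also have "\<dots> < ennreal (B + 1)" using B(2) by (simp add: ennreal_less_iff)
    finally obtain g where g: "weak_deriv 1 (u t) g" "sobolev_norm_sq s g < ennreal (B + 1)"
      unfolding deriv_sobolev_norm_sq_def INF_less_iff by auto
    then obtain h where h: "has_fourier g h"
      "(\<integral>\<^sup>+\<xi>. ennreal ((1 + \<xi>\<^sup>2) powr s * (cmod (h \<xi>))\<^sup>2) \<partial>lborel) < ennreal (B + 1)"
      unfolding sobolev_norm_sq_def INF_less_iff by auto
    have "(\<integral>\<^sup>+\<xi>. ennreal ((cmod (h \<xi>))\<^sup>2) \<partial>lborel) \<le>
        (\<integral>\<^sup>+\<xi>. ennreal ((1 + \<xi>\<^sup>2) powr s * (cmod (h \<xi>))\<^sup>2) \<partial>lborel)"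
    proof (intro nn_integral_mono ennreal_leI)
      fix \<xi> :: real
      have "1 \<le> (1 + \<xi>\<^sup>2) powr s" using s by (intro ge_one_powr_ge_zero) auto
      then show "(cmod (h \<xi>))\<^sup>2 \<le> (1 + \<xi>\<^sup>2) powr s * (cmod (h \<xi>))\<^sup>2"
        using mult_right_mono[of 1 "(1 + \<xi>\<^sup>2) powr s" "(cmod (h \<xi>))\<^sup>2"] by simp
    qed
    with h(2) have "(\<integral>\<^sup>+\<xi>. ennreal ((cmod (h \<xi>))\<^sup>2) \<partial>lborel) \<le> ennreal (B + 1)" by simp
    then show ?thesis
      using weak_deriv_growth[OF contx[OF t] g(1) h(1) _ _ \<open>x \<le> y\<close>] B(2) by simp
  qed
  let ?D = "(B + 1) + 5 * pi"
  have D: "0 \<le> ?D" using B(2) by simp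
  show thesis
  proof (rule that[of "\<bar>C0\<bar> + ?D"])
    fix t x assume t: "t \<in> {0..T}"
    have "\<bar>u t x - u t 0\<bar> \<le> (1 + \<bar>x\<bar>) * ?D"
    proof (cases "0 \<le> x")
      case True
      then show ?thesis using diff[OF t True] by simp
    next
      case False
      then show ?thesis using diff[OF t, of x 0] by (simp add: abs_minus_commute)
    qed
    moreover have "\<bar>u t 0\<bar> \<le> (1 + \<bar>x\<bar>) * \<bar>C0\<bar>"
    proof -
      have "\<bar>C0\<bar> * 1 \<le> \<bar>C0\<bar> * (1 + \<bar>x\<bar>)" by (intro mult_left_mono) auto
      then show ?thesis using C0[OF t] unfolding mult.commute[of "1 + \<bar>x\<bar>"] by linarith
    qed
    ultimately have "\<bar>u t x\<bar> \<le> (1 + \<bar>x\<bar>) * \<bar>C0\<bar> + (1 + \<bar>x\<bar>) * ?D" by linarith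
    then show "\<bar>u t x\<bar> \<le> (\<bar>C0\<bar> + ?D) * (1 + \<bar>x\<bar>)"
      by (simp add: algebra_simps)
  qed
qed

section \<open>The jump of the second derivative\<close>

text \<open>The means of passing from almost every time to every time: a continuous function that is
  nonzero once is nonzero on an interval of positive length.\<close>

lemma nonzero_on_interval:
  fixes F :: "real \<Rightarrow> real"
  assumes F: "continuous_on {0<..} F" and t: "0 < t" "t < T" and nz: "F t \<noteq> 0"
  obtains a b where "0 < a" "a < b" "b < T" "\<And>s. s \<in> {a..b} \<Longrightarrow> F s \<noteq> 0"
proof -
  have "isCont F t" using F t(1) by (simp add: continuous_on_eq_continuous_at)
  then have "(F \<longlongrightarrow> F t) (nhds t)"
    unfolding isCont_def tendsto_at_iff_tendsto_nhds .
  then have "eventually (\<lambda>s. F s \<noteq> 0) (nhds t)"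
    using nz by (rule tendsto_imp_eventually_ne)
  then obtain d where d: "0 < d" "\<And>s. dist s t < d \<Longrightarrow> F s \<noteq> 0"
    by (auto simp: eventually_nhds_metric)
  define e where "e = min (d / 2) (min (t / 2) ((T - t) / 2))"
  have e: "0 < e" "e < d" "e < t" "e < T - t"
    using d t by (auto simp: e_def min_def)
  show thesis
    by (rule that[of "t - e" "t + e"]) (use e d(2) in \<open>auto simp: dist_real_def\<close>)
qed

text \<open>In the variable \<open>\<sigma> = exp (- w\<^sup>2 / 2)\<close> the hypothesis says that all moments vanish.\<close>

lemma gaussian_moments_zero:
  fixes f :: "real \<Rightarrow> real"
  assumes f: "continuous_on {0..} f" and bound: "\<And>w. 0 \<le> w \<Longrightarrow> \<bar>f w\<bar> \<le> B"
    and const: "\<And>w. N \<le> w \<Longrightarrow> f w = d"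
    and mom: "\<And>n. (LINT w|lborel. indicat_real {0..} w * (exp (- w\<^sup>2 / 2) ^ Suc n * f w)) = 0"
    and w0: "0 < w0"
  shows "f w0 = 0"
proof -
  let ?i = "indicat_real {0..}" and ?r = "\<lambda>w::real. exp (- w\<^sup>2 / 2)"
  have B0: "0 \<le> B" using bound[of 0] by simp
  have fm: "(\<lambda>w. ?i w * f w) \<in> borel_measurable borel"
    using borel_measurable_continuous_on_indicator[OF _ f] by simp
  have rint: "integrable lborel ?r"
  proof -
    have "integrable lborel (\<lambda>w. sqrt (2 * pi) * gauss w)" by simp
    then show ?thesis by (simp add: std_normal_density_def)
  qed
  \<comment> \<open>The function \<open>f\<close> in the variable \<open>\<sigma>\<close>, with
    \<open>w = sqrt (- 2 ln \<sigma>)\<close>. As \<open>f\<close> is eventually constant, the value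
    \<open>d\<close> at \<open>\<sigma> \<le> 0\<close> extends it continuously; \<open>max\<close>
    only concerns \<open>\<sigma> > 1\<close>.\<close>
  define \<Phi> where "\<Phi> \<sigma> = (if \<sigma> \<le> 0 then d else f (sqrt (max 0 (- 2 * ln \<sigma>))))" for \<sigma>
  have \<Phi>r: "\<Phi> (?r w) = f w" if "0 \<le> w" for w using that by (simp add: \<Phi>_def)
  define K where "K = max N 0"
  have \<Phi>small: "\<Phi> \<sigma> = d" if "\<sigma> < ?r K" for \<sigma>
  proof (cases "\<sigma> \<le> 0")
    case False
    then have "ln \<sigma> < - K\<^sup>2 / 2" using that by (metis ln_exp ln_less_cancel_iff exp_gt_zero not_le)
    then have "K\<^sup>2 \<le> max 0 (- 2 * ln \<sigma>)" by simp
    then have "K \<le> sqrt (max 0 (- 2 * ln \<sigma>))" by (rule real_le_rsqrt)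
    then show ?thesis using False const by (simp add: \<Phi>_def K_def)
  qed (simp add: \<Phi>_def)
  have cont1: "continuous_on {..<?r K} \<Phi>"
    by (rule continuous_on_eq[of _ "\<lambda>_. d"]) (auto simp: \<Phi>small)
  have cont2: "continuous_on {0<..} \<Phi>"
  proof -
    have "continuous_on {0<..} (\<lambda>\<sigma>. f (sqrt (max 0 (- 2 * ln \<sigma>))))"
      by (rule continuous_on_compose2[OF f]) (auto intro!: continuous_intros)
    then show ?thesis by (rule continuous_on_eq) (auto simp: \<Phi>_def)
  qed
  have "continuous_on ({..<?r K} \<union> {0<..}) \<Phi>"
    by (rule continuous_on_open_Un[OF _ _ cont1 cont2]) auto
  moreover have "{..<?r K} \<union> {0<..} = UNIV" using exp_gt_zero[of "- K\<^sup>2 / 2"] by (auto simp: not_less) (metis exp_gt_zero less_le_trans not_less)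
  ultimately have cont\<Phi>: "continuous_on {0..1} \<Phi>" by (metis continuous_on_subset subset_UNIV)
  have fb: "\<bar>?i w * f w\<bar> \<le> B" for w using bound[of w] B0 by (simp add: indicator_def)
  have int_gen: "integrable lborel (\<lambda>w. ?r w * ((?i w * f w) * g w))"
    if "g \<in> borel_measurable borel" "\<And>w. 0 \<le> w \<Longrightarrow> \<bar>g w\<bar> \<le> A" "0 \<le> A" for g A
  proof (rule Bochner_Integration.integrable_bound)
    show "integrable lborel (\<lambda>w. (B * A) * ?r w)" by (intro integrable_mult_right rint)
    show "(\<lambda>w. ?r w * ((?i w * f w) * g w)) \<in> borel_measurable lborel"
      using fm that(1) by measurable
    show "AE w in lborel. norm (?r w * ((?i w * f w) * g w)) \<le> norm ((B * A) * ?r w)"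
    proof (rule AE_I2)
      fix w
      have "\<bar>(?i w * f w) * g w\<bar> \<le> B * A"
      proof (cases "0 \<le> w")
        case True
        then show ?thesis unfolding abs_mult[of _ "g w"] by (intro mult_mono fb that) (auto simp: B0)
      next
        case False
        then show ?thesis using B0 that(3) by simp
      qed
      from mult_left_mono[OF this, of "?r w"]
      show "norm (?r w * ((?i w * f w) * g w)) \<le> norm ((B * A) * ?r w)"
        using B0 that(3) by (simp add: abs_mult mult.commute)
    qed
  qed
  have ff: "(?i w * f w) * (?i w * f w) = (?i w * f w) * f w" for w by (simp add: indicator_def)
  have int2: "integrable lborel (\<lambda>w. ?r w * ((?i w * f w) * (?i w * f w)))"
    by (rule int_gen[OF fm _ B0]) (use fb in blast)
  let ?R = "LINT w|lborel. ?r w"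
  have R0: "0 \<le> ?R" by (rule Bochner_Integration.integral_nonneg) simp
  \<comment> \<open>By Weierstrass, a polynomial in \<open>\<sigma>\<close> approximates
    \<open>f\<close> up to \<open>e\<close>. Its pairing with \<open>f\<close> vanishes by the
    moment conditions, so one factor \<open>f\<close> in the weighted integral of \<open>f^2\<close>
    may be replaced by the error. The moments start at exponent 1 because one power of
    \<open>\<sigma>\<close> is the integrable weight.\<close>
  have le: "(LINT w|lborel. ?r w * ((?i w * f w) * (?i w * f w))) \<le> e * (B * ?R)" if e: "0 < e" for e
  proof -
    obtain p where p: "real_polynomial_function p" "\<And>x. x \<in> {0..1} \<Longrightarrow> \<bar>\<Phi> x - p x\<bar> < e"
      using Stone_Weierstrass_real_polynomial_function[OF compact_Icc cont\<Phi> e] by metis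
    then obtain a m where pa: "p = (\<lambda>x. \<Sum>i\<le>m. a i * x ^ i)"
      using real_polynomial_function_iff_sum by metis
    have r01: "?r w \<in> {0..1}" for w by simp
    have int_pow: "integrable lborel (\<lambda>w. ?r w * ((?i w * f w) * (a i * ?r w ^ i)))" for i
    proof (rule int_gen[of "\<lambda>w. a i * ?r w ^ i" "\<bar>a i\<bar>"])
      show "\<bar>a i * ?r w ^ i\<bar> \<le> \<bar>a i\<bar>" for w
        using r01[of w] by (simp add: abs_mult mult_left_le power_le_one)
    qed auto
    have eqp: "?r w * ((?i w * f w) * p (?r w)) = (\<Sum>i\<le>m. ?r w * ((?i w * f w) * (a i * ?r w ^ i)))" for w
      by (simp add: pa sum_distrib_left)
    have "(LINT w|lborel. ?r w * ((?i w * f w) * p (?r w))) =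
        (\<Sum>i\<le>m. LINT w|lborel. ?r w * ((?i w * f w) * (a i * ?r w ^ i)))"
      unfolding eqp by (rule Bochner_Integration.integral_sum) (rule int_pow)
    also have "\<dots> = (\<Sum>i\<le>m. a i * (LINT w|lborel. ?i w * (?r w ^ Suc i * f w)))"
    proof (rule sum.cong[OF refl])
      fix i
      have "(\<lambda>w. ?r w * ((?i w * f w) * (a i * ?r w ^ i))) = (\<lambda>w. a i * (?i w * (?r w ^ Suc i * f w)))"
        by (intro ext) simp
      then show "(LINT w|lborel. ?r w * ((?i w * f w) * (a i * ?r w ^ i))) =
          a i * (LINT w|lborel. ?i w * (?r w ^ Suc i * f w))"
        by (simp only: integral_mult_right_zero)
    qed
    also have "\<dots> = 0" by (simp only: mom) simp
    finally have zero: "(LINT w|lborel. ?r w * ((?i w * f w) * p (?r w))) = 0" .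
    have intp: "integrable lborel (\<lambda>w. ?r w * ((?i w * f w) * p (?r w)))"
      unfolding eqp by (rule Bochner_Integration.integrable_sum) (rule int_pow)
    have "(LINT w|lborel. ?r w * ((?i w * f w) * (?i w * f w))) =
        (LINT w|lborel. ?r w * ((?i w * f w) * (?i w * f w)) - ?r w * ((?i w * f w) * p (?r w)))"
      by (simp only: Bochner_Integration.integral_diff[OF int2 intp] zero diff_zero)
    also have "\<dots> \<le> (LINT w|lborel. (e * B) * ?r w)"
    proof (rule integral_mono)
      show "integrable lborel (\<lambda>w. ?r w * ((?i w * f w) * (?i w * f w)) - ?r w * ((?i w * f w) * p (?r w)))"
        by (rule Bochner_Integration.integrable_diff[OF int2 intp])
      show "integrable lborel (\<lambda>w. (e * B) * ?r w)" by (intro integrable_mult_right rint)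
      fix w
      have "?r w * ((?i w * f w) * (?i w * f w)) - ?r w * ((?i w * f w) * p (?r w)) =
          ?r w * ((?i w * f w) * (f w - p (?r w)))"
        unfolding ff by (simp add: right_diff_distrib)
      also have "\<dots> \<le> ?r w * (B * e)"
      proof (rule mult_left_mono)
        show "(?i w * f w) * (f w - p (?r w)) \<le> B * e"
        proof (cases "0 \<le> w")
          case True
          have "\<bar>f w - p (?r w)\<bar> \<le> e" using p(2)[OF r01[of w]] \<Phi>r[OF True] by simp
          then have "\<bar>?i w * f w\<bar> * \<bar>f w - p (?r w)\<bar> \<le> B * e" by (intro mult_mono fb) (auto simp: B0)
          then show ?thesis by (simp add: abs_mult[symmetric] abs_le_iff)
        next
          case False
          then show ?thesis using B0 e by simp
        qed
      qed simp
      finally show "?r w * ((?i w * f w) * (?i w * f w)) - ?r w * ((?i w * f w) * p (?r w)) \<le> (e * B) * ?r w"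
        by (simp add: mult_ac)
    qed
    also have "\<dots> = e * (B * ?R)" by (simp only: integral_mult_right_zero mult.assoc)
    finally show ?thesis .
  qed
  have le0: "(LINT w|lborel. ?r w * ((?i w * f w) * (?i w * f w))) \<le> 0"
  proof (rule field_le_epsilon)
    fix \<epsilon> :: real assume "0 < \<epsilon>"
    define e where "e = \<epsilon> / (B * ?R + 1)"
    have BR: "0 < B * ?R + 1" using B0 R0 by (simp add: add_nonneg_pos)
    then have "0 < e" using \<open>0 < \<epsilon>\<close> by (simp add: e_def)
    have "e * (B * ?R) \<le> e * (B * ?R + 1)" using \<open>0 < e\<close> by simp
    also have "\<dots> = \<epsilon>" using BR by (simp add: e_def)
    finally show "(LINT w|lborel. ?r w * ((?i w * f w) * (?i w * f w))) \<le> 0 + \<epsilon>"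
      using le[OF \<open>0 < e\<close>] by simp
  qed
  let ?q = "\<lambda>w. ?r w * (f w * f w)"
  have cq: "continuous_on {0..2 * w0} ?q"
    by (intro continuous_intros continuous_on_subset[OF f]) auto
  have "integral {0..2 * w0} ?q = (LINT w:{0..2 * w0}|lborel. ?q w)"
    by (rule set_borel_integral_eq_integral(2)[symmetric], rule borel_integrable_atLeastAtMost'[OF cq])
  also have "\<dots> \<le> (LINT w|lborel. ?r w * ((?i w * f w) * (?i w * f w)))"
    unfolding set_lebesgue_integral_def
  proof (rule integral_mono)
    show "integrable lborel (\<lambda>w. indicat_real {0..2 * w0} w *\<^sub>R ?q w)"
      using borel_integrable_atLeastAtMost'[OF cq] by (simp add: set_integrable_def)
    show "indicat_real {0..2 * w0} w *\<^sub>R ?q w \<le> ?r w * ((?i w * f w) * (?i w * f w))" for w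
      by (auto simp: indicator_def)
  qed (rule int2)
  finally have "integral {0..2 * w0} ?q \<le> 0" using le0 by simp
  moreover have "0 \<le> integral {0..2 * w0} ?q"
    by (intro integral_nonneg integrable_continuous_real cq) simp
  ultimately have "(?q has_integral 0) (cbox 0 (2 * w0))"
    using integrable_integral[OF integrable_continuous_real[OF cq]] by simp
  then have "?q w0 = 0"
    by (intro has_integral_0_cbox_imp_0[of 0 "2 * w0" ?q w0]) (use w0 cq in auto)
  then show ?thesis by simp
qed

section \<open>The trace at the interface and the condition on the datum\<close>

context interface_problem
begin

text \<open>The one-sided limits of the second derivative are \<open>sol_t t 0\<close> and half of
  it, which agree only if both vanish. The function is compared with \<open>sol\<close> off 0 alone,
  so the criterion covers the unknown solution and the explicit formula alike.\<close>

lemma second_deriv_matches_iff: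
  assumes t: "0 < t" and f: "\<And>x. x \<noteq> 0 \<Longrightarrow> f x = sol t x"
  shows "second_deriv_matches f \<longleftrightarrow> sol_t t 0 = 0"
proof -
  have ev: "eventually (\<lambda>y. y \<noteq> 0) (nhds x)" if "x \<noteq> (0 :: real)" for x
    using that by (rule t1_space_nhds)
  have d1: "deriv f x = sol_x t x" if "x \<noteq> 0" for x
  proof (rule DERIV_imp_deriv)
    show "(f has_real_derivative sol_x t x) (at x)"
      by (rule has_field_derivative_transform_within_open[OF DERIV_sol_x[OF t], of "- {0}"])
         (use that f in auto)
  qed
  have d2: "(deriv ^^ 2) f x = sol_t t x / coeff_a x" if "x \<noteq> 0" for x
  proof -
    have "(deriv f has_real_derivative sol_t t x / coeff_a x) (at x)"
      by (rule has_field_derivative_transform_within_open[OF DERIV_sol_xx[OF t that], of "- {0}"])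
         (use that d1 in auto)
    then show ?thesis by (simp add: numeral_2_eq_2 DERIV_imp_deriv)
  qed
  have c: "(sol_t t \<longlongrightarrow> sol_t t 0) (at 0)"
    using continuous_on_sol_slices(3)[OF t, of UNIV] by (simp add: continuous_on_eq_continuous_at isCont_def)
  have l: "((deriv ^^ 2) f \<longlongrightarrow> sol_t t 0) (at_left 0)"
  proof (rule Lim_transform_eventually)
    show "(sol_t t \<longlongrightarrow> sol_t t 0) (at_left 0)" using c by (rule filterlim_mono) (auto simp: at_le)
    show "eventually (\<lambda>x. sol_t t x = (deriv ^^ 2) f x) (at_left 0)"
      by (auto simp: eventually_at_left_field d2 coeff_a_def intro!: exI[of _ "-1"])
  qed
  have r: "((deriv ^^ 2) f \<longlongrightarrow> sol_t t 0 / 2) (at_right 0)"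
  proof (rule Lim_transform_eventually)
    have "(sol_t t \<longlongrightarrow> sol_t t 0) (at_right 0)" using c by (rule filterlim_mono) (auto simp: at_le)
    then show "((\<lambda>x. sol_t t x / 2) \<longlongrightarrow> sol_t t 0 / 2) (at_right 0)" by (intro tendsto_intros) auto
    show "eventually (\<lambda>x. sol_t t x / 2 = (deriv ^^ 2) f x) (at_right 0)"
      by (auto simp: eventually_at_right_field d2 coeff_a_def intro!: exI[of _ "1"])
  qed
  show ?thesis
  proof
    assume "second_deriv_matches f"
    then obtain m where m: "((deriv ^^ 2) f \<longlongrightarrow> m) (at_left 0)" "((deriv ^^ 2) f \<longlongrightarrow> m) (at_right 0)"
      by (auto simp: second_deriv_matches_def)
    have "m = sol_t t 0" "m = sol_t t 0 / 2"
      using tendsto_unique[OF _ m(1) l] tendsto_unique[OF _ m(2) r] by auto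
    then show "sol_t t 0 = 0" by simp
  next
    assume "sol_t t 0 = 0"
    then show "second_deriv_matches f"
      using l r by (auto simp: second_deriv_matches_def)
  qed
qed

text \<open>A nonzero time derivative at the interface persists on a time interval. At each of its
  times the second derivative has a jump, hence infinite \<open>H^s\<close> norm for
  \<open>s \<ge> 1/2\<close>, and the time integral in the regularity norm diverges.\<close>

lemma regular_imp_no_jump:
  assumes T: "0 < T" and u: "\<And>t x. t \<in> {0<..T} \<Longrightarrow> u t x = sol t x"
    and reg: "regularity_sq s T u < \<infinity>" and s: "1 / 2 \<le> s" and t: "0 < t" "t < T"
  shows "sol_t t 0 = 0"
proof (rule ccontr)
  assume "sol_t t 0 \<noteq> 0"
  then obtain a b where ab: "0 < a" "a < b" "b < T" "\<And>\<tau>. \<tau> \<in> {a..b} \<Longrightarrow> sol_t \<tau> 0 \<noteq> 0"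
    using nonzero_on_interval[OF continuous_on_sol_slices(6) t] by metis
  have inf: "deriv_sobolev_norm_sq 2 s (u \<tau>) = \<infinity>" if "\<tau> \<in> {a..b}" for \<tau>
  proof (rule ccontr)
    assume "deriv_sobolev_norm_sq 2 s (u \<tau>) \<noteq> \<infinity>"
    then have "deriv_sobolev_norm_sq 2 s (u \<tau>) < \<infinity>" by (simp add: less_top)
    then obtain g where g: "weak_deriv 2 (u \<tau>) g" "sobolev_norm_sq s g < \<infinity>"
      unfolding deriv_sobolev_norm_sq_def INF_less_iff by auto
    then obtain h where h: "has_fourier g h"
      "(\<integral>\<^sup>+\<xi>. ennreal ((1 + \<xi>\<^sup>2) powr s * (cmod (h \<xi>))\<^sup>2) \<partial>lborel) < \<infinity>"
      unfolding sobolev_norm_sq_def INF_less_iff by auto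
    have \<tau>: "0 < \<tau>" "\<tau> \<in> {0<..T}" using that ab by auto
    have "u \<tau> = sol \<tau>" using u[OF \<tau>(2)] by blast
    then have weak: "weak_deriv 2 (sol \<tau>) g" using g(1) by simp
    let ?s = "\<lambda>n. inverse (real (Suc n))"
    have s0: "0 < ?s n" for n by simp
    have lim: "(\<lambda>n. (sol_x \<tau> (?s n) - 2 * sol_x \<tau> 0 + sol_x \<tau> (- ?s n)) / ?s n) \<longlonglongrightarrow> 0"
      by (rule half_derivative_no_jump[OF DERIV_sol_x[OF \<tau>(1)] continuous_on_sol_slices(2)[OF \<tau>(1)]
          weak h s s0 LIMSEQ_inverse_real_of_nat])
    have r: "(\<lambda>n. (right_x \<tau> (?s n) - right_x \<tau> 0) / ?s n) \<longlonglongrightarrow> right heat_t \<tau> 0 / 2"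
    proof -
      have *: "((\<lambda>y. (right_x \<tau> y - right_x \<tau> 0) / (y - 0)) \<longlongrightarrow> right heat_t \<tau> 0 / 2) (at 0)"
        using DERIV_branches(4)[OF \<tau>(1), of 0] by (simp add: has_field_derivative_iff)
      have "filterlim ?s (at 0) sequentially"
        unfolding filterlim_at by (intro conjI LIMSEQ_inverse_real_of_nat) (simp add: eventually_sequentially)
      from filterlim_compose[OF * this] show ?thesis by simp
    qed
    have l: "(\<lambda>n. (left_x \<tau> (- ?s n) - left_x \<tau> 0) / (- ?s n)) \<longlonglongrightarrow> left heat_t \<tau> 0"
    proof -
      have *: "((\<lambda>y. (left_x \<tau> y - left_x \<tau> 0) / (y - 0)) \<longlongrightarrow> left heat_t \<tau> 0) (at 0)"
        using DERIV_branches(3)[OF \<tau>(1), of 0] by (simp add: has_field_derivative_iff)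
      have "(\<lambda>n. - ?s n) \<longlonglongrightarrow> - 0" by (intro tendsto_minus LIMSEQ_inverse_real_of_nat)
      then have "filterlim (\<lambda>n. - ?s n) (at 0) sequentially"
        unfolding filterlim_at by (simp add: eventually_sequentially)
      from filterlim_compose[OF * this] show ?thesis by simp
    qed
    \<comment> \<open>The symmetric second difference of the slope is the difference of the two
      one-sided quotients; their limits are \<open>u_xx\<close> at \<open>0+\<close> and at
      \<open>0-\<close>, that is, half of the time derivative and the full one.\<close>
    have eq: "(sol_x \<tau> (?s n) - 2 * sol_x \<tau> 0 + sol_x \<tau> (- ?s n)) / ?s n =
        (right_x \<tau> (?s n) - right_x \<tau> 0) / ?s n - (left_x \<tau> (- ?s n) - left_x \<tau> 0) / (- ?s n)" for n
    proof -
      have "(A - 2 * X + L) / q = (A - X) / q - (L - X) / (- q)" if "0 < q" for A X L q :: real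
        using that by (simp add: field_simps)
      moreover have "\<not> ?s n < 0" "- ?s n < 0" using s0[of n] by linarith+
      ultimately show ?thesis by (simp only: sol_x_def left_right_x_0 s0 if_True if_False less_irrefl)
    qed
    have "(\<lambda>n. (right_x \<tau> (?s n) - right_x \<tau> 0) / ?s n - (left_x \<tau> (- ?s n) - left_x \<tau> 0) / (- ?s n))
        \<longlonglongrightarrow> right heat_t \<tau> 0 / 2 - left heat_t \<tau> 0"
      by (rule tendsto_diff[OF r l])
    then have "(\<lambda>n. (sol_x \<tau> (?s n) - 2 * sol_x \<tau> 0 + sol_x \<tau> (- ?s n)) / ?s n) \<longlonglongrightarrow>
        right heat_t \<tau> 0 / 2 - left heat_t \<tau> 0"
      by (simp only: eq)
    from LIMSEQ_unique[OF lim this] have "right heat_t \<tau> 0 = 0" by (simp add: left_right_0)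
    then have "sol_t \<tau> 0 = 0" by (simp add: sol_t_def)
    then show False using ab(4)[OF that] by simp
  qed
  have "(\<integral>\<^sup>+t. \<infinity> * indicator {a..b} t \<partial>lborel) \<le>
      (\<integral>\<^sup>+t. deriv_sobolev_norm_sq 2 s (u t) * indicator {0..T} t \<partial>lborel)"
  proof (rule nn_integral_mono)
    show "\<infinity> * indicator {a..b} t \<le> deriv_sobolev_norm_sq 2 s (u t) * indicator {0..T} t" for t
      using inf[of t] ab by (auto simp: indicator_def)
  qed
  moreover have "(\<integral>\<^sup>+t. \<infinity> * indicator {a..b} t \<partial>lborel) = (\<infinity> :: ennreal)"
    using ab by (subst nn_integral_cmult_indicator) (auto simp: ennreal_top_mult)
  ultimately have "(\<integral>\<^sup>+t. deriv_sobolev_norm_sq 2 s (u t) * indicator {0..T} t \<partial>lborel) = \<infinity>"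
    by (simp add: top_unique)
  then have "regularity_sq s T u = \<infinity>" by (simp add: regularity_sq_def)
  then show False using reg by simp
qed

text \<open>At the interface direct and reflected parts coincide, so the coefficients combine to
  \<open>1 + (3 - 2 sqrt 2) = 4 - 2 sqrt 2\<close>, and the right half contributes
  \<open>(2 - sqrt 2) sqrt 2 = 2 sqrt 2 - 2\<close>. In this form time enters only through the scale
  \<open>sqrt (2 * t)\<close> inside the datum.\<close>

lemma sol_at_interface:
  assumes t: "0 < t"
  shows "sol t 0 = (LINT w|lborel. gauss w * (indicat_real {0..} w *
    ((4 - 2 * sqrt 2) * u0 (- (sqrt (2 * t) * w)) + (2 * sqrt 2 - 2) * u0 (sqrt 2 * (sqrt (2 * t) * w)))))"
proof -
  let ?q = "sqrt (2 * t)" and ?i = "indicat_real {0..}"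
  have q: "0 < ?q" using t by simp
  obtain B where B: "0 \<le> B" "\<And>x. \<bar>u0 x\<bar> \<le> B" using u0_bound by blast
  have um [measurable]: "u0 \<in> borel_measurable borel"
    by (intro borel_measurable_continuous_onI cont_u0)
  have L: "PL heat t 0 = (LINT w|lborel. gauss w * (?i w * u0 (- (?q * w))))"
  proof -
    have "PL heat t 0 = (LINT z|lborel. gauss z * (indicat_real {-M..0} (- (?q * z)) * u0 (- (?q * z))))"
      using potential_heat_gauss[OF cont_u0 t, of 1 "-M" 0 0] by (simp add: PL_def)
    also have "(\<lambda>z. gauss z * (indicat_real {-M..0} (- (?q * z)) * u0 (- (?q * z)))) =
        (\<lambda>w. gauss w * (?i w * u0 (- (?q * w))))"
    proof
      fix z
      show "gauss z * (indicat_real {-M..0} (- (?q * z)) * u0 (- (?q * z))) = gauss z * (?i z * u0 (- (?q * z)))"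
      proof (cases "M \<le> \<bar>?q * z\<bar>")
        case True
        then have "u0 (- (?q * z)) = 0" by (intro supp) simp
        then show ?thesis by simp
      next
        case False
        then show ?thesis
          using q by (auto simp: indicator_def zero_le_mult_iff abs_if split: if_splits)
      qed
    qed
    finally show ?thesis .
  qed
  have R: "PR heat t 0 = sqrt 2 * (LINT w|lborel. gauss w * (?i w * u0 (sqrt 2 * (?q * w))))"
  proof -
    have "PR heat t 0 = 1 / (1 / sqrt 2) * (LINT z|lborel. gauss z *
        (indicat_real {0..M} ((0 - ?q * z) / (1 / sqrt 2)) * u0 ((0 - ?q * z) / (1 / sqrt 2))))"
      unfolding PR_def by (rule potential_heat_gauss[OF cont_u0 t]) simp
    also have "(LINT z|lborel. gauss z *
        (indicat_real {0..M} ((0 - ?q * z) / (1 / sqrt 2)) * u0 ((0 - ?q * z) / (1 / sqrt 2)))) =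
        \<bar>- 1\<bar> *\<^sub>R (LINT w|lborel. gauss (0 + (- 1) * w) *
        (indicat_real {0..M} ((0 - ?q * (0 + (- 1) * w)) / (1 / sqrt 2)) * u0 ((0 - ?q * (0 + (- 1) * w)) / (1 / sqrt 2))))"
      by (rule lborel_integral_real_affine) simp
    also have "(\<lambda>w. gauss (0 + (- 1) * w) *
        (indicat_real {0..M} ((0 - ?q * (0 + (- 1) * w)) / (1 / sqrt 2)) * u0 ((0 - ?q * (0 + (- 1) * w)) / (1 / sqrt 2)))) =
        (\<lambda>w. gauss w * (?i w * u0 (sqrt 2 * (?q * w))))"
    proof
      fix w
      have g: "gauss (0 + (- 1) * w) = gauss w" by (simp add: std_normal_density_def)
      have e: "(0 - ?q * (0 + (- 1) * w)) / (1 / sqrt 2) = sqrt 2 * (?q * w)" by simp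
      have "indicat_real {0..M} (sqrt 2 * (?q * w)) * u0 (sqrt 2 * (?q * w)) = ?i w * u0 (sqrt 2 * (?q * w))"
      proof (cases "M \<le> \<bar>sqrt 2 * (?q * w)\<bar>")
        case True
        then have "u0 (sqrt 2 * (?q * w)) = 0" by (rule supp)
        then show ?thesis by simp
      next
        case False
        then show ?thesis
          using q by (auto simp: indicator_def zero_le_mult_iff abs_if split: if_splits)
      qed
      then show "gauss (0 + (- 1) * w) *
        (indicat_real {0..M} ((0 - ?q * (0 + (- 1) * w)) / (1 / sqrt 2)) * u0 ((0 - ?q * (0 + (- 1) * w)) / (1 / sqrt 2))) =
        gauss w * (?i w * u0 (sqrt 2 * (?q * w)))"
        unfolding g e by simp
    qed
    finally show ?thesis by simp
  qed
  have int: "integrable lborel (\<lambda>w. gauss w * (?i w * u0 (c * (?q * w))))" for c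
  proof (rule Bochner_Integration.integrable_bound[of _ "\<lambda>w. B * gauss w"])
    show "AE w in lborel. norm (gauss w * (?i w * u0 (c * (?q * w)))) \<le> norm (B * gauss w)"
    proof (rule AE_I2)
      fix w
      have "\<bar>?i w * u0 (c * (?q * w))\<bar> \<le> B" using B by (simp add: indicator_def)
      from mult_left_mono[OF this, of "gauss w"]
      show "norm (gauss w * (?i w * u0 (c * (?q * w)))) \<le> norm (B * gauss w)"
        using B(1) by (simp add: abs_mult normal_density_nonneg mult.commute)
    qed
  qed auto
  have "sol t 0 = (4 - 2 * sqrt 2) * PL heat t 0 + (2 - sqrt 2) * PR heat t 0"
    by (simp add: sol_def left_right_0[symmetric] left_def algebra_simps)
  also have "\<dots> = (4 - 2 * sqrt 2) * (LINT w|lborel. gauss w * (?i w * u0 ((- 1) * (?q * w)))) +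
      (2 * sqrt 2 - 2) * (LINT w|lborel. gauss w * (?i w * u0 (sqrt 2 * (?q * w))))"
  proof -
    have "(2 - sqrt 2) * (sqrt 2 * a) = (2 * sqrt 2 - 2) * a" for a :: real
      using sqrt2(1) by (simp add: algebra_simps)
    then show ?thesis by (simp only: L R) simp
  qed
  also have "\<dots> = (LINT w|lborel. (4 - 2 * sqrt 2) * (gauss w * (?i w * u0 ((- 1) * (?q * w)))) +
      (2 * sqrt 2 - 2) * (gauss w * (?i w * u0 (sqrt 2 * (?q * w)))))"
    by (simp only: integral_mult_right_zero Bochner_Integration.integral_add[OF
          integrable_mult_right[OF int] integrable_mult_right[OF int]])
  finally show ?thesis by (simp add: algebra_simps)
qed

text \<open>The trace is constant in time. Subtracting a constant \<open>c'\<close> from the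
  combination of the two halves makes all its Gaussian means at the sampled times vanish, so by
  completeness the combination equals \<open>c'\<close> on the positive half-line; compact support
  of the datum then forces \<open>c' = 0\<close>.\<close>

lemma no_jump_imp_relation:
  assumes T: "0 < T" and J: "\<And>t. 0 < t \<Longrightarrow> t < T \<Longrightarrow> sol_t t 0 = 0" and z: "0 < z"
  shows "(4 - 2 * sqrt 2) * u0 (- z) + (2 * sqrt 2 - 2) * u0 (sqrt 2 * z) = 0"
proof -
  let ?i = "indicat_real {0..}"
  define k where "k z = (4 - 2 * sqrt 2) * u0 (- z) + (2 * sqrt 2 - 2) * u0 (sqrt 2 * z)" for z
  have contk: "continuous_on A k" for A
  proof -
    have c: "continuous_on A (\<lambda>z. u0 (c * z))" for c
      by (rule continuous_on_compose2[OF cont_u0[of UNIV]]) (auto intro!: continuous_intros)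
    show ?thesis unfolding k_def using c[of "-1"] c[of "sqrt 2"] by (auto intro!: continuous_intros)
  qed
  have ksupp: "k z = 0" if "M \<le> z" for z
  proof -
    have "1 * z \<le> sqrt 2 * z" using that M_pos by (intro mult_right_mono) auto
    then have "M \<le> \<bar>sqrt 2 * z\<bar>" using that by linarith
    then have "u0 (sqrt 2 * z) = 0" by (rule supp)
    moreover have "u0 (- z) = 0" using that M_pos by (intro supp) auto
    ultimately show ?thesis by (simp add: k_def)
  qed
  have "compact (k ` {0..M})" by (intro compact_continuous_image contk) auto
  then have "bounded (k ` {0..M})" by (rule compact_imp_bounded)
  then obtain B0 where B0: "\<forall>y\<in>k ` {0..M}. \<bar>y\<bar> \<le> B0" unfolding bounded_real by blast
  have kB: "\<bar>k z\<bar> \<le> max 0 B0" if "0 \<le> z" for z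
  proof (cases "M \<le> z")
    case False
    then have "k z \<in> k ` {0..M}" using that by (intro imageI) auto
    then show ?thesis using B0 by (auto simp: le_max_iff_disj)
  qed (simp add: ksupp)
  have [measurable]: "k \<in> borel_measurable borel" by (intro borel_measurable_continuous_onI contk)
  define c where "c = sol (T / 2) 0"
  have const: "sol t 0 = c" if t: "0 < t" "t < T" for t
  proof -
    have "\<exists>C. \<forall>t\<in>{0<..<T}. sol t 0 = C"
    proof (rule has_field_derivative_zero_constant)
      show "convex {0<..<T}" by (rule convex_real_interval)
      show "((\<lambda>t. sol t 0) has_real_derivative 0) (at t within {0<..<T})" if "t \<in> {0<..<T}" for t
        using has_field_derivative_at_within[OF DERIV_sol_t, of t 0 "{0<..<T}"] J[of t] that by simp
    qed
    then show ?thesis using t T by (auto simp: c_def)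
  qed
  \<comment> \<open>The Gaussian mass of the half-line. Dividing the constant trace by it gives the
    constant whose half-line Gaussian mean is this trace.\<close>
  define m0 where "m0 = (LINT w|lborel. gauss w * ?i w)"
  have gi_int: "integrable lborel (\<lambda>w. gauss w * indicat_real A w)" if "A \<in> sets borel" for A
    by (rule Bochner_Integration.integrable_bound[of _ gauss])
       (use that in \<open>auto simp: indicator_def normal_density_nonneg\<close>)
  have m0: "0 < m0"
  proof -
    have refl: "(LINT w|lborel. gauss w * indicat_real {..0} w) = m0"
    proof -
      have "(LINT w|lborel. gauss w * indicat_real {..0} w) =
          \<bar>- 1\<bar> *\<^sub>R (LINT w|lborel. gauss (0 + (- 1) * w) * indicat_real {..0} (0 + (- 1) * w))"
        by (rule lborel_integral_real_affine) simp
      then show ?thesis by (simp add: m0_def std_normal_density_def indicator_def)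
    qed
    have "1 = (LINT w|lborel. gauss w)" by simp
    also have "\<dots> \<le> (LINT w|lborel. gauss w * ?i w + gauss w * indicat_real {..0} w)"
    proof (rule integral_mono)
      show "integrable lborel (\<lambda>w. gauss w * ?i w + gauss w * indicat_real {..0} w)"
        by (rule Bochner_Integration.integrable_add[OF gi_int gi_int]) simp_all
      show "gauss w \<le> gauss w * ?i w + gauss w * indicat_real {..0} w" for w
        by (simp add: indicator_def normal_density_nonneg)
    qed simp
    also have "\<dots> = m0 + m0"
      by (subst Bochner_Integration.integral_add[OF gi_int gi_int]) (simp_all add: m0_def refl[unfolded m0_def])
    finally show ?thesis by simp
  qed
  define c' where "c' = c / m0"
  define q0 where "q0 = sqrt T"
  have q0: "0 < q0" using T by (simp add: q0_def)
  define f where "f w = k (q0 * w) - c'" for w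
  have "f w0 = 0" if w0: "0 < w0" for w0
  proof (rule gaussian_moments_zero[where f = f and B = "max 0 B0 + \<bar>c'\<bar>" and N = "M / q0" and d = "- c'"])
    show "continuous_on {0..} f"
      unfolding f_def by (intro continuous_intros continuous_on_compose2[OF contk[of UNIV]]) auto
    show "\<bar>f w\<bar> \<le> max 0 B0 + \<bar>c'\<bar>" if "0 \<le> w" for w
      using kB[of "q0 * w"] that q0 unfolding f_def by simp
    show "f w = - c'" if "M / q0 \<le> w" for w
      using ksupp[of "q0 * w"] that q0 by (simp add: f_def field_simps)
    show "0 < w0" by (rule w0)
    fix n :: nat
    define N where "N = real (Suc n)"
    have N: "0 < N" by (simp add: N_def)
    \<comment> \<open>Here \<open>sqrt (2 * t)\<close> is \<open>q0 / sqrt N\<close>, so stretching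
      \<open>w\<close> by \<open>sqrt N\<close> makes the argument of \<open>k\<close> independent
      of \<open>N\<close> and turns the Gaussian into an \<open>N\<close>-th power. The 2 in the
      denominator keeps \<open>t\<close> below \<open>T\<close> already for
      \<open>N = 1\<close>.\<close>
    define t where "t = T / (2 * N)"
    have t: "0 < t" "t < T" using T N by (auto simp: t_def N_def field_simps add_pos_nonneg)
    have q: "sqrt (2 * t) = q0 / sqrt N" using N by (simp add: t_def q0_def real_sqrt_divide)
    have "c' * m0 = c" using m0 by (simp add: c'_def)
    then have "0 = sol t 0 - c' * m0" using const[OF t] by simp
    also have "\<dots> = (LINT w|lborel. gauss w * (?i w * k (sqrt (2 * t) * w))) - (LINT w|lborel. c' * (gauss w * ?i w))"
      unfolding sol_at_interface[OF t(1)] k_def m0_def by simp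
    also have "\<dots> = (LINT w|lborel. gauss w * (?i w * k (sqrt (2 * t) * w)) - c' * (gauss w * ?i w))"
    proof (rule Bochner_Integration.integral_diff[symmetric])
      show "integrable lborel (\<lambda>w. gauss w * (?i w * k (sqrt (2 * t) * w)))"
      proof (rule Bochner_Integration.integrable_bound[of _ "\<lambda>w. max 0 B0 * gauss w"])
        show "AE w in lborel. norm (gauss w * (?i w * k (sqrt (2 * t) * w))) \<le> norm (max 0 B0 * gauss w)"
        proof (rule AE_I2)
          fix w
          have "\<bar>?i w * k (sqrt (2 * t) * w)\<bar> \<le> max 0 B0"
            using kB[of "sqrt (2 * t) * w"] t(1) by (auto simp: indicator_def)
          from mult_left_mono[OF this, of "gauss w"]
          show "norm (gauss w * (?i w * k (sqrt (2 * t) * w))) \<le> norm (max 0 B0 * gauss w)"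
            by (simp add: abs_mult normal_density_nonneg mult.commute)
        qed
      qed auto
      show "integrable lborel (\<lambda>w. c' * (gauss w * ?i w))"
        by (intro integrable_mult_right gi_int) simp
    qed
    also have "\<dots> = \<bar>sqrt N\<bar> *\<^sub>R (LINT w|lborel. gauss (0 + sqrt N * w) * (?i (0 + sqrt N * w) * k (sqrt (2 * t) * (0 + sqrt N * w)))
        - c' * (gauss (0 + sqrt N * w) * ?i (0 + sqrt N * w)))"
      by (rule lborel_integral_real_affine) (use N in simp)
    also have "(\<lambda>w. gauss (0 + sqrt N * w) * (?i (0 + sqrt N * w) * k (sqrt (2 * t) * (0 + sqrt N * w)))
        - c' * (gauss (0 + sqrt N * w) * ?i (0 + sqrt N * w))) =
        (\<lambda>w. 1 / sqrt (2 * pi) * (?i w * (exp (- w\<^sup>2 / 2) ^ Suc n * f w)))"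
    proof
      fix w
      have g: "gauss (0 + sqrt N * w) = 1 / sqrt (2 * pi) * exp (- w\<^sup>2 / 2) ^ Suc n"
        using N by (simp add: std_normal_density_def power_mult_distrib N_def field_simps flip: exp_of_nat_mult exp_add del: of_nat_Suc power_Suc)
      have i: "?i (0 + sqrt N * w) = ?i w" using N by (simp add: indicator_def zero_le_mult_iff)
      have e: "sqrt (2 * t) * (0 + sqrt N * w) = q0 * w" using N by (simp add: q)
      show "gauss (0 + sqrt N * w) * (?i (0 + sqrt N * w) * k (sqrt (2 * t) * (0 + sqrt N * w)))
        - c' * (gauss (0 + sqrt N * w) * ?i (0 + sqrt N * w)) =
        1 / sqrt (2 * pi) * (?i w * (exp (- w\<^sup>2 / 2) ^ Suc n * f w))"
        unfolding g i e f_def by (simp only: algebra_simps)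
    qed
    finally have "\<bar>sqrt N\<bar> *\<^sub>R (1 / sqrt (2 * pi) * (LINT w|lborel. ?i w * (exp (- w\<^sup>2 / 2) ^ Suc n * f w))) = 0"
      by (simp only: integral_mult_right_zero)
    then show "(LINT w|lborel. ?i w * (exp (- w\<^sup>2 / 2) ^ Suc n * f w)) = 0"
      using N by (simp del: power_Suc)
  qed
  then have kc: "k z = c'" if "0 < z" for z
  proof -
    have "f (z / q0) = 0" using \<open>\<And>w0. 0 < w0 \<Longrightarrow> f w0 = 0\<close> that q0 by simp
    then show ?thesis using q0 by (simp add: f_def)
  qed
  then have "c' = 0" using kc[OF M_pos] ksupp[of M] by simp
  then show ?thesis using kc[OF z] by (simp add: k_def)
qed

text \<open>Two differentiations bring out a factor \<open>sqrt 2\<close> each from the right half,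
  and \<open>2 (2 sqrt 2 - 2) = sqrt 2 (4 - 2 sqrt 2)\<close> leaves the common factor
  \<open>4 - 2 sqrt 2\<close>. The point \<open>z = 0\<close> is reached by continuity.\<close>

lemma no_jump_imp_second_deriv_relation:
  assumes T: "0 < T" and J: "\<And>t. 0 < t \<Longrightarrow> t < T \<Longrightarrow> sol_t t 0 = 0" and z: "0 \<le> z"
  shows "sqrt 2 * (deriv ^^ 2) u0 (sqrt 2 * z) + (deriv ^^ 2) u0 (- z) = 0"
proof -
  note sm = test_function_imp_smooth[OF test]
  have sm1: "smooth (deriv u0)" and sm2: "smooth ((deriv ^^ 2) u0)"
    using smooth_deriv[OF sm] smooth_funpow_deriv[OF sm] by auto
  have d2: "(deriv u0 has_real_derivative (deriv ^^ 2) u0 x) (at x)" for x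
    using smooth_imp_DERIV[OF sm1] by (simp add: numeral_2_eq_2)
  let ?a = "4 - 2 * sqrt 2" and ?b = "2 * sqrt 2 - 2 :: real"
  define r0 where "r0 z = ?a * u0 ((- 1) * z) + ?b * u0 (sqrt 2 * z)" for z
  define r1 where "r1 z = ?a * ((- 1) * deriv u0 ((- 1) * z)) + ?b * (sqrt 2 * deriv u0 (sqrt 2 * z))" for z
  define r2 where "r2 z = ?a * ((- 1) * ((- 1) * (deriv ^^ 2) u0 ((- 1) * z))) +
      ?b * (sqrt 2 * (sqrt 2 * (deriv ^^ 2) u0 (sqrt 2 * z)))" for z
  have der0: "(r0 has_real_derivative r1 z) (at z)" for z
    unfolding r0_def r1_def
    by (intro DERIV_add DERIV_cmult DERIV_scaled smooth_imp_DERIV sm)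
  have der1: "(r1 has_real_derivative r2 z) (at z)" for z
    unfolding r1_def r2_def
    by (intro DERIV_add DERIV_cmult DERIV_scaled d2)
  have r0z: "r0 z = 0" if "0 < z" for z
    using no_jump_imp_relation[OF T J that] by (simp add: r0_def)
  have const0: "f' z = 0" if "\<And>z. (f has_real_derivative f' z) (at z)" "\<And>z. 0 < z \<Longrightarrow> f z = 0" "0 < z"
    for f f' :: "real \<Rightarrow> real" and z
  proof (rule DERIV_unique)
    show "(f has_real_derivative f' z) (at z)" by (rule that)
    show "(f has_real_derivative 0) (at z)"
      by (rule has_field_derivative_transform_within_open[of "\<lambda>_. 0" 0 z "{0<..}"]) (use that in auto)
  qed
  have r1z: "r1 z = 0" if "0 < z" for z by (rule const0[OF der0 r0z that])
  have r2z: "r2 z = 0" if "0 < z" for z by (rule const0[OF der1 r1z that])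
  have r2eq: "r2 z = ?a * (sqrt 2 * (deriv ^^ 2) u0 (sqrt 2 * z) + (deriv ^^ 2) u0 (- z))" for z
  proof -
    have "?b * (sqrt 2 * (sqrt 2 * A)) = ?a * (sqrt 2 * A)" for A
      using sqrt2(1) by (simp add: algebra_simps)
    then show ?thesis by (simp add: r2_def distrib_left)
  qed
  have "continuous_on UNIV (\<lambda>z. (deriv ^^ 2) u0 (c * z))" for c
    by (rule continuous_on_compose2[OF smooth_imp_continuous_on[OF sm2, of UNIV]]) (auto intro!: continuous_intros)
  then have "continuous_on UNIV r2"
    unfolding r2_def by (intro continuous_intros)
  then have "isCont r2 0" by (simp add: continuous_on_eq_continuous_at)
  then have "(\<lambda>n. r2 (inverse (real (Suc n)))) \<longlonglongrightarrow> r2 0"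
    by (rule isCont_tendsto_compose[OF _ LIMSEQ_inverse_real_of_nat])
  then have "r2 0 = 0" using r2z by (simp add: LIMSEQ_const_iff)
  then have "r2 z = 0" using r2z[of z] z by (cases "z = 0") auto
  moreover have "?a \<noteq> 0"
  proof
    assume "?a = 0"
    then have "sqrt 2 = (2 :: real)" by simp
    then show False using sqrt2(1) by simp
  qed
  ultimately show ?thesis by (simp add: r2eq)
qed

end

section \<open>Identification of all regular solutions, and a datum that admits none\<close>

lemma test_function_imp_interface_problem:
  assumes "test_function u0"
  obtains M where "interface_problem u0 M"
  using test_function_bounded_support[OF assms] assms unfolding interface_problem_def by metis

lemma interface_problem_solution:
  assumes "interface_problem u0 M" "0 < T" "strong_solution T u0 u" "regularity_sq s T u < \<infinity>" "0 \<le> s"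
    and "t \<in> {0<..T}"
  shows "u t x = interface_problem.sol u0 M t x"
proof -
  interpret interface_problem u0 M by fact
  obtain C where "\<And>t x. t \<in> {0..T} \<Longrightarrow> \<bar>u t x\<bar> \<le> C * (1 + \<bar>x\<bar>)"
    using regularity_growth[OF assms(2-5)] by blast
  then show ?thesis using strong_solution_eq_sol[OF assms(3,2)] assms(6) by blast
qed

lemma AE_zero_imp_zero:
  fixes F :: "real \<Rightarrow> real"
  assumes F: "continuous_on {0<..} F" and AE: "AE t in lborel. t \<in> {0<..T} \<longrightarrow> F t = 0" and t: "0 < t" "t < T"
  shows "F t = 0"
proof (rule ccontr)
  assume "F t \<noteq> 0"
  then obtain a b where ab: "0 < a" "a < b" "b < T" "\<And>s. s \<in> {a..b} \<Longrightarrow> F s \<noteq> 0"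
    using nonzero_on_interval[OF F t] by metis
  have "AE t in lborel. t \<notin> {a..b}"
    using AE by eventually_elim (use ab in auto)
  then have "emeasure lborel {a..b} = 0"
    by (subst (asm) AE_iff_null_sets[symmetric]) (auto simp: null_sets_def)
  then show False using ab(2) by simp
qed

text \<open>A single datum works for all times and all exponents from 1/2 on. As \<open>bump\<close>
  vanishes on the negative half-line, the relation between the two halves would force it to vanish
  on the positive one too.\<close>

lemma test_function_without_regular_solution:
  obtains u0 where "test_function u0"
    "\<And>T s u. 0 < T \<Longrightarrow> 1 / 2 \<le> s \<Longrightarrow> strong_solution T u0 u \<Longrightarrow> \<not> regularity_sq s T u < \<infinity>"
proof
  show tf: "test_function bump"
  proof (rule test_functionI[OF smooth_bump, of 0 1])
    show "x \<in> {0..1}" if "bump x \<noteq> 0" for x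
      using bump_eq_0[of x] that by (cases "x \<le> 0"; cases "1 \<le> x") auto
  qed
  fix T s :: real and u
  assume *: "0 < T" "1 / 2 \<le> s" "strong_solution T bump u"
  show "\<not> regularity_sq s T u < \<infinity>"
  proof
    assume reg: "regularity_sq s T u < \<infinity>"
    obtain M where ip: "interface_problem bump M" using test_function_imp_interface_problem[OF tf] .
    interpret interface_problem bump M by (rule ip)
    have "u t x = sol t x" if "t \<in> {0<..T}" for t x
      by (rule interface_problem_solution[OF ip *(1) *(3) reg _ that]) (use *(2) in simp)
    then have J: "sol_t t 0 = 0" if "0 < t" "t < T" for t
      using regular_imp_no_jump[OF *(1) _ reg *(2) that] by blast
    \<comment> \<open>Chosen so that \<open>sqrt 2 * ?z\<close> is the midpoint of the
      support.\<close>
    let ?z = "1 / (2 * sqrt 2) :: real"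
    have "(2 * sqrt 2 - 2) * bump (sqrt 2 * ?z) = 0"
      using no_jump_imp_relation[OF *(1) J, of ?z] by (simp add: bump_eq_0)
    moreover have "sqrt 2 * ?z = 1 / 2" by simp
    moreover have "0 < bump (1 / 2)" by (rule bump_pos) auto
    moreover have "1 < sqrt (2 :: real)" by simp
    ultimately show False by simp
  qed
qed

theorem mainTheorem3:
  fixes T :: real
  assumes "0 < T"
  shows
    "(\<forall>u0 u c. test_function u0 \<and> unique_bounded_strong_solution c T u0 u \<longrightarrow>
        (\<forall>t\<in>{0<..T}. (\<forall>x<0. u t x = explicit_left u0 t x) \<and>
                       (\<forall>x>0. u t x = explicit_right u0 t x)) \<and>
        (AE t in lborel. t \<in> {0<..T} \<longrightarrow> second_deriv_matches (u t))) \<and>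
     (\<forall>u0. test_function u0 \<and>
        (AE t in lborel. t \<in> {0<..T} \<longrightarrow> second_deriv_matches (explicit_solution u0 t)) \<longrightarrow>
        (\<forall>z\<ge>0. sqrt 2 * (deriv ^^ 2) u0 (sqrt 2 * z) + (deriv ^^ 2) u0 (- z) = 0)) \<and>
     (\<forall>c. (\<forall>u0. test_function u0 \<longrightarrow> (\<exists>u. unique_bounded_strong_solution c T u0 u)) \<longrightarrow>
        (\<forall>u0. test_function u0 \<longrightarrow>
          (\<forall>z\<ge>0. sqrt 2 * (deriv ^^ 2) u0 z + (deriv ^^ 2) u0 (- z) = 0))) \<and>
     (\<exists>u0. test_function u0 \<and>
        (\<forall>s\<ge>1/2. \<not> (\<exists>u. strong_solution T u0 u \<and> regularity_sq s T u < \<infinity>)))"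
proof (intro conjI)
  have bounded: "strong_solution T u0 u" "regularity_sq (1 / 2) T u < \<infinity>"
    if "unique_bounded_strong_solution c T u0 u" for c u0 u
  proof -
    have le: "regularity_sq (1 / 2) T u \<le> ennreal (c * (homogeneous_norm 1 u0 + homogeneous_norm (3/2) u0)\<^sup>2)"
      and "strong_solution T u0 u"
      using that by (simp_all add: unique_bounded_strong_solution_def bounded_strong_solution_def)
    then show "strong_solution T u0 u" by simp
    show "regularity_sq (1 / 2) T u < \<infinity>"
      by (rule le_less_trans[OF le]) simp
  qed
  show "\<forall>u0 u c. test_function u0 \<and> unique_bounded_strong_solution c T u0 u \<longrightarrow>
        (\<forall>t\<in>{0<..T}. (\<forall>x<0. u t x = explicit_left u0 t x) \<and>
                       (\<forall>x>0. u t x = explicit_right u0 t x)) \<and>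
        (AE t in lborel. t \<in> {0<..T} \<longrightarrow> second_deriv_matches (u t))"
  proof (intro allI impI, elim conjE)
    fix u0 u c
    assume tf: "test_function u0" and ub: "unique_bounded_strong_solution c T u0 u"
    obtain M where ip: "interface_problem u0 M" using test_function_imp_interface_problem[OF tf] .
    interpret interface_problem u0 M by (rule ip)
    have eq: "u t x = sol t x" if "t \<in> {0<..T}" for t x
      by (rule interface_problem_solution[OF ip assms bounded[OF ub] _ that]) simp
    have J: "sol_t t 0 = 0" if "0 < t" "t < T" for t
      by (rule regular_imp_no_jump[OF assms eq bounded(2)[OF ub] _ that]) auto
    \<comment> \<open>Absence of the jump is known for \<open>t < T\<close>; the final time is a
      null set.\<close>
    have "AE t in lborel. t \<in> {0<..T} \<longrightarrow> second_deriv_matches (u t)"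
      using AE_lborel_singleton[of T]
    proof eventually_elim
      fix t assume "t \<noteq> T"
      show "t \<in> {0<..T} \<longrightarrow> second_deriv_matches (u t)"
      proof
        assume t: "t \<in> {0<..T}"
        then have "second_deriv_matches (u t) \<longleftrightarrow> sol_t t 0 = 0"
          by (intro second_deriv_matches_iff eq) auto
        then show "second_deriv_matches (u t)" using J[of t] t \<open>t \<noteq> T\<close> by auto
      qed
    qed
    moreover have "\<forall>t\<in>{0<..T}. (\<forall>x<0. u t x = explicit_left u0 t x) \<and> (\<forall>x>0. u t x = explicit_right u0 t x)"
      using eq by (auto simp: explicit_left_eq explicit_right_eq sol_def)
    ultimately show "(\<forall>t\<in>{0<..T}. (\<forall>x<0. u t x = explicit_left u0 t x) \<and>
                       (\<forall>x>0. u t x = explicit_right u0 t x)) \<and>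
        (AE t in lborel. t \<in> {0<..T} \<longrightarrow> second_deriv_matches (u t))" by blast
  qed
  show "\<forall>u0. test_function u0 \<and>
        (AE t in lborel. t \<in> {0<..T} \<longrightarrow> second_deriv_matches (explicit_solution u0 t)) \<longrightarrow>
        (\<forall>z\<ge>0. sqrt 2 * (deriv ^^ 2) u0 (sqrt 2 * z) + (deriv ^^ 2) u0 (- z) = 0)"
  proof (intro allI impI, elim conjE)
    fix u0 and z :: real
    assume tf: "test_function u0" and z: "0 \<le> z"
      and AE: "AE t in lborel. t \<in> {0<..T} \<longrightarrow> second_deriv_matches (explicit_solution u0 t)"
    obtain M where ip: "interface_problem u0 M" using test_function_imp_interface_problem[OF tf] .
    interpret interface_problem u0 M by (rule ip)
    \<comment> \<open>The formula is differentiated directly, so the condition on the datum follows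
      without reference to any solution of the Cauchy problem.\<close>
    have iff: "second_deriv_matches (explicit_solution u0 t) \<longleftrightarrow> sol_t t 0 = 0" if "0 < t" for t
      by (rule second_deriv_matches_iff[OF that])
         (simp add: explicit_solution_def sol_def explicit_left_eq[OF that] explicit_right_eq[OF that])
    have "AE t in lborel. t \<in> {0<..T} \<longrightarrow> sol_t t 0 = 0"
      using AE by eventually_elim (auto simp: iff)
    then have "sol_t t 0 = 0" if "0 < t" "t < T" for t
      using AE_zero_imp_zero[OF continuous_on_sol_slices(6) _ that] by blast
    then show "sqrt 2 * (deriv ^^ 2) u0 (sqrt 2 * z) + (deriv ^^ 2) u0 (- z) = 0"
      using no_jump_imp_second_deriv_relation[OF assms _ z] by blast
  qed
  obtain u1 where u1: "test_function u1"
    "\<And>T s u. 0 < T \<Longrightarrow> 1 / 2 \<le> s \<Longrightarrow> strong_solution T u1 u \<Longrightarrow> \<not> regularity_sq s T u < \<infinity>"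
    using test_function_without_regular_solution by blast
  \<comment> \<open>Solvability for all data includes the datum \<open>u1\<close>, which has no
    solution of the required regularity. The premise is thus contradictory for every
    \<open>c\<close>, and the relation with argument \<open>z\<close>, instead of the
    \<open>sqrt 2 * z\<close> that the trace yields for a given datum, is obtained from this
    contradiction.\<close>
  show "\<forall>c. (\<forall>u0. test_function u0 \<longrightarrow> (\<exists>u. unique_bounded_strong_solution c T u0 u)) \<longrightarrow>
        (\<forall>u0. test_function u0 \<longrightarrow>
          (\<forall>z\<ge>0. sqrt 2 * (deriv ^^ 2) u0 z + (deriv ^^ 2) u0 (- z) = 0))"
    using u1 bounded assms by (meson order_refl)
  show "\<exists>u0. test_function u0 \<and>
        (\<forall>s\<ge>1/2. \<not> (\<exists>u. strong_solution T u0 u \<and> regularity_sq s T u < \<infinity>))"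
    using u1 assms by blast
qed

end
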